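(* Let $F$ be a germ of holomorphic diffeomorphism of $\mathbb{C}^n$ fixing $0$, with diagonal differential $dF_0=\mathrm{diag}(\lambda_1,\ldots,\lambda_n)$. Suppose that $\lambda_1^q=1$ for some $q\in\mathbb{N}\setminus\{0\}$, that $\lambda_1^l\neq1$ for $l=1,\ldots,q-1$, and that $|\lambda_j|<1$ for $j=2,\ldots,n$. In particular, $F$ is one-resonant with respect to $\{\lambda_1\}$. Let $k$ be the order of $F$ with respect to $\lambda_1$. Then: (1) either $k<\infty$ and there exist $k$ basins of attraction for $F$ at $0$, each having $q$ connected components which are cyclically permuted by $F$; (2) or $k=\infty$ and $F$ is formally linearizable in the first component. This is the case if and only if there exists a holomorphic germ of a non-singular curve of fixed points of $F^{\circ q}$ passing through $0$.
   Context: Notation: $\mathbb{N}=\{0,1,2,\ldots\}$. $F^{\circ p}$ denotes the $p$-th iterate of $F$. For $l\in\mathbb{N}^n$, $|l|=\sum l_j$ and $\lambda^l=\lambda_1^{l_1}\cdots\lambda_n^{l_n}$; $e_1=(1,0,\ldots,0)$. Resonance: a pair $(j,l)$ with $j\in\{1,\ldots,n\}$, $l\in\mathbb{N}^n$, $|l|\ge2$ and $\lambda_j=\lambda^l$. One-resonant with respect to $\{\lambda_1\}$: there is a multi-index $\alpha=(\alpha_1,0,\ldots,0)\in\mathbb{N}^n$, $\alpha\ne0$ (the index of resonance), such that the resonances of the form $(1,l)$ are precisely the pairs $(1,s\alpha+e_1)$ with $s\ge1$ an integer. In the present situation $\alpha=(q,0,\ldots,0)$. Order: $F$ is formally linearizable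 in the first component if it is conjugate, by a formal power series change of coordinates fixing $0$ with invertible linear part, to a (formal) map whose first component is $\lambda_1z_1$; in this case its order with respect to $\lambda_1$ is $k=\infty$. Otherwise, there are holomorphic coordinates at $0$ in which $$F_1(z)=\lambda_1z_1+a_1z_1^{kq+1}+O(|z|^{kq+2}),\qquad a_1\neq0,$$ with $k\ge1$ an integer; $k$ is independent of the choice of such coordinates and is the order of $F$ with respect to $\lambda_1$. Basin of attraction: a basin of attraction for $F$ at $0$ is a nonempty (not necessarily connected) open set $U\subset\mathbb{C}^n$ with $0\in\overline U$ for which there exists a neighborhood basis $\{\Omega_i\}$ of $0$ such that $F(U\cap\Omega_i)\subset U\cap\Omega_i$ for all $i$, and $F^{\circ p}(z)\to0$ as $p\to\infty$ whenever $z\in U\cap\Omega_i$ for some $i$. That the connected components of a basin are cyclically permuted by $F$ means that they can be labelled $D_0,\ldots,D_{q-1}$ so that $F$ maps $D_p$ into $D_{p+1}$ for $p=0,\ldots,q-1$, where $D_q=D_0$. *)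

theory Defs
  imports "HOL-Analysis.Analysis" "HOL-Library.Landau_Symbols"
begin

text \<open>
  A multi-index is a function of type \<open>'n \<Rightarrow> nat\<close>, where the finite type \<open>'n\<close> labels the
  coordinates of $\mathbb{C}^n$.
\<close>

definition mi_deg :: "('n::finite \<Rightarrow> nat) \<Rightarrow> nat" where
  "mi_deg l = (\<Sum>j\<in>UNIV. l j)"

definition mi_unit :: "'n \<Rightarrow> 'n \<Rightarrow> nat" where
  "mi_unit i = (\<lambda>j. if j = i then 1 else 0)"

definition mi_power :: "complex ^ 'n::finite \<Rightarrow> ('n \<Rightarrow> nat) \<Rightarrow> complex" where
  "mi_power z l = (\<Prod>j\<in>UNIV. (z $ j) ^ l j)"

typedef 'n mfps = "UNIV :: (('n \<Rightarrow> nat) \<Rightarrow> complex) set"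
  morphisms mfps_nth Abs_mfps by simp

setup_lifting type_definition_mfps

lemma mfps_eqI: "(\<And>l. mfps_nth f l = mfps_nth g l) \<Longrightarrow> f = g"
  by (simp add: ext flip: mfps_nth_inject)

lemma finite_mi_le: "finite {a :: 'n::finite \<Rightarrow> nat. a \<le> m}"
proof -
  have "{a. a \<le> m} = PiE UNIV (\<lambda>j. {..m j})"
    by (auto simp: le_fun_def PiE_def Pi_def)
  then show ?thesis by (simp add: finite_PiE)
qed

instantiation mfps :: (finite) comm_ring_1
begin

lift_definition zero_mfps :: "'a mfps" is "\<lambda>_. 0" .
lift_definition one_mfps :: "'a mfps" is "\<lambda>l. if l = (\<lambda>_. 0) then 1 else 0" .
lift_definition plus_mfps :: "'a mfps \<Rightarrow> 'a mfps \<Rightarrow> 'a mfps" is "\<lambda>f g l. f l + g l" .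
lift_definition minus_mfps :: "'a mfps \<Rightarrow> 'a mfps \<Rightarrow> 'a mfps" is "\<lambda>f g l. f l - g l" .
lift_definition uminus_mfps :: "'a mfps \<Rightarrow> 'a mfps" is "\<lambda>f l. - f l" .
lift_definition times_mfps :: "'a mfps \<Rightarrow> 'a mfps \<Rightarrow> 'a mfps"
  is "\<lambda>f g l. \<Sum>a | a \<le> l. f a * g (\<lambda>j. l j - a j)" .

instance
proof
  fix f g h :: "'a mfps"
  show "f * g * h = f * (g * h)"
  proof (rule mfps_eqI)
    fix l :: "'a \<Rightarrow> nat"
    let ?F = "mfps_nth f" and ?G = "mfps_nth g" and ?H = "mfps_nth h"
    have "mfps_nth (f * g * h) l =
        (\<Sum>(b, a)\<in>(SIGMA b:{b. b \<le> l}. {a. a \<le> b}).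
           ?F a * ?G (\<lambda>j. b j - a j) * ?H (\<lambda>j. l j - b j))"
      by (simp add: times_mfps.rep_eq sum_distrib_right sum.Sigma finite_mi_le)
    also have "\<dots> = (\<Sum>(a, c)\<in>(SIGMA a:{a. a \<le> l}. {c. c \<le> (\<lambda>j. l j - a j)}).
           ?F a * (?G c * ?H (\<lambda>j. l j - a j - c j)))"
      by (rule sum.reindex_bij_witness[where
            i = "\<lambda>(a, c). (\<lambda>j. a j + c j, a)" and j = "\<lambda>(b, a). (a, \<lambda>j. b j - a j)"])
        (auto simp: le_fun_def fun_eq_iff mult.assoc intro: order_trans diff_le_mono
          simp: le_diff_conv2 add.commute)
    also have "\<dots> = mfps_nth (f * (g * h)) l"
      by (simp add: times_mfps.rep_eq sum_distrib_left sum.Sigma finite_mi_le)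
    finally show "mfps_nth (f * g * h) l = mfps_nth (f * (g * h)) l" .
  qed
  show "f * g = g * f"
  proof (rule mfps_eqI)
    fix l :: "'a \<Rightarrow> nat"
    show "mfps_nth (f * g) l = mfps_nth (g * f) l"
      unfolding times_mfps.rep_eq
      by (rule sum.reindex_bij_witness[where
            i = "\<lambda>a j. l j - a j" and j = "\<lambda>a j. l j - a j"])
        (auto simp: le_fun_def fun_eq_iff mult.commute)
  qed
  show "1 * f = f"
  proof (rule mfps_eqI)
    fix l :: "'a \<Rightarrow> nat"
    have "mfps_nth (1 * f) l =
        (\<Sum>a | a \<le> l. if a = (\<lambda>_. 0) then mfps_nth f l else 0)"
      unfolding times_mfps.rep_eq one_mfps.rep_eq by (rule sum.cong) auto
    also have "\<dots> = mfps_nth f l"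
      using finite_mi_le[of l] by (subst sum.delta) (auto simp: le_fun_def)
    finally show "mfps_nth (1 * f) l = mfps_nth f l" .
  qed
  show "(f + g) * h = f * h + g * h"
    by (rule mfps_eqI)
      (simp add: times_mfps.rep_eq plus_mfps.rep_eq distrib_right sum.distrib)
  show "f + g + h = f + (g + h)" "f + g = g + f" "0 + f = f" "- f + f = 0"
      "f - g = f + - g"
    by (rule mfps_eqI; simp add: plus_mfps.rep_eq minus_mfps.rep_eq uminus_mfps.rep_eq
          zero_mfps.rep_eq)+
  have "mfps_nth (0 :: 'a mfps) (\<lambda>_. 0) \<noteq> mfps_nth 1 (\<lambda>_. 0)"
    by (simp add: zero_mfps.rep_eq one_mfps.rep_eq)
  then show "(0 :: 'a mfps) \<noteq> 1" by metis
qed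

end

lift_definition mfps_const :: "complex \<Rightarrow> 'n mfps" is "\<lambda>c l. if l = (\<lambda>_. 0) then c else 0" .

lift_definition mfps_X :: "'n \<Rightarrow> 'n mfps" is "\<lambda>i l. if l = mi_unit i then 1 else 0" .

text \<open>
  The composition $f \circ \Phi = \sum_l f_l \Phi^l$ is meaningful when the components of $\Phi$
  have no constant term. Then $\Phi^l$ has order at least $|l|$, so only multi-indices
  with $|l| \le |m|$ contribute to the coefficient of $z^m$.
\<close>

definition mfps_compose :: "'n::finite mfps \<Rightarrow> 'n mfps ^ 'n \<Rightarrow> 'n mfps" where
  "mfps_compose f \<Phi> = Abs_mfps (\<lambda>m. \<Sum>l | mi_deg l \<le> mi_deg m.
     mfps_nth f l * mfps_nth (\<Prod>j\<in>UNIV. (\<Phi> $ j) ^ l j) m)"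

definition formal_map_compose :: "'n::finite mfps ^ 'n \<Rightarrow> 'n mfps ^ 'n \<Rightarrow> 'n mfps ^ 'n" where
  "formal_map_compose G \<Phi> = (\<chi> j. mfps_compose (G $ j) \<Phi>)"

definition formal_coord_change :: "'n::finite mfps ^ 'n \<Rightarrow> bool" where
  "formal_coord_change \<Phi> \<longleftrightarrow> (\<forall>i. mfps_nth (\<Phi> $ i) (\<lambda>_. 0) = 0) \<and>
     invertible ((\<chi> i j. mfps_nth (\<Phi> $ i) (mi_unit j)) :: complex ^ 'n ^ 'n)"

definition has_mfps_expansion :: "(complex ^ 'n::finite \<Rightarrow> complex) \<Rightarrow> 'n mfps \<Rightarrow> bool" where
  "has_mfps_expansion f T \<longleftrightarrow>
     (\<exists>r>0. \<forall>z\<in>ball 0 r. ((\<lambda>l. mfps_nth T l * mi_power z l) has_sum f z) UNIV)"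

definition holomorphic_map_on ::
    "(complex ^ 'n::finite \<Rightarrow> complex ^ 'm::finite) \<Rightarrow> (complex ^ 'n) set \<Rightarrow> bool" where
  "holomorphic_map_on f S \<longleftrightarrow>
     (\<forall>z\<in>S. \<exists>A :: complex ^ 'n ^ 'm. (f has_derivative (\<lambda>v. A *v v)) (at z within S))"

definition biholomorphic_map_on ::
    "(complex ^ 'n::finite \<Rightarrow> complex ^ 'n) \<Rightarrow> (complex ^ 'n) set \<Rightarrow> bool" where
  "biholomorphic_map_on f W \<longleftrightarrow> open W \<and> open (f ` W) \<and> inj_on f W \<and>
     holomorphic_map_on f W \<and> holomorphic_map_on (inv_into W f) (f ` W)"

text \<open>
  A germ of holomorphic diffeomorphism fixing the origin is given by a representative: a map
  together with an open neighbourhood \<open>W\<close> of the origin on which it is biholomorphic. The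
  values of \<open>F\<close> outside \<open>W\<close> carry no meaning.
\<close>

definition diffeo_germ_rep ::
    "(complex ^ 'n::finite \<Rightarrow> complex ^ 'n) \<Rightarrow> (complex ^ 'n) set \<Rightarrow> bool" where
  "diffeo_germ_rep F W \<longleftrightarrow> 0 \<in> W \<and> F 0 = 0 \<and> biholomorphic_map_on F W"

text \<open>The distinguished first coordinate is an arbitrary index \<open>i\<close>.\<close>

definition resonance :: "complex ^ 'n::finite \<Rightarrow> 'n \<Rightarrow> ('n \<Rightarrow> nat) \<Rightarrow> bool" where
  "resonance lam j l \<longleftrightarrow> mi_deg l \<ge> 2 \<and> lam $ j = mi_power lam l"

definition one_resonant_index :: "complex ^ 'n::finite \<Rightarrow> 'n \<Rightarrow> ('n \<Rightarrow> nat) \<Rightarrow> bool" where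
  "one_resonant_index lam i \<alpha> \<longleftrightarrow> \<alpha> \<noteq> (\<lambda>_. 0) \<and> (\<forall>j. j \<noteq> i \<longrightarrow> \<alpha> j = 0) \<and>
     (\<forall>l. resonance lam i l \<longleftrightarrow> (\<exists>s\<ge>1. l = (\<lambda>j. s * \<alpha> j + mi_unit i j)))"

text \<open>
  Here \<open>T\<close> is the (unique) Taylor expansion of \<open>F\<close>; the equation $\Phi \circ T = G \circ \Phi$
  says that \<open>\<Phi>\<close> conjugates it to \<open>G\<close>.
\<close>

definition formally_linearizable_comp ::
    "'n \<Rightarrow> complex \<Rightarrow> (complex ^ 'n::finite \<Rightarrow> complex ^ 'n) \<Rightarrow> bool" where
  "formally_linearizable_comp i \<mu> F \<longleftrightarrow>
     (\<exists>T \<Phi> G. (\<forall>j. has_mfps_expansion (\<lambda>z. F z $ j) (T $ j)) \<and>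
        formal_coord_change \<Phi> \<and>
        formal_map_compose \<Phi> T = formal_map_compose G \<Phi> \<and>
        G $ i = mfps_const \<mu> * mfps_X i)"

definition has_leading_term ::
    "'n \<Rightarrow> complex \<Rightarrow> nat \<Rightarrow> (complex ^ 'n::finite \<Rightarrow> complex ^ 'n) \<Rightarrow> nat \<Rightarrow> bool" where
  "has_leading_term i \<mu> q F k \<longleftrightarrow>
     (\<exists>\<psi> V a. diffeo_germ_rep \<psi> V \<and> a \<noteq> 0 \<and>
        (\<lambda>z. norm (\<psi> (F (inv_into V \<psi> z)) $ i - (\<mu> * z $ i + a * (z $ i) ^ (k * q + 1))))
          \<in> O[nhds 0](\<lambda>z. norm z ^ (k * q + 2)))"

definition resonance_order ::
    "'n \<Rightarrow> complex \<Rightarrow> nat \<Rightarrow> (complex ^ 'n::finite \<Rightarrow> complex ^ 'n) \<Rightarrow> enat" where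
  "resonance_order i \<mu> q F =
     (if formally_linearizable_comp i \<mu> F then \<infinity>
      else enat (THE k. k \<ge> 1 \<and> has_leading_term i \<mu> q F k))"

definition nhds_basis :: "'a::topological_space \<Rightarrow> 'a set set \<Rightarrow> bool" where
  "nhds_basis x B \<longleftrightarrow> (\<forall>\<Omega>\<in>B. x \<in> interior \<Omega>) \<and>
     (\<forall>V. open V \<and> x \<in> V \<longrightarrow> (\<exists>\<Omega>\<in>B. \<Omega> \<subseteq> V))"

text \<open>
  The basin is required to lie in the domain \<open>W\<close> of the representative, so that all
  the iterates below are iterates of the germ.
\<close>

definition basin_of_attraction ::
    "(complex ^ 'n::finite) set \<Rightarrow> (complex ^ 'n \<Rightarrow> complex ^ 'n) \<Rightarrow> (complex ^ 'n) set \<Rightarrow> bool"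
where
  "basin_of_attraction W F U \<longleftrightarrow> U \<noteq> {} \<and> open U \<and> U \<subseteq> W \<and> 0 \<in> closure U \<and>
     (\<exists>B. nhds_basis 0 B \<and>
        (\<forall>\<Omega>\<in>B. F ` (U \<inter> \<Omega>) \<subseteq> U \<inter> \<Omega> \<and>
           (\<forall>z\<in>U \<inter> \<Omega>. (\<lambda>p. (F ^^ p) z) \<longlonglongrightarrow> 0)))"

definition components_cyclically_permuted ::
    "('a::topological_space \<Rightarrow> 'a) \<Rightarrow> 'a set \<Rightarrow> nat \<Rightarrow> bool" where
  "components_cyclically_permuted F U q \<longleftrightarrow>
     (\<exists>D. bij_betw D {..<q} (components U) \<and> (\<forall>p<q. F ` D p \<subseteq> D (Suc p mod q)))"

text \<open>
  The germ of a non-singular holomorphic curve through the origin is given by an immersive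
  holomorphic parametrization. The condition is insensitive to the values of \<open>f\<close> away
  from the origin, since \<open>r\<close> may be decreased.
\<close>

definition fixed_curve_germ :: "(complex ^ 'n::finite \<Rightarrow> complex ^ 'n) \<Rightarrow> bool" where
  "fixed_curve_germ f \<longleftrightarrow>
     (\<exists>\<gamma> r. r > 0 \<and> (\<forall>j. (\<lambda>t. \<gamma> t $ j) holomorphic_on ball 0 r) \<and>
        \<gamma> 0 = 0 \<and> (\<exists>j. deriv (\<lambda>t. \<gamma> t $ j) 0 \<noteq> 0) \<and>
        (\<forall>t\<in>ball 0 r. f (\<gamma> t) = \<gamma> t))"

end

theory Submission
  imports Defs "HOL-Complex_Analysis.Conformal_Mappings"
begin

text \<open>
  Since \<open>\<bar>\<lambda>\<^sub>j\<bar> < 1\<close> for \<open>j \<noteq> i\<close>, the equations \<open>(F\<^sup>q)\<^sub>j z = z\<^sub>j\<close>, \<open>j \<noteq> i\<close>, define by the inverse function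
  theorem a smooth curve \<open>\<gamma>\<close> with \<open>\<gamma>(t)\<^sub>i = t\<close>, on which \<open>F\<^sup>q\<close> moves only the distinguished coordinate,
  by some \<open>h(t)\<close>. If \<open>u = c z\<^sub>i + \<dots>\<close> is holomorphic and \<open>u \<circ> F = \<mu> u + a z\<^sub>i\<^sup>m + O(\<bar>z\<bar>\<^sup>m\<^sup>+\<^sup>1)\<close> with
  \<open>m = k q + 1\<close>, iterating \<open>q\<close> times and evaluating on \<open>\<gamma>\<close> shows that \<open>h\<close> has order exactly \<open>m\<close>
  if \<open>a \<noteq> 0\<close>, and order larger than \<open>m\<close> if \<open>a = 0\<close>. Hence \<open>k\<close> is unique, and formal linearizability
  forces \<open>h = 0\<close>. Conversely, solving the homological equation for \<open>u\<close> monomial by monomial either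
  meets a first obstruction at a resonant monomial, which is incompatible with a curve of fixed
  points, or produces a formal linearization.

  If there is an obstruction, then in the cone where the distinguished coordinate \<open>x\<close> dominates the
  others \<open>F\<close> acts on \<open>c / x\<^sup>k\<^sup>q\<close> almost as the translation by 1, as in the Leau-Fatou flower theorem.
\<close>

section \<open>Complex differentiable functions of several variables\<close>

text \<open>The function \<open>h\<close> links the formal and the holomorphic side. A normalizing
  series may diverge, but each truncation of it is a polynomial, hence a legitimate
  \<open>u\<close>, and all truncations give information on the same holomorphic function
  \<open>h\<close> of one variable; once \<open>h\<close> vanishes to every order it is zero. The
  curve is built from \<open>F ^^ q\<close> alone, before any choice of coordinates, so
  \<open>h\<close> can compare two normal forms. This comparison is what evaluates the
  \<open>THE\<close> in the definition of the order.

  The flower argument is run for \<open>F\<close> itself and not for \<open>F ^^ q\<close>: the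
  multiplier \<mu> sends the petal labelled \<omega> into the one labelled \<mu> \<omega>. With
  \<open>K = k * q\<close> there are \<open>K\<close> petals, labelled by the \<open>K\<close>-th
  roots of unity, and the cosets of the group generated by \<mu> cut the labels into
  \<open>k\<close> cycles of length \<open>q\<close>; each cycle is one basin. The cone is invariant
  because the distinguished coordinate is multiplied by a factor of modulus close to 1, whereas the
  others shrink by a factor bounded away from 1.\<close>

definition cdiff_at :: "(complex ^ 'n::finite \<Rightarrow> complex) \<Rightarrow> complex ^ 'n \<Rightarrow> bool" where
  "cdiff_at f z \<longleftrightarrow> (\<exists>D. (f has_derivative D) (at z) \<and> (\<forall>c v. D (c *s v) = c * D v))"

lemma scaleR_eq_smult_complex: "r *\<^sub>R (v :: complex ^ 'n) = complex_of_real r *s v"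
  by (simp add: vec_eq_iff) (simp add: scaleR_conv_of_real)

lemma norm_vec_le_sum: "norm (x :: 'a::real_normed_vector ^ 'n::finite) \<le> (\<Sum>j\<in>UNIV. norm (x $ j))"
  unfolding norm_vec_def by (rule L2_set_le_sum) simp

lemma norm_smult_axis_le: "norm (t *s (axis j 1 :: complex ^ 'n::finite)) \<le> norm t"
  using norm_vec_le_sum[of "t *s (axis j 1 :: complex ^ 'n)"]
  by (simp add: axis_def norm_mult if_distrib[of norm] if_distrib[of "(*) (norm t)"] cong: if_cong)

lemma has_derivative_vec_lambda:
  fixes f :: "'i::finite \<Rightarrow> 'a::real_normed_vector \<Rightarrow> 'b::real_normed_vector"
  assumes "\<And>i. (f i has_derivative D i) F"
  shows "((\<lambda>x. \<chi> i. f i x) has_derivative (\<lambda>v. \<chi> i. D i v)) F"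
proof -
  have nax: "norm (axis i x :: 'b ^ 'i) \<le> norm x" for i and x :: 'b
    using norm_vec_le_sum[of "axis i x"] by (simp add: axis_def if_distrib[of norm] cong: if_cong)
  have eq: "(\<chi> i. g i) = (\<Sum>i\<in>UNIV. axis i (g i))" for g :: "'i \<Rightarrow> 'b"
    by (simp add: vec_eq_iff axis_def)
  have bl: "bounded_linear (axis i :: 'b \<Rightarrow> 'b ^ 'i)" for i
  proof (rule bounded_linear_intro)
    show "norm (axis i x :: 'b ^ 'i) \<le> norm x * 1" for x :: 'b
      by (simp add: nax)
  qed (auto simp: vec_eq_iff axis_def)
  show ?thesis unfolding eq
    by (intro has_derivative_sum bounded_linear.has_derivative[OF bl] assms)
qed

lemma complex_linear_expand:
  fixes D :: "complex ^ 'n::finite \<Rightarrow> 'b::real_normed_vector"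
  assumes "linear D"
  shows "D v = (\<Sum>j\<in>UNIV. D (v $ j *s axis j 1))"
  by (subst basis_expansion[symmetric]) (rule linear_sum[OF assms])

text \<open>Complex homogeneity of the component derivatives is exactly what lets a complex matrix
  represent them: its entries are their values on the coordinate vectors. From here on holomorphic
  maps are handled through scalar components.\<close>

lemma holomorphic_map_on_cdiff_at:
  assumes "open S"
  shows "holomorphic_map_on f S \<longleftrightarrow> (\<forall>z\<in>S. \<forall>j. cdiff_at (\<lambda>z. f z $ j) z)"
proof
  assume *: "holomorphic_map_on f S"
  show "\<forall>z\<in>S. \<forall>j. cdiff_at (\<lambda>z. f z $ j) z"
  proof (intro ballI allI)
    fix z j assume "z \<in> S"
    then obtain A where A: "(f has_derivative (*v) A) (at z)"
      using * assms unfolding holomorphic_map_on_def by (metis at_within_open)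
    have "((\<lambda>z. f z $ j) has_derivative (\<lambda>v. (A *v v) $ j)) (at z)"
      by (rule bounded_linear.has_derivative[OF bounded_linear_vec_nth A])
    moreover have "(A *v (c *s v)) $ j = c * (A *v v) $ j" for c v
      by (simp add: vector_scalar_commute)
    ultimately show "cdiff_at (\<lambda>z. f z $ j) z" unfolding cdiff_at_def by blast
  qed
next
  assume *: "\<forall>z\<in>S. \<forall>j. cdiff_at (\<lambda>z. f z $ j) z"
  show "holomorphic_map_on f S" unfolding holomorphic_map_on_def
  proof
    fix z assume "z \<in> S"
    then obtain D where D: "\<And>j. ((\<lambda>z. f z $ j) has_derivative D j) (at z)"
      "\<And>j c v. D j (c *s v) = c * D j v"
      using * unfolding cdiff_at_def by metis
    have lin: "linear (D j)" for j using D(1) has_derivative_linear by blast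
    have "(f has_derivative (\<lambda>v. \<chi> j. D j v)) (at z)"
      by (rule has_derivative_vec_lambda[where f="\<lambda>i x. f x $ i", simplified]) (use D in auto)
    moreover have "(\<chi> j. D j v) = (\<chi> j k. D j (axis k 1)) *v v" for v
      by (simp add: vec_eq_iff matrix_vector_mult_def complex_linear_expand[OF lin, of _ v] D(2) mult.commute)
    ultimately show "\<exists>A. (f has_derivative (*v) A) (at z within S)"
      using has_derivative_at_withinI by (metis (no_types, lifting) ext)
  qed
qed

lemma cdiff_at_const [intro]: "cdiff_at (\<lambda>_. c) z"
  unfolding cdiff_at_def by (rule exI[of _ "\<lambda>_. 0"]) auto

lemma cdiff_at_nth [intro]: "cdiff_at (\<lambda>z. z $ j) z"
  unfolding cdiff_at_def
  by (rule exI[of _ "\<lambda>v. v $ j"]) (auto intro: bounded_linear_imp_has_derivative bounded_linear_vec_nth)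

lemma cdiff_at_add [intro]:
  assumes "cdiff_at f z" "cdiff_at g z" shows "cdiff_at (\<lambda>z. f z + g z) z"
proof -
  obtain D E where "(f has_derivative D) (at z)" "\<forall>c v. D (c *s v) = c * D v"
    "(g has_derivative E) (at z)" "\<forall>c v. E (c *s v) = c * E v" using assms unfolding cdiff_at_def by blast
  then show ?thesis unfolding cdiff_at_def
    by (intro exI[of _ "\<lambda>v. D v + E v"]) (auto intro!: derivative_intros simp: algebra_simps)
qed

lemma cdiff_at_mult [intro]:
  assumes "cdiff_at f z" "cdiff_at g z" shows "cdiff_at (\<lambda>z. f z * g z) z"
proof -
  obtain D E where "(f has_derivative D) (at z)" "\<forall>c v. D (c *s v) = c * D v"
    "(g has_derivative E) (at z)" "\<forall>c v. E (c *s v) = c * E v" using assms unfolding cdiff_at_def by blast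
  then show ?thesis unfolding cdiff_at_def
    by (intro exI[of _ "\<lambda>v. f z * E v + D v * g z"] conjI has_derivative_mult) (auto simp: algebra_simps)
qed

lemma cdiff_at_diff [intro]:
  assumes "cdiff_at f z" "cdiff_at g z" shows "cdiff_at (\<lambda>z. f z - g z) z"
  using cdiff_at_add[OF assms(1) cdiff_at_mult[OF cdiff_at_const[of "-1"] assms(2)]] by simp

lemma cdiff_at_sum [intro]: "(\<And>i. i \<in> A \<Longrightarrow> cdiff_at (f i) z) \<Longrightarrow> cdiff_at (\<lambda>z. \<Sum>i\<in>A. f i z) z"
  by (induction A rule: infinite_finite_induct) auto

lemma cdiff_at_power [intro]: "cdiff_at f z \<Longrightarrow> cdiff_at (\<lambda>z. f z ^ n) z"
  by (induction n) auto

lemma cdiff_at_prod [intro]: "(\<And>i. i \<in> A \<Longrightarrow> cdiff_at (f i) z) \<Longrightarrow> cdiff_at (\<lambda>z. \<Prod>i\<in>A. f i z) z"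
  by (induction A rule: infinite_finite_induct) auto

lemma cdiff_at_mi_power [intro]: "cdiff_at (\<lambda>z. mi_power z l) z"
  unfolding mi_power_def by (intro cdiff_at_prod cdiff_at_power cdiff_at_nth)

lemma cdiff_at_compose:
  assumes "cdiff_at f (g z)" "\<And>j. cdiff_at (\<lambda>z. g z $ j) z"
  shows "cdiff_at (\<lambda>z. f (g z)) z"
proof -
  obtain D where D: "(f has_derivative D) (at (g z))" "\<forall>c v. D (c *s v) = c * D v"
    using assms unfolding cdiff_at_def by blast
  obtain E where E: "\<And>j. ((\<lambda>z. g z $ j) has_derivative E j) (at z)" "\<And>j c v. E j (c *s v) = c * E j v"
    using assms unfolding cdiff_at_def by metis
  have "(g has_derivative (\<lambda>v. \<chi> j. E j v)) (at z)"
    by (rule has_derivative_vec_lambda[where f="\<lambda>i x. g x $ i", simplified]) (use E in auto)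
  from has_derivative_compose[OF this D(1)]
  have "((\<lambda>z. f (g z)) has_derivative (\<lambda>v. D (\<chi> j. E j v))) (at z)" .
  moreover have "(\<chi> j. E j (c *s v)) = c *s (\<chi> j. E j v)" for c v
    by (simp add: vec_eq_iff E(2))
  ultimately show ?thesis unfolding cdiff_at_def using D(2)
    by (intro exI[of _ "\<lambda>v. D (\<chi> j. E j v)"]) simp
qed

lemma cdiff_at_imp_continuous: "cdiff_at f z \<Longrightarrow> isCont f z"
  unfolding cdiff_at_def using has_derivative_continuous by blast

lemma cdiff_imp_continuous_on:
  fixes g :: "complex ^ 'n::finite \<Rightarrow> complex ^ 'm::finite"
  assumes "\<And>z j. z \<in> S \<Longrightarrow> cdiff_at (\<lambda>z. g z $ j) z"
  shows "continuous_on S g"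
proof -
  have "continuous_on S (\<lambda>z. \<chi> j. g z $ j)"
    using assms cdiff_at_imp_continuous
    by (intro continuous_on_vec_lambda continuous_at_imp_continuous_on) blast
  then show ?thesis by simp
qed

section \<open>Restriction to lines parallel to a coordinate axis\<close>

definition vec_upd :: "complex ^ 'n \<Rightarrow> 'n \<Rightarrow> complex \<Rightarrow> complex ^ 'n::finite" where
  "vec_upd z j t = (\<chi> k. if k = j then t else z $ k)"

lemma vec_upd_nth [simp]: "vec_upd z j t $ k = (if k = j then t else z $ k)"
  by (simp add: vec_upd_def)

lemma vec_upd_same [simp]: "vec_upd z j (z $ j) = z"
  by (simp add: vec_eq_iff)

lemma vec_upd_upd [simp]: "vec_upd (vec_upd z j s) j t = vec_upd z j t"
  by (simp add: vec_eq_iff)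

lemma vec_upd_eq: "vec_upd z j t = z + (t - z $ j) *s axis j 1"
  by (simp add: vec_eq_iff axis_def)

lemma has_derivative_vec_upd:
  fixes z :: "complex ^ 'n::finite"
  shows "((\<lambda>t. vec_upd z j t) has_derivative (\<lambda>t. t *s axis j 1)) F"
proof -
  have "bounded_linear (\<lambda>t::complex. t *s axis j (1::complex) :: complex ^ 'n)"
    unfolding linear_conv_bounded_linear[symmetric]
    by (rule linearI) (auto simp: vec_eq_iff axis_def algebra_simps)
  then have "((\<lambda>t. (z - (z $ j) *s axis j 1) + t *s axis j 1) has_derivative (\<lambda>t. 0 + t *s axis j 1)) F"
    by (intro has_derivative_add has_derivative_const bounded_linear_imp_has_derivative) 
  then show ?thesis
    by (simp add: vec_upd_eq[abs_def] algebra_simps vector_sub_rdistrib)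
qed

lemma cdiff_at_vec_upd_field_derivative:
  assumes "(f has_derivative D) (at (vec_upd z j t))" "\<forall>c v. D (c *s v) = c * D v"
  shows "((\<lambda>t. f (vec_upd z j t)) has_field_derivative D (axis j 1)) (at t)"
  using has_derivative_compose[OF has_derivative_vec_upd assms(1)] assms(2)
  by (simp add: has_field_derivative_def mult_commute_abs)

lemma cdiff_at_vec_upd_holomorphic:
  assumes "\<And>t. t \<in> S \<Longrightarrow> cdiff_at f (vec_upd z j t)"
  shows "(\<lambda>t. f (vec_upd z j t)) holomorphic_on S"
  unfolding holomorphic_on_def
proof
  fix t assume "t \<in> S"
  then obtain D where "(f has_derivative D) (at (vec_upd z j t))" "\<forall>c v. D (c *s v) = c * D v"
    using assms unfolding cdiff_at_def by blast
  from cdiff_at_vec_upd_field_derivative[OF this]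
  show "(\<lambda>t. f (vec_upd z j t)) field_differentiable at t within S"
    using field_differentiable_at_within field_differentiable_def by blast
qed

section \<open>Taylor expansion on polydiscs\<close>

definition polydisc :: "real \<Rightarrow> (complex ^ 'n) set" where
  "polydisc r = {z. \<forall>j. norm (z $ j) < r}"

lemma vec_upd_polydisc: "z \<in> polydisc r \<Longrightarrow> norm t < r \<Longrightarrow> vec_upd z j t \<in> polydisc r"
  by (simp add: polydisc_def)

lemma ball_subset_polydisc: "ball 0 r \<subseteq> polydisc r"
  by (auto simp: polydisc_def intro: order_le_less_trans[OF Finite_Cartesian_Product.norm_nth_le])

text \<open>Cauchy's inequality asks for continuity up to the circle, which is not given at radius
  \<open>r\<close>. It is applied at every smaller radius, and the bound survives the limit.\<close>

lemma holomorphic_coeff_bound: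
  assumes f: "f holomorphic_on ball 0 r" and M: "\<And>t. t \<in> ball 0 r \<Longrightarrow> norm (f t) \<le> M" and r: "r > 0"
  shows "norm ((deriv ^^ m) f 0 / fact m) \<le> M / r ^ m"
proof -
  have "norm ((deriv ^^ m) f 0 / fact m) \<le> M / s ^ m" if s: "0 < s" "s < r" for s
  proof -
    have "norm ((deriv ^^ m) f 0) \<le> fact m * M / s ^ m"
    proof (rule Cauchy_inequality)
      show "f holomorphic_on ball 0 s" using s by (intro holomorphic_on_subset[OF f]) auto
      show "continuous_on (cball 0 s) f"
        using s by (intro continuous_on_subset[OF holomorphic_on_imp_continuous_on[OF f]]) auto
    qed (use s M in auto)
    then show ?thesis by (simp add: norm_divide field_simps)
  qed
  then have ev: "\<forall>\<^sub>F s in at_left r. norm ((deriv ^^ m) f 0 / fact m) \<le> M / s ^ m"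
    using eventually_at_leftI[of 0 r] r by (metis greaterThanLessThan_iff)
  have "((\<lambda>s. M / s ^ m) \<longlongrightarrow> M / r ^ m) (at_left r)"
    using r by (intro tendsto_intros) auto
  from tendsto_lowerbound[OF this ev] show ?thesis by simp
qed

text \<open>
  The Taylor coefficients are locally uniform limits of difference quotients in the expansion
  variable, so no derivative with respect to the parameter is needed.
\<close>

lemma holomorphic_coeff_parameter:
  fixes g :: "complex \<Rightarrow> complex \<Rightarrow> complex"
  assumes r: "r > 0"
    and g1: "\<And>a. a \<in> ball 0 r \<Longrightarrow> g a holomorphic_on ball 0 r"
    and g2: "\<And>t. t \<in> ball 0 r \<Longrightarrow> (\<lambda>a. g a t) holomorphic_on ball 0 r"
    and M: "\<And>a t. a \<in> ball 0 r \<Longrightarrow> t \<in> ball 0 r \<Longrightarrow> norm (g a t) \<le> M"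
  shows "(\<lambda>a. (deriv ^^ m) (g a) 0 / fact m) holomorphic_on ball 0 r"
proof (induction m rule: less_induct)
  case (less m)
  define c where "c k a = (deriv ^^ k) (g a) 0 / fact k" for k a
  have c_le: "norm (c k a) \<le> M / r ^ k" if "a \<in> ball 0 r" for k a
    unfolding c_def using holomorphic_coeff_bound[OF g1[OF that]] M that r by blast
  have M0: "M \<ge> 0" using c_le[of 0 0] r by (simp add: order_trans[OF norm_ge_zero])
  have c_sums: "(\<lambda>k. c k a * t ^ k) sums g a t" if "a \<in> ball 0 r" "t \<in> ball 0 r" for a t
    unfolding c_def using holomorphic_power_series[OF g1] that by fastforce
  \<comment> \<open>Removing the terms of degree below \<open>m\<close> and dividing by
    \<open>t ^ m\<close> leaves \<open>c m a\<close> plus an error of size \<open>O(t)\<close>. For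
    \<open>norm t\<close> at most \<open>r / 2\<close> the error is dominated by a geometric series
    of ratio 1/2, uniformly in \<open>a\<close>.\<close>
  define Q where "Q t a = (g a t - (\<Sum>k<m. c k a * t ^ k)) / t ^ m" for t a
  define t where "t n = complex_of_real (r / 2 / real (Suc n))" for n
  have t: "norm (t n) \<le> r / 2" "t n \<noteq> 0" for n
    using r by (auto simp: t_def norm_divide norm_mult field_simps simp del: of_nat_Suc)
  have Q: "norm (Q s a - c m a) \<le> norm s * (2 * M / r ^ Suc m)"
    if a: "a \<in> ball 0 r" and s: "norm s \<le> r / 2" "s \<noteq> 0" for a s
  proof -
    have "(\<lambda>k. c (k + m) a * s ^ (k + m)) sums (g a s - (\<Sum>k<m. c k a * s ^ k))"
      using sums_split_initial_segment[OF c_sums] a s r by auto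
    then have "(\<lambda>k. c (k + m) a * s ^ (k + m) / s ^ m) sums Q s a"
      unfolding Q_def by (rule sums_divide)
    then have "(\<lambda>k. c (k + m) a * s ^ k) sums Q s a"
      using s by (simp add: power_add)
    then have *: "(\<lambda>k. c (Suc k + m) a * s ^ Suc k) sums (Q s a - c m a)"
      using sums_Suc_iff[of "\<lambda>k. c (k + m) a * s ^ k" "Q s a - c m a"] by simp
    have geo: "(\<lambda>k. norm s * (M / r ^ Suc m) * (1/2) ^ k) sums (norm s * (M / r ^ Suc m) * 2)"
      using sums_mult[OF geometric_sums[of "1/2::real"], of "norm s * (M / r ^ Suc m)"] by simp
    have le: "norm (c (Suc k + m) a * s ^ Suc k) \<le> norm s * (M / r ^ Suc m) * (1/2) ^ k" for k
    proof -
      have "norm (c (Suc k + m) a * s ^ Suc k) \<le> M / r ^ (Suc k + m) * (norm s * (r / 2) ^ k)"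
        unfolding norm_mult norm_power
        by (intro mult_mono c_le a) (use s M0 r in \<open>auto intro!: mult_left_mono power_mono\<close>)
      also have "\<dots> = norm s * (M / r ^ Suc m) * (1/2) ^ k"
        using r by (simp add: power_add power_divide field_simps)
      finally show ?thesis .
    qed
    have "norm (Q s a - c m a) \<le> norm s * (M / r ^ Suc m) * 2"
      using norm_suminf_le[OF le sums_summable[OF geo]] sums_unique[OF *] sums_unique[OF geo] by simp
    then show ?thesis by (simp add: mult_ac)
  qed
  have "(\<lambda>a. c m a) holomorphic_on ball 0 r"
  proof (rule holomorphic_uniform_sequence)
    show "open (ball (0::complex) r)" by simp
    show "Q (t n) holomorphic_on ball 0 r" for n
      unfolding Q_def c_def
      by (intro holomorphic_intros g2 less) (use t[of n] r in auto)
    have unif: "uniform_limit (ball 0 r) (\<lambda>n. Q (t n)) (c m) sequentially"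
      unfolding uniform_limit_iff
    proof (intro allI impI)
      fix e :: real assume "e > 0"
      have "(\<lambda>n. norm (t n) * (2 * M / r ^ Suc m)) \<longlonglongrightarrow> 0"
      proof -
        have "(\<lambda>n. r / 2 * (1 / real (Suc n)) * (2 * M / r ^ Suc m)) \<longlonglongrightarrow> r / 2 * 0 * (2 * M / r ^ Suc m)"
          by (intro tendsto_intros lim_1_over_n LIMSEQ_Suc[OF lim_1_over_n])
        moreover have "norm (t n) = r / 2 * (1 / real (Suc n))" for n
          using r by (simp add: t_def norm_divide norm_mult del: of_nat_Suc)
        ultimately show ?thesis by simp
      qed
      then have "\<forall>\<^sub>F n in sequentially. norm (t n) * (2 * M / r ^ Suc m) < e"
        using \<open>e > 0\<close> order_tendstoD(2) by blast
      then show "\<forall>\<^sub>F n in sequentially. \<forall>x\<in>ball 0 r. dist (Q (t n) x) (c m x) < e"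
      proof eventually_elim
        case (elim n)
        then show ?case using Q[OF _ t] unfolding dist_norm by (meson order_le_less_trans)
      qed
    qed
    show "\<exists>d>0. cball x d \<subseteq> ball 0 r \<and> uniform_limit (cball x d) (\<lambda>n. Q (t n)) (c m) sequentially"
      if "x \<in> ball 0 r" for x
      using that uniform_limit_on_subset[OF unif] open_contains_cball by (metis open_ball)
  qed
  then show ?case by (simp add: c_def)
qed

text \<open>A class that is stable under taking Taylor coefficients in one variable: the bound
  controls the coefficients through Cauchy's estimate, and holomorphy in each remaining variable is
  inherited.\<close>

definition separately_holomorphic_bounded ::
    "real \<Rightarrow> real \<Rightarrow> (complex ^ 'n::finite \<Rightarrow> complex) \<Rightarrow> bool" where
  "separately_holomorphic_bounded r M f \<longleftrightarrow> (\<forall>z\<in>polydisc r. norm (f z) \<le> M) \<and>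
     (\<forall>z\<in>polydisc r. \<forall>j. (\<lambda>t. f (vec_upd z j t)) holomorphic_on ball 0 r)"

lemma
  assumes "separately_holomorphic_bounded r M f" "z \<in> polydisc r"
  shows separately_holomorphic_bounded_le: "norm (f z) \<le> M"
    and separately_holomorphic_bounded_holomorphic: "(\<lambda>t. f (vec_upd z j t)) holomorphic_on ball 0 r"
  using assms unfolding separately_holomorphic_bounded_def by blast+

text \<open>The value does not depend on \<open>z $ j\<close>. Keeping the full vector as argument
  lets coefficients be taken in one coordinate after another within a single function type.\<close>

definition axis_coeff :: "'n \<Rightarrow> nat \<Rightarrow> (complex ^ 'n::finite \<Rightarrow> complex) \<Rightarrow> complex ^ 'n \<Rightarrow> complex" where
  "axis_coeff j m f z = (deriv ^^ m) (\<lambda>t. f (vec_upd z j t)) 0 / fact m"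

lemma axis_coeff_sums:
  assumes "separately_holomorphic_bounded r M f" "z \<in> polydisc r"
  shows "(\<lambda>m. axis_coeff j m f z * (z $ j) ^ m) sums f z"
proof -
  have "(\<lambda>t. f (vec_upd z j t)) holomorphic_on ball 0 r"
    using assms by (rule separately_holomorphic_bounded_holomorphic)
  from holomorphic_power_series[OF this, of "z $ j"] show ?thesis
    using assms(2) by (simp add: axis_coeff_def polydisc_def)
qed

text \<open>Along \<open>j\<close> the coefficient is constant; along another coordinate the two
  updates commute and the claim is holomorphic dependence on a parameter. The radius does not
  shrink, so the step can be iterated over all coordinates.\<close>

lemma separately_holomorphic_axis_coeff:
  fixes f :: "complex ^ 'n::finite \<Rightarrow> complex"
  assumes f: "separately_holomorphic_bounded r M f" and r: "r > 0"
  shows "separately_holomorphic_bounded r (M / r ^ m) (axis_coeff j m f)"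
  unfolding separately_holomorphic_bounded_def
proof (intro conjI ballI allI)
  fix z :: "complex ^ 'n" assume z: "z \<in> polydisc r"
  note zu = vec_upd_polydisc[OF z]
  show "norm (axis_coeff j m f z) \<le> M / r ^ m"
    unfolding axis_coeff_def
    by (intro holomorphic_coeff_bound r separately_holomorphic_bounded_holomorphic[OF f z]
        separately_holomorphic_bounded_le[OF f zu]) simp
  fix k
  show "(\<lambda>t. axis_coeff j m f (vec_upd z k t)) holomorphic_on ball 0 r"
  proof (cases "k = j")
    case True
    then show ?thesis by (simp add: axis_coeff_def)
  next
    case False
    have comm: "vec_upd (vec_upd z k a) j t = vec_upd (vec_upd z j t) k a" for a t
      using False by (simp add: vec_eq_iff)
    show ?thesis unfolding axis_coeff_def
    proof (rule holomorphic_coeff_parameter[OF r])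
      show "(\<lambda>t. f (vec_upd (vec_upd z k a) j t)) holomorphic_on ball 0 r" if "a \<in> ball 0 r" for a
        using separately_holomorphic_bounded_holomorphic[OF f zu] that by simp
      show "(\<lambda>a. f (vec_upd (vec_upd z k a) j t)) holomorphic_on ball 0 r" if "t \<in> ball 0 r" for t
        unfolding comm using separately_holomorphic_bounded_holomorphic[OF f zu] that by simp
      show "norm (f (vec_upd (vec_upd z k a) j t)) \<le> M" if "a \<in> ball 0 r" "t \<in> ball 0 r" for a t
        using separately_holomorphic_bounded_le[OF f vec_upd_polydisc[OF zu]] that by simp
    qed
  qed
qed

text \<open>Every finite set of multi-indices lies in a box, and over a box the sum factors into
  one-variable geometric sums.\<close>

lemma summable_on_multi_geometric:
  fixes x :: "'n::finite \<Rightarrow> real"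
  assumes "\<And>j. 0 \<le> x j" "\<And>j. x j < 1"
  shows "(\<lambda>l. \<Prod>j\<in>UNIV. x j ^ l j) summable_on (UNIV :: ('n \<Rightarrow> nat) set)"
proof -
  have geo: "(\<Sum>k\<in>A. x j ^ k) \<le> 1 / (1 - x j)" if "finite A" for A j
  proof -
    have n: "norm (x j) < 1" using assms[of j] by simp
    have "(\<Sum>k\<in>A. x j ^ k) \<le> (\<Sum>k. x j ^ k)"
      by (rule sum_le_suminf) (use that n assms(1)[of j] in \<open>auto intro: summable_geometric\<close>)
    then show ?thesis by (simp add: suminf_geometric[OF n])
  qed
  have "(\<Sum>l\<in>A. \<Prod>j\<in>UNIV. x j ^ l j) \<le> (\<Prod>j\<in>UNIV. 1 / (1 - x j))" if "finite A" for A
  proof -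
    define B where "B j = (\<lambda>l. l j) ` A" for j :: 'n
    have "(\<Sum>l\<in>A. \<Prod>j\<in>UNIV. x j ^ l j) \<le> (\<Sum>l\<in>PiE UNIV B. \<Prod>j\<in>UNIV. x j ^ l j)"
      using that assms by (intro sum_mono2 finite_PiE) (auto simp: B_def prod_nonneg)
    also have "\<dots> = (\<Prod>j\<in>UNIV. \<Sum>k\<in>B j. x j ^ k)"
      by (rule prod_sum_PiE[symmetric]) (use that in \<open>auto simp: B_def\<close>)
    also have "\<dots> \<le> (\<Prod>j\<in>UNIV. 1 / (1 - x j))"
      using geo that assms by (intro prod_mono) (auto simp: B_def sum_nonneg)
    finally show ?thesis .
  qed
  then show ?thesis
    using assms by (intro nonneg_bdd_above_summable_on) (auto simp: prod_nonneg bdd_above_def)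
qed

text \<open>Expansion in the variables of \<open>S\<close> only, by induction on \<open>S\<close>.
  The Cauchy bounds give absolute convergence at the next step; the last clause says that the
  coefficients forget the variables already expanded, so for \<open>S = UNIV\<close> they are
  constants.\<close>

lemma separately_holomorphic_has_sum:
  fixes f :: "complex ^ 'n::finite \<Rightarrow> complex"
  assumes f: "separately_holomorphic_bounded r M f" and r: "r > 0" and S: "finite (S :: 'n set)"
  shows "\<exists>C :: ('n \<Rightarrow> nat) \<Rightarrow> complex ^ 'n \<Rightarrow> complex.
    (\<forall>l. (\<forall>j. j \<notin> S \<longrightarrow> l j = 0) \<longrightarrow> separately_holomorphic_bounded r (M / r ^ mi_deg l) (C l)) \<and>
    (\<forall>z\<in>polydisc r. ((\<lambda>l. C l z * mi_power z l) has_sum f z) {l. \<forall>j. j \<notin> S \<longrightarrow> l j = 0}) \<and>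
    (\<forall>l z w. (\<forall>j. j \<notin> S \<longrightarrow> z $ j = w $ j) \<longrightarrow> C l z = C l w)"
  using S
proof (induction S rule: finite_induct)
  case empty
  have eq: "{l :: 'n \<Rightarrow> nat. \<forall>j. l j = 0} = {\<lambda>_. 0}" by (auto simp: fun_eq_iff)
  show ?case
  proof (intro exI[of _ "\<lambda>_. f"] conjI allI impI ballI)
    fix l :: "'n \<Rightarrow> nat" assume "\<forall>j. j \<notin> {} \<longrightarrow> l j = 0"
    then show "separately_holomorphic_bounded r (M / r ^ mi_deg l) f" using f by (simp add: mi_deg_def)
  next
    fix z :: "complex ^ 'n"
    have "((\<lambda>l. f z * mi_power z l) has_sum f z * mi_power z (\<lambda>_. 0)) {\<lambda>_. 0}"
      using has_sum_finite[of "{\<lambda>_. 0}" "\<lambda>l. f z * mi_power z l"] by simp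
    then show "((\<lambda>l. f z * mi_power z l) has_sum f z) {l. \<forall>j. j \<notin> {} \<longrightarrow> l j = 0}"
      by (simp add: eq mi_power_def)
  next
    fix z w :: "complex ^ 'n" assume "\<forall>j. j \<notin> {} \<longrightarrow> z $ j = w $ j"
    then have "z = w" by (simp add: vec_eq_iff)
    then show "f z = f w" by simp
  qed
next
  case (insert j S)
  obtain C :: "('n \<Rightarrow> nat) \<Rightarrow> complex ^ 'n \<Rightarrow> complex" where
    C1: "\<And>l. (\<forall>j. j \<notin> S \<longrightarrow> l j = 0) \<Longrightarrow> separately_holomorphic_bounded r (M / r ^ mi_deg l) (C l)"
    and C2: "\<And>z. z \<in> polydisc r \<Longrightarrow>
      ((\<lambda>l. C l z * mi_power z l) has_sum f z) {l. \<forall>j. j \<notin> S \<longrightarrow> l j = 0}"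
    and C3: "\<And>l z w. (\<forall>j. j \<notin> S \<longrightarrow> z $ j = w $ j) \<Longrightarrow> C l z = C l w"
  proof -
    obtain C where C: "\<forall>l. (\<forall>j. j \<notin> S \<longrightarrow> l j = 0) \<longrightarrow> separately_holomorphic_bounded r (M / r ^ mi_deg l) (C l)"
      "\<forall>z\<in>polydisc r. ((\<lambda>l. C l z * mi_power z l) has_sum f z) {l. \<forall>j. j \<notin> S \<longrightarrow> l j = 0}"
      "\<forall>l z w. (\<forall>j. j \<notin> S \<longrightarrow> z $ j = w $ j) \<longrightarrow> C l z = C l w"
      using insert.IH by (elim exE conjE)
    show thesis
      by (rule that[of C]) (use C in blast)+
  qed
  define C' where "C' l = axis_coeff j (l j) (C (l(j := 0)))" for l
  have deg: "mi_deg l = l j + mi_deg (l(j := 0))" for l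
  proof -
    have "(\<Sum>k\<in>UNIV - {j}. (l(j := 0)) k) = sum l (UNIV - {j})" by (rule sum.cong) auto
    then show ?thesis
      using sum.remove[of UNIV j l] sum.remove[of UNIV j "l(j := 0)"] by (simp add: mi_deg_def)
  qed
  have pow: "mi_power z l = z $ j ^ l j * mi_power z (l(j := 0))" for z l
  proof -
    have "(\<Prod>k\<in>UNIV - {j}. z $ k ^ (l(j := 0)) k) = (\<Prod>k\<in>UNIV - {j}. z $ k ^ l k)"
      by (rule prod.cong) auto
    then show ?thesis
      using prod.remove[of UNIV j "\<lambda>k. z $ k ^ l k"] prod.remove[of UNIV j "\<lambda>k. z $ k ^ (l(j := 0)) k"]
      by (simp add: mi_power_def)
  qed
  have C'1: "separately_holomorphic_bounded r (M / r ^ mi_deg l) (C' l)"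
    if l: "\<forall>k. k \<notin> insert j S \<longrightarrow> l k = 0" for l
  proof -
    have "separately_holomorphic_bounded r (M / r ^ mi_deg (l(j := 0))) (C (l(j := 0)))"
      using l insert.hyps by (intro C1) auto
    from separately_holomorphic_axis_coeff[OF this r, of "l j" j] show ?thesis
      by (simp add: C'_def deg[of l] power_add mult.commute)
  qed
  have C'2: "((\<lambda>l. C' l z * mi_power z l) has_sum f z) {l. \<forall>k. k \<notin> insert j S \<longrightarrow> l k = 0}"
    if z: "z \<in> polydisc r" for z
  proof -
    let ?A = "{l :: 'n \<Rightarrow> nat. \<forall>k. k \<notin> S \<longrightarrow> l k = 0}"
    let ?B = "{l :: 'n \<Rightarrow> nat. \<forall>k. k \<notin> insert j S \<longrightarrow> l k = 0}"
    \<comment> \<open>An index supported on \<open>insert j S\<close> is an index supported on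
      \<open>S\<close> together with its entry at \<open>j\<close>, so the new series is a double
      series.\<close>
    define h where "h = (\<lambda>(l :: 'n \<Rightarrow> nat, m). l(j := m))"
    have bij: "bij_betw h (?A \<times> UNIV) ?B"
      by (rule bij_betw_byWitness[of _ "\<lambda>l. (l(j := 0), l j)"])
         (use insert.hyps in \<open>auto simp: h_def fun_eq_iff\<close>)
    have M0: "M \<ge> 0"
      using separately_holomorphic_bounded_le[OF f z] norm_ge_zero order_trans by blast
    have "(\<lambda>l. C' l z * mi_power z l) summable_on ?B"
    proof (rule abs_summable_summable, rule Infinite_Sum.abs_summable_on_comparison_test')
      have geo: "(\<lambda>l. \<Prod>j\<in>UNIV. (norm (z $ j) / r) ^ l j) summable_on (UNIV :: ('n \<Rightarrow> nat) set)"
        using z r by (intro summable_on_multi_geometric) (auto simp: polydisc_def)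
      show "(\<lambda>l. M * (\<Prod>j\<in>UNIV. (norm (z $ j) / r) ^ l j)) summable_on ?B"
        by (intro summable_on_cmult_right) (rule summable_on_subset_banach[OF geo subset_UNIV])
      fix l assume "l \<in> ?B"
      then have "norm (C' l z) \<le> M / r ^ mi_deg l"
        using separately_holomorphic_bounded_le[OF C'1 z] by blast
      then have "norm (C' l z * mi_power z l) \<le> M / r ^ mi_deg l * norm (mi_power z l)"
        unfolding norm_mult by (rule mult_right_mono) simp
      also have "\<dots> = M * (\<Prod>j\<in>UNIV. (norm (z $ j) / r) ^ l j)"
        by (simp add: mi_power_def mi_deg_def power_divide prod_dividef power_sum prod_norm[symmetric] norm_power)
      finally show "norm (C' l z * mi_power z l) \<le> M * (\<Prod>j\<in>UNIV. (norm (z $ j) / r) ^ l j)" .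
    qed
    then have summ: "(\<lambda>x. C' (h x) z * mi_power z (h x)) summable_on (?A \<times> UNIV)"
      using summable_on_reindex_bij_betw[OF bij, of "\<lambda>l. C' l z * mi_power z l"] by simp
    have "((\<lambda>x. C' (h x) z * mi_power z (h x)) has_sum f z) (?A \<times> UNIV)"
    proof (rule has_sum_SigmaI[OF _ C2[OF z] summ])
      fix l assume l: "l \<in> ?A"
      have lj: "l(j := 0) = l" using l insert.hyps by (auto simp: fun_eq_iff)
      have eq: "C' (h (l, m)) z * mi_power z (h (l, m)) = axis_coeff j m (C l) z * z $ j ^ m * mi_power z l" for m
        using pow[of z "l(j := m)"] lj by (simp add: C'_def h_def)
      have sums: "(\<lambda>m. axis_coeff j m (C l) z * z $ j ^ m) sums C l z"
        using axis_coeff_sums[OF C1 z] l by simp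
      have "(\<lambda>m. C' (h (l, m)) z * mi_power z (h (l, m))) summable_on UNIV"
        using summable_on_SigmaD1[where f = "\<lambda>l m. C' (h (l, m)) z * mi_power z (h (l, m))", OF _ l] summ
        by (simp add: case_prod_unfold)
      then have hs: "((\<lambda>m. C' (h (l, m)) z * mi_power z (h (l, m))) has_sum
          (\<Sum>\<^sub>\<infinity>m. C' (h (l, m)) z * mi_power z (h (l, m)))) UNIV" by simp
      \<comment> \<open>The one-variable series gives the inner sum only in the order of the natural
        numbers. Unconditional summability is already known from the Cauchy bounds, and uniqueness
        of limits identifies the two values.\<close>
      have "(\<lambda>m. C' (h (l, m)) z * mi_power z (h (l, m))) sums (C l z * mi_power z l)"
        unfolding eq by (rule sums_mult2[OF sums])
      from sums_unique2[OF has_sum_imp_sums[OF hs] this] hs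
      show "((\<lambda>m. C' (h (l, m)) z * mi_power z (h (l, m))) has_sum C l z * mi_power z l) UNIV"
        by (simp only:)
    qed
    then show ?thesis using has_sum_reindex_bij_betw[OF bij, of "\<lambda>l. C' l z * mi_power z l"] by simp
  qed
  have C'3: "C' l z = C' l w" if "\<forall>k. k \<notin> insert j S \<longrightarrow> z $ k = w $ k" for l z w
  proof -
    have "C (l(j := 0)) (vec_upd z j t) = C (l(j := 0)) (vec_upd w j t)" for t
      by (rule C3) (use that in auto)
    then show ?thesis by (simp add: C'_def axis_coeff_def)
  qed
  show ?case using C'1 C'2 C'3 by (intro exI[of _ C']) blast
qed

theorem cdiff_has_mfps_expansion:
  fixes f :: "complex ^ 'n::finite \<Rightarrow> complex"
  assumes "open S" "0 \<in> S" "\<And>z. z \<in> S \<Longrightarrow> cdiff_at f z"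
  obtains T where "has_mfps_expansion f T"
proof -
  have "isCont f 0" using assms cdiff_at_imp_continuous by blast
  then obtain d where d: "d > 0" "\<And>z. dist z 0 < d \<Longrightarrow> dist (f z) (f 0) < 1"
    unfolding continuous_at_eps_delta by (metis zero_less_one)
  obtain e where e: "e > 0" "ball 0 e \<subseteq> S" using assms open_contains_ball by metis
  \<comment> \<open>Division by the dimension turns a bound on all coordinates into one on the norm;
    the factor 2 keeps the inequality strict.\<close>
  define r where "r = min d e / (2 * real CARD('n))"
  have r: "r > 0" using d e by (simp add: r_def)
  have sub: "norm z < min d e" if "z \<in> polydisc r" for z :: "complex ^ 'n"
  proof -
    have "norm z \<le> (\<Sum>j\<in>UNIV. norm (z $ j))" by (rule norm_vec_le_sum)
    also have "\<dots> \<le> (\<Sum>j\<in>(UNIV::'n set). r)" using that by (intro sum_mono) (auto simp: polydisc_def less_imp_le)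
    also have "\<dots> = min d e / 2" by (simp add: r_def)
    also have "\<dots> < min d e" using d e by (simp add: min_def)
    finally show ?thesis .
  qed
  have "separately_holomorphic_bounded r (norm (f 0) + 1) f"
    unfolding separately_holomorphic_bounded_def
  proof (intro conjI ballI allI)
    fix z :: "complex ^ 'n" assume z: "z \<in> polydisc r"
    have "dist (f z) (f 0) < 1" using sub[OF z] d by simp
    then show "norm (f z) \<le> norm (f 0) + 1" unfolding dist_norm by norm
    show "(\<lambda>t. f (vec_upd z j t)) holomorphic_on ball 0 r" for j
    proof (rule cdiff_at_vec_upd_holomorphic)
      fix t :: complex assume "t \<in> ball 0 r"
      then have "norm (vec_upd z j t) < min d e" by (intro sub vec_upd_polydisc z) simp
      then show "cdiff_at f (vec_upd z j t)" using assms e by auto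
    qed
  qed
  from separately_holomorphic_has_sum[OF this r, of UNIV]
  obtain C where C2: "\<And>z. z \<in> polydisc r \<Longrightarrow> ((\<lambda>l. C l z * mi_power z l) has_sum f z) UNIV"
    and C3: "\<And>l z w. C l z = C l (w :: complex ^ 'n)"
    by auto
  have "has_mfps_expansion f (Abs_mfps (\<lambda>l. C l 0))"
    unfolding has_mfps_expansion_def
  proof (intro exI[of _ r] conjI ballI r)
    fix z :: "complex ^ 'n" assume "z \<in> ball 0 r"
    then have "z \<in> polydisc r" using ball_subset_polydisc by blast
    from C2[OF this] show "((\<lambda>l. mfps_nth (Abs_mfps (\<lambda>l. C l 0)) l * mi_power z l) has_sum f z) UNIV"
      using C3[of _ z 0] by (simp add: Abs_mfps_inverse)
  qed
  then show thesis by (rule that)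
qed

section \<open>The holomorphic inverse function theorem\<close>

definition partial_deriv :: "(complex ^ 'n::finite \<Rightarrow> complex) \<Rightarrow> 'n \<Rightarrow> complex ^ 'n \<Rightarrow> complex" where
  "partial_deriv f j z = deriv (\<lambda>t. f (z + t *s axis j 1)) 0"

lemma field_derivative_along_axis:
  fixes f :: "complex ^ 'n::finite \<Rightarrow> complex"
  assumes "(f has_derivative D) (at (z + t *s axis j 1))" "\<And>c v. D (c *s v) = c * D v"
  shows "((\<lambda>t. f (z + t *s axis j 1)) has_field_derivative D (axis j 1)) (at t)"
proof -
  have eq: "vec_upd z j (z $ j + t) = z + t *s axis j 1" for t
    by (simp add: vec_upd_eq)
  have "((\<lambda>s. f (vec_upd z j s)) has_field_derivative D (axis j 1)) (at (z $ j + t))"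
    by (rule cdiff_at_vec_upd_field_derivative) (use assms in \<open>auto simp: eq\<close>)
  moreover have "((\<lambda>t. z $ j + t) has_field_derivative 1) (at t)"
    by (auto intro!: derivative_eq_intros)
  ultimately show ?thesis
    using DERIV_chain2[of "\<lambda>s. f (vec_upd z j s)" _ "\<lambda>t. z $ j + t" t 1 UNIV] by (simp add: eq)
qed

lemma partial_deriv_eq:
  assumes "(f has_derivative D) (at z)" "\<And>c v. D (c *s v) = c * D v"
  shows "partial_deriv f j z = D (axis j 1)"
  unfolding partial_deriv_def
  by (rule DERIV_imp_deriv, rule field_derivative_along_axis) (use assms in auto)

lemma cdiff_at_has_derivative_partial:
  fixes f :: "complex ^ 'n::finite \<Rightarrow> complex"
  assumes "cdiff_at f z"
  shows "(f has_derivative (\<lambda>v. \<Sum>j\<in>UNIV. partial_deriv f j z * v $ j)) (at z)"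
proof -
  obtain D where D: "(f has_derivative D) (at z)" "\<And>c v. D (c *s v) = c * D v"
    using assms unfolding cdiff_at_def by blast
  have "D = (\<lambda>v. \<Sum>j\<in>UNIV. partial_deriv f j z * v $ j)"
  proof
    fix v
    have "D v = (\<Sum>j\<in>UNIV. D (v $ j *s axis j 1))"
      by (rule complex_linear_expand[OF has_derivative_linear[OF D(1)]])
    then show "D v = (\<Sum>j\<in>UNIV. partial_deriv f j z * v $ j)"
      by (simp add: D(2) partial_deriv_eq[OF D] mult.commute)
  qed
  then show ?thesis using D(1) by simp
qed

text \<open>Only pointwise differentiability is assumed, so continuity of the derivative has to come
  from Cauchy's estimate: the slices through \<open>z\<close> and \<open>z0\<close> differ by a
  holomorphic function of one variable that is uniformly small, by uniform continuity of
  \<open>f\<close> on a compact ball.\<close>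

lemma partial_deriv_continuous_on:
  fixes f :: "complex ^ 'n::finite \<Rightarrow> complex"
  assumes S: "open S" and f: "\<And>z. z \<in> S \<Longrightarrow> cdiff_at f z"
  shows "continuous_on S (partial_deriv f j)"
  unfolding continuous_on_eq_continuous_at[OF S]
proof
  fix z0 assume "z0 \<in> S"
  then obtain e where e: "e > 0" "cball z0 e \<subseteq> S" using S open_contains_cball by blast
  define \<rho> where "\<rho> = e / 2"
  have \<rho>: "\<rho> > 0" using e by (simp add: \<rho>_def)
  have mem: "z + t *s axis j 1 \<in> cball z0 e" if "dist z z0 < \<rho>" "norm t \<le> \<rho>" for z t
    using that norm_smult_axis_le[of t j] norm_triangle_ineq[of "z - z0" "t *s axis j 1"]
    by (simp add: dist_norm norm_minus_commute[of z0] \<rho>_def algebra_simps)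
  have hol: "(\<lambda>t. f (z + t *s axis j 1)) holomorphic_on ball 0 \<rho>" if "dist z z0 < \<rho>" for z
    unfolding holomorphic_on_def
  proof
    fix t :: complex assume "t \<in> ball 0 \<rho>"
    then have "cdiff_at f (z + t *s axis j 1)" using f[OF subsetD[OF e(2) mem[OF that]]] by simp
    then obtain D where "(f has_derivative D) (at (z + t *s axis j 1))" "\<And>c v. D (c *s v) = c * D v"
      unfolding cdiff_at_def by blast
    from field_derivative_along_axis[OF this]
    show "(\<lambda>t. f (z + t *s axis j 1)) field_differentiable at t within ball 0 \<rho>"
      using field_differentiable_at_within field_differentiable_def by blast
  qed
  have "continuous_on (cball z0 e) f"
    using e f cdiff_at_imp_continuous by (intro continuous_at_imp_continuous_on) blast
  then have uc: "uniformly_continuous_on (cball z0 e) f"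
    by (intro compact_uniformly_continuous) auto
  show "isCont (partial_deriv f j) z0" unfolding continuous_at_eps_delta
  proof (intro allI impI)
    fix \<epsilon> :: real assume \<epsilon>: "\<epsilon> > 0"
    obtain d where d: "d > 0" "\<And>z w. z \<in> cball z0 e \<Longrightarrow> w \<in> cball z0 e \<Longrightarrow> dist w z < d \<Longrightarrow>
        dist (f w) (f z) < \<epsilon> * \<rho> / 2"
      using uc[unfolded uniformly_continuous_on_def, rule_format, of "\<epsilon> * \<rho> / 2"] \<epsilon> \<rho> by auto
    show "\<exists>d>0. \<forall>z. dist z z0 < d \<longrightarrow> dist (partial_deriv f j z) (partial_deriv f j z0) < \<epsilon>"
    proof (intro exI[of _ "min d \<rho>"] conjI allI impI)
      fix z assume z: "dist z z0 < min d \<rho>"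
      define g where "g t = f (z + t *s axis j 1) - f (z0 + t *s axis j 1)" for t
      have z': "dist z z0 < \<rho>" "dist z0 z0 < \<rho>" using z \<rho> by auto
      have g: "g holomorphic_on ball 0 \<rho>" unfolding g_def
        by (intro holomorphic_on_diff hol z')
      have "norm ((deriv ^^ 1) g 0 / fact 1) \<le> (\<epsilon> * \<rho> / 2) / \<rho> ^ 1"
      proof (rule holomorphic_coeff_bound[OF g _ \<rho>])
        fix t :: complex assume "t \<in> ball 0 \<rho>"
        then have t: "norm t \<le> \<rho>" by simp
        have "dist (f (z + t *s axis j 1)) (f (z0 + t *s axis j 1)) < \<epsilon> * \<rho> / 2"
          using z by (intro d mem z' t) (simp add: dist_norm)
        then show "norm (g t) \<le> \<epsilon> * \<rho> / 2" by (simp add: g_def dist_norm)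
      qed
      then have "norm (deriv g 0) < \<epsilon>" using \<rho> \<epsilon> by simp
      moreover have "deriv g 0 = partial_deriv f j z - partial_deriv f j z0"
        unfolding g_def partial_deriv_def
        by (rule deriv_diff) (use hol[OF z'(1)] hol[OF z'(2)] \<rho> holomorphic_on_imp_differentiable_at in auto)
      ultimately show "dist (partial_deriv f j z) (partial_deriv f j z0) < \<epsilon>" by (simp add: dist_norm)
    qed (use d \<rho> in auto)
  qed
qed

lemma holomorphic_map_on_imp_cdiff:
  "open S \<Longrightarrow> holomorphic_map_on f S \<Longrightarrow> z \<in> S \<Longrightarrow> cdiff_at (\<lambda>z. f z $ j) z"
  using holomorphic_map_on_cdiff_at by blast

lemma bounded_linear_complex_matrix: "bounded_linear ((*v) (A :: complex ^ 'n::finite ^ 'm::finite))"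
  unfolding linear_conv_bounded_linear[symmetric]
  by (rule linearI) (simp_all add: matrix_vector_right_distrib scaleR_eq_smult_complex vector_scalar_commute)

text \<open>The real inverse function theorem supplies a differentiable local inverse. Its
  derivative is the inverse of a complex linear bijection, hence complex linear, so the local
  inverse is holomorphic.\<close>

theorem holomorphic_inverse_function:
  fixes f :: "complex ^ 'n::finite \<Rightarrow> complex ^ 'n"
  assumes S: "open S" "x0 \<in> S" and f: "holomorphic_map_on f S"
    and A: "(f has_derivative (*v) A) (at x0)" "invertible A"
  obtains V where "x0 \<in> V" "V \<subseteq> S" "biholomorphic_map_on f V"
proof -
  define M where "M z = (\<chi> j k. partial_deriv (\<lambda>z. f z $ j) k z)" for z
  have cd: "cdiff_at (\<lambda>z. f z $ j) z" if "z \<in> S" for z j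
    using holomorphic_map_on_imp_cdiff S f that by blast
  have M: "(f has_derivative (*v) (M z)) (at z)" if "z \<in> S" for z
  proof -
    have "((\<lambda>z. \<chi> j. f z $ j) has_derivative (\<lambda>v. \<chi> j. \<Sum>k\<in>UNIV. partial_deriv (\<lambda>z. f z $ j) k z * v $ k)) (at z)"
      by (intro has_derivative_vec_lambda cdiff_at_has_derivative_partial cd that)
    then show ?thesis by (simp add: M_def matrix_vector_mult_def[abs_def])
  qed
  have MA: "M x0 = A"
    using has_derivative_unique[OF M[OF S(2)] A(1)] by (simp add: matrix_eq fun_eq_iff)
  define f' where "f' z = Blinfun ((*v) (M z))" for z
  have f': "blinfun_apply (f' z) = (*v) (M z)" for z
    unfolding f'_def by (rule bounded_linear_Blinfun_apply[OF bounded_linear_complex_matrix])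
  have "continuous_on S (\<lambda>z. f' z b)" for b
    unfolding f' M_def matrix_vector_mult_def using partial_deriv_continuous_on[OF S(1) cd]
    by (intro continuous_on_vec_lambda continuous_on_sum continuous_on_mult continuous_on_const) simp
  then have contf: "continuous_on S f'" by (intro continuous_on_blinfun_componentwise)
  obtain B where B: "B ** A = mat 1" using A(2) unfolding invertible_def by blast
  have invf: "Blinfun ((*v) B) o\<^sub>L f' x0 = id_blinfun"
    by (rule blinfun_eqI) (simp add: f' MA bounded_linear_Blinfun_apply[OF bounded_linear_complex_matrix]
        matrix_vector_mul_assoc B)
  obtain U V g g' where U: "open U" "U \<subseteq> S" "x0 \<in> U" "open V" "homeomorphism U V f g"
    and g: "\<And>y. y \<in> V \<Longrightarrow> (g has_derivative (g' y)) (at y)"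
      "\<And>y. y \<in> V \<Longrightarrow> g' y = inv (blinfun_apply (f'(g y)))"
      "\<And>y. y \<in> V \<Longrightarrow> bij (blinfun_apply (f'(g y)))"
  proof (rule inverse_function_theorem[OF S(1) _ contf S(2) invf])
    show "(f has_derivative blinfun_apply (f' z)) (at z)" if "z \<in> S" for z
      using M[OF that] by (simp add: f')
  qed (rule that)
  have gf: "\<And>z. z \<in> U \<Longrightarrow> g (f z) = z" and fU: "f ` U = V" and gV: "g ` V = U" "\<And>y. y \<in> V \<Longrightarrow> f (g y) = y"
    using U(5) by (auto simp: homeomorphism_def)
  have inj: "inj_on f U" using gf by (metis inj_on_inverseI)
  have invg: "inv_into U f y = g y" if "y \<in> V" for y
    using inv_into_f_f[OF inj, of "g y"] gV that by auto
  have "holomorphic_map_on (inv_into U f) V"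
    unfolding holomorphic_map_on_cdiff_at[OF U(4)]
  proof (intro ballI allI)
    fix y j assume y: "y \<in> V"
    have lin: "g' y (c *s v) = c *s g' y v" for c v
    proof -
      have "M (g y) *v (c *s g' y v) = c *s v"
        using g(2,3)[OF y] by (simp add: f' vector_scalar_commute surj_f_inv_f bij_is_surj)
      then have "inv ((*v) (M (g y))) (c *s v) = c *s g' y v"
        using g(3)[OF y] by (metis f' bij_is_inj inv_f_f)
      then show ?thesis using g(2)[OF y] by (simp add: f')
    qed
    have "((\<lambda>y. inv_into U f y $ j) has_derivative (\<lambda>v. g' y v $ j)) (at y)"
      by (rule has_derivative_transform_within_open[OF
            bounded_linear.has_derivative[OF bounded_linear_vec_nth g(1)[OF y]] U(4) y])
         (simp add: invg)
    then show "cdiff_at (\<lambda>y. inv_into U f y $ j) y"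
      unfolding cdiff_at_def using lin by (intro exI[of _ "\<lambda>v. g' y v $ j"]) simp
  qed
  moreover have "holomorphic_map_on f U"
    using U(2) cd holomorphic_map_on_cdiff_at[OF U(1)] by blast
  ultimately have "biholomorphic_map_on f U"
    unfolding biholomorphic_map_on_def using U fU inj by simp
  then show thesis using that U by blast
qed

section \<open>Orders of vanishing and formal power series\<close>

text \<open>The filter is \<open>nhds 0\<close> and not the punctured one, so for positive
  \<open>n\<close> the value at the origin is forced to be zero, while order 0 means local
  boundedness.\<close>

definition vanishes :: "nat \<Rightarrow> ('a::real_normed_vector \<Rightarrow> 'b::real_normed_vector) \<Rightarrow> bool" where
  "vanishes n f \<longleftrightarrow> (\<exists>C. \<forall>\<^sub>F z in nhds 0. norm (f z) \<le> C * norm z ^ n)"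

lemma vanishesI: "\<forall>\<^sub>F z in nhds 0. norm (f z) \<le> C * norm z ^ n \<Longrightarrow> vanishes n f"
  unfolding vanishes_def by blast

lemma vanishesE:
  assumes "vanishes n f"
  obtains C where "C > 0" "\<forall>\<^sub>F z in nhds 0. norm (f z) \<le> C * norm z ^ n"
proof -
  obtain C where C: "\<forall>\<^sub>F z in nhds 0. norm (f z) \<le> C * norm z ^ n"
    using assms unfolding vanishes_def by blast
  show thesis
  proof (rule that[of "\<bar>C\<bar> + 1"])
    show "\<forall>\<^sub>F z in nhds 0. norm (f z) \<le> (\<bar>C\<bar> + 1) * norm z ^ n"
      using C
    proof eventually_elim
      case (elim z)
      have "C * norm z ^ n \<le> (\<bar>C\<bar> + 1) * norm z ^ n" by (rule mult_right_mono) auto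
      with elim show ?case by simp
    qed
  qed simp
qed

lemma vanishes_0 [simp, intro]: "vanishes n (\<lambda>_. 0)"
  by (rule vanishesI[of _ 0]) auto

lemma vanishes_cong:
  assumes "vanishes n f" "\<forall>\<^sub>F z in nhds 0. norm (g z) \<le> norm (f z)"
  shows "vanishes n g"
proof -
  obtain C where "\<forall>\<^sub>F z in nhds 0. norm (f z) \<le> C * norm z ^ n" using vanishesE[OF assms(1)] by blast
  with assms(2) have "\<forall>\<^sub>F z in nhds 0. norm (g z) \<le> C * norm z ^ n" by eventually_elim simp
  then show ?thesis by (rule vanishesI)
qed

lemma vanishes_add [intro]:
  assumes "vanishes n f" "vanishes n g" shows "vanishes n (\<lambda>z. f z + g z)"
proof -
  obtain C where C: "C > 0" "\<forall>\<^sub>F z in nhds 0. norm (f z) \<le> C * norm z ^ n" using vanishesE[OF assms(1)] .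
  obtain D where D: "D > 0" "\<forall>\<^sub>F z in nhds 0. norm (g z) \<le> D * norm z ^ n" using vanishesE[OF assms(2)] .
  from C(2) D(2) have "\<forall>\<^sub>F z in nhds 0. norm (f z + g z) \<le> (C + D) * norm z ^ n"
    by eventually_elim (auto intro: norm_triangle_le simp: distrib_right)
  then show ?thesis by (rule vanishesI)
qed

lemma vanishes_minus: "vanishes n f \<Longrightarrow> vanishes n (\<lambda>z. - f z)"
  by (erule vanishes_cong) simp

lemma vanishes_diff [intro]:
  assumes "vanishes n f" "vanishes n g" shows "vanishes n (\<lambda>z. f z - g z)"
  using vanishes_add[OF assms(1) vanishes_minus[OF assms(2)]] by simp

lemma vanishes_sum [intro]: "(\<And>i. i \<in> A \<Longrightarrow> vanishes n (f i)) \<Longrightarrow> vanishes n (\<lambda>z. \<Sum>i\<in>A. f i z)"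
  by (induction A rule: infinite_finite_induct) auto

lemma vanishes_mult:
  fixes f g :: "'a::real_normed_vector \<Rightarrow> 'b::real_normed_div_algebra"
  assumes "vanishes m f" "vanishes n g" shows "vanishes (m + n) (\<lambda>z. f z * g z)"
proof -
  obtain C where C: "C > 0" "\<forall>\<^sub>F z in nhds 0. norm (f z) \<le> C * norm z ^ m" using vanishesE[OF assms(1)] .
  obtain D where D: "D > 0" "\<forall>\<^sub>F z in nhds 0. norm (g z) \<le> D * norm z ^ n" using vanishesE[OF assms(2)] .
  from C(2) D(2) have "\<forall>\<^sub>F z in nhds 0. norm (f z * g z) \<le> (C * D) * norm z ^ (m + n)"
  proof eventually_elim
    case (elim z)
    have "norm (f z) * norm (g z) \<le> (C * norm z ^ m) * (D * norm z ^ n)"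
      using C D by (intro mult_mono elim) auto
    then show ?case by (simp add: norm_mult power_add mult_ac)
  qed
  then show ?thesis by (rule vanishesI)
qed

lemma vanishes_mono:
  assumes "vanishes n f" "m \<le> n" shows "vanishes m f"
proof -
  obtain C where C: "C > 0" "\<forall>\<^sub>F z in nhds 0. norm (f z) \<le> C * norm z ^ n" using vanishesE[OF assms(1)] .
  have "\<forall>\<^sub>F z :: 'a in nhds 0. norm z < 1"
    unfolding eventually_nhds_metric by (intro exI[of _ 1]) auto
  with C(2) have "\<forall>\<^sub>F z in nhds 0. norm (f z) \<le> C * norm z ^ m"
  proof eventually_elim
    case (elim z)
    have "C * norm z ^ n \<le> C * norm z ^ m"
      using C elim assms(2) by (intro mult_left_mono power_decreasing) auto
    with elim show ?case by simp
  qed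
  then show ?thesis by (rule vanishesI)
qed

lemma vanishes_const [intro]: "vanishes 0 (\<lambda>_. c)"
  by (rule vanishesI[of _ "norm c"]) auto

lemma vanishes_cmult [intro]:
  fixes f :: "'a::real_normed_vector \<Rightarrow> 'b::real_normed_div_algebra"
  shows "vanishes n f \<Longrightarrow> vanishes n (\<lambda>z. c * f z)"
  using vanishes_mult[OF vanishes_const[of c]] by fastforce

lemma vanishes_power:
  fixes f :: "'a::real_normed_vector \<Rightarrow> 'b::real_normed_field"
  assumes "vanishes m f" shows "vanishes (m * n) (\<lambda>z. f z ^ n)"
proof (induction n)
  case (Suc n)
  from vanishes_mult[OF assms Suc] show ?case by simp
qed (auto intro: vanishes_mono)

lemma vanishes_prod:
  fixes f :: "'i \<Rightarrow> 'a::real_normed_vector \<Rightarrow> 'b::real_normed_field"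
  assumes "\<And>i. i \<in> A \<Longrightarrow> vanishes (m i) (f i)"
  shows "vanishes (\<Sum>i\<in>A. m i) (\<lambda>z. \<Prod>i\<in>A. f i z)"
  using assms by (induction A rule: infinite_finite_induct) (auto intro: vanishes_mult)

lemma vanishes_nth [intro]: "vanishes 1 (\<lambda>z :: 'b::real_normed_vector ^ 'n::finite. z $ j)"
  by (rule vanishesI[of _ 1]) (simp add: Finite_Cartesian_Product.norm_nth_le)

lemma vanishes_mi_power: "vanishes (mi_deg l) (\<lambda>z. mi_power z l)"
  unfolding mi_power_def mi_deg_def
  by (rule vanishes_prod) (use vanishes_power[OF vanishes_nth] in simp)

lemma vanishes_1_tendsto:
  assumes "vanishes 1 g" shows "(g \<longlongrightarrow> 0) (nhds 0)"
proof -
  obtain C where C: "C > 0" "\<forall>\<^sub>F z in nhds 0. norm (g z) \<le> C * norm z ^ 1" using vanishesE[OF assms] .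
  have "((\<lambda>z :: 'a. C * norm z ^ 1) \<longlongrightarrow> C * norm (0 :: 'a) ^ 1) (nhds 0)"
    by (intro tendsto_intros filterlim_ident)
  then have "((\<lambda>z :: 'a. C * norm z ^ 1) \<longlongrightarrow> 0) (nhds 0)" by simp
  from Lim_null_comparison[OF C(2) this] show ?thesis .
qed

lemma vanishes_compose:
  assumes "vanishes n f" "vanishes 1 g" shows "vanishes n (\<lambda>z. f (g z))"
proof -
  obtain C where C: "C > 0" "\<forall>\<^sub>F z in nhds 0. norm (f z) \<le> C * norm z ^ n" using vanishesE[OF assms(1)] .
  obtain D where D: "D > 0" "\<forall>\<^sub>F z in nhds 0. norm (g z) \<le> D * norm z ^ 1" using vanishesE[OF assms(2)] .
  have "\<forall>\<^sub>F z in nhds 0. norm (f (g z)) \<le> C * norm (g z) ^ n"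
    using filterlim_iff[THEN iffD1, OF vanishes_1_tendsto[OF assms(2)]] C(2) by blast
  with D(2) have "\<forall>\<^sub>F z in nhds 0. norm (f (g z)) \<le> (C * D ^ n) * norm z ^ n"
  proof eventually_elim
    case (elim z)
    have "C * norm (g z) ^ n \<le> C * (D * norm z ^ 1) ^ n"
      using C elim by (intro mult_left_mono power_mono) auto
    with elim show ?case by (simp add: power_mult_distrib mult_ac)
  qed
  then show ?thesis by (rule vanishesI)
qed

lemma vanishes_vec:
  fixes f :: "'a::real_normed_vector \<Rightarrow> 'b::real_normed_vector ^ 'n::finite"
  assumes "\<And>j. vanishes n (\<lambda>z. f z $ j)" shows "vanishes n f"
proof -
  have "\<forall>j. \<exists>C. \<forall>\<^sub>F z in nhds 0. norm (f z $ j) \<le> C * norm z ^ n"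
    using assms unfolding vanishes_def by blast
  then obtain C where "\<forall>j. \<forall>\<^sub>F z in nhds 0. norm (f z $ j) \<le> C j * norm z ^ n"
    by (rule choice[THEN exE])
  then have "\<forall>\<^sub>F z in nhds 0. \<forall>j. norm (f z $ j) \<le> C j * norm z ^ n"
    by (intro eventually_all_finite) auto
  then have "\<forall>\<^sub>F z in nhds 0. norm (f z) \<le> (\<Sum>j\<in>UNIV. C j) * norm z ^ n"
  proof eventually_elim
    case (elim z)
    have "norm (f z) \<le> (\<Sum>j\<in>UNIV. norm (f z $ j))" by (rule norm_vec_le_sum)
    also have "\<dots> \<le> (\<Sum>j\<in>UNIV. C j * norm z ^ n)" using elim by (intro sum_mono) auto
    finally show ?case by (simp add: sum_distrib_right)
  qed
  then show ?thesis by (rule vanishesI)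
qed

lemma vanishes_has_derivative:
  assumes "(f has_derivative D) (at 0)" "f 0 = 0" shows "vanishes 1 f"
proof -
  have "bounded_linear D" using assms(1) has_derivative_bounded_linear by blast
  then obtain K where K: "\<And>x. norm (D x) \<le> norm x * K" using bounded_linear.bounded by blast
  have "\<exists>d>0. \<forall>y. norm (y - 0) < d \<longrightarrow> norm (f y - f 0 - D (y - 0)) \<le> 1 * norm (y - 0)"
    using assms(1) zero_less_one unfolding has_derivative_at_alt by blast
  then obtain d where d: "d > 0" "\<And>y. norm y < d \<Longrightarrow> norm (f y - D y) \<le> norm y"
    using assms(2) by auto
  have "\<forall>\<^sub>F z in nhds 0. norm (f z) \<le> (1 + K) * norm z ^ 1"
    unfolding eventually_nhds_metric
  proof (intro exI[of _ d] conjI allI impI d(1))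
    fix z :: 'a assume "dist z 0 < d"
    then have "norm (f z - D z) \<le> norm z" using d(2) by simp
    moreover have "norm (f z) \<le> norm (f z - D z) + norm (D z)" using norm_triangle_ineq[of "f z - D z" "D z"] by simp
    ultimately show "norm (f z) \<le> (1 + K) * norm z ^ 1" using K[of z] by (simp add: algebra_simps)
  qed
  then show ?thesis by (rule vanishesI)
qed

section \<open>Truncated power series, leading monomials and formal composition\<close>

lemma finite_mi_deg_le: "finite {l :: 'n::finite \<Rightarrow> nat. mi_deg l \<le> N}"
proof (rule finite_subset)
  show "{l :: 'n \<Rightarrow> nat. mi_deg l \<le> N} \<subseteq> PiE UNIV (\<lambda>_. {..N})"
  proof
    fix l :: "'n \<Rightarrow> nat" assume l: "l \<in> {l. mi_deg l \<le> N}"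
    have "l j \<le> mi_deg l" for j unfolding mi_deg_def by (rule member_le_sum) auto
    then show "l \<in> PiE UNIV (\<lambda>_. {..N})" using l by (auto simp: PiE_def Pi_def intro: order_trans)
  qed
  show "finite (PiE (UNIV :: 'n set) (\<lambda>_. {..N}))" by (intro finite_PiE) auto
qed

definition jet :: "nat \<Rightarrow> 'n::finite mfps \<Rightarrow> complex ^ 'n \<Rightarrow> complex" where
  "jet N T z = (\<Sum>l | mi_deg l \<le> N. mfps_nth T l * mi_power z l)"

lemma mi_power_add: "mi_power z (\<lambda>j. a j + b j) = mi_power z a * mi_power z b"
  by (simp add: mi_power_def power_add prod.distrib)

lemma mi_deg_add: "mi_deg (\<lambda>j. a j + b j) = mi_deg a + mi_deg b"
  by (simp add: mi_deg_def sum.distrib)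

text \<open>The product of the truncations is the truncation of the product plus the pairs of
  monomials whose total degree exceeds \<open>N\<close>, each of which vanishes to order
  \<open>Suc N\<close>.\<close>

lemma jet_mult:
  fixes S T :: "'n::finite mfps"
  shows "vanishes (Suc N) (\<lambda>z. jet N S z * jet N T z - jet N (S * T) z)"
proof -
  let ?D = "{l :: 'n \<Rightarrow> nat. mi_deg l \<le> N}"
  let ?A = "{x \<in> ?D \<times> ?D. mi_deg (fst x) + mi_deg (snd x) \<le> N}"
  let ?g = "\<lambda>z x. mfps_nth S (fst x) * mfps_nth T (snd x) * mi_power z (\<lambda>j. fst x j + snd x j)"
  have fin: "finite (?D \<times> ?D)" using finite_mi_deg_le by blast
  have eq: "jet N S z * jet N T z - jet N (S * T) z = sum (?g z) (?D \<times> ?D - ?A)" for z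
  proof -
    have "jet N S z * jet N T z = sum (?g z) (?D \<times> ?D)"
      by (simp add: jet_def sum_product sum.cartesian_product mi_power_add case_prod_unfold mult_ac)
    also have "sum (?g z) (?D \<times> ?D) = sum (?g z) ?A + sum (?g z) (?D \<times> ?D - ?A)"
      by (subst sum.subset_diff[OF _ fin, of ?A]) (auto simp: add.commute)
    also have "sum (?g z) ?A = jet N (S * T) z"
    proof -
      have "jet N (S * T) z = (\<Sum>(l, a)\<in>Sigma ?D (\<lambda>l. {a. a \<le> l}).
          mfps_nth S a * mfps_nth T (\<lambda>j. l j - a j) * mi_power z l)"
        by (simp add: jet_def times_mfps.rep_eq sum_distrib_right sum.Sigma finite_mi_deg_le finite_mi_le)
      also have "\<dots> = sum (?g z) ?A"
      proof (rule sum.reindex_bij_witness[where i = "\<lambda>(a, b). (\<lambda>j. a j + b j, a)" and j = "\<lambda>(l, a). (a, \<lambda>j. l j - a j)"], goal_cases)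
        case (2 x)
        then obtain l a where x: "x = (l, a)" "mi_deg l \<le> N" "a \<le> l" by auto
        have "mi_deg l = mi_deg a + mi_deg (\<lambda>j. l j - a j)"
          using x(3) by (simp flip: mi_deg_add add: le_fun_def)
        with x show ?case by auto
      qed (auto simp: le_fun_def mi_deg_add)
      finally show ?thesis by simp
    qed
    finally show ?thesis by simp
  qed
  have "vanishes (Suc N) (\<lambda>z. sum (?g z) (?D \<times> ?D - ?A))"
  proof (intro vanishes_sum vanishes_cmult)
    fix x assume "x \<in> ?D \<times> ?D - ?A"
    then have "Suc N \<le> mi_deg (\<lambda>j. fst x j + snd x j)" by (auto simp: mi_deg_add)
    then show "vanishes (Suc N) (\<lambda>z. mi_power z (\<lambda>j. fst x j + snd x j))"
      using vanishes_mono vanishes_mi_power by blast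
  qed
  then show ?thesis by (simp add: eq)
qed

text \<open>An asymptotic counterpart of \<open>has_mfps_expansion\<close>: products and powers are
  handled by estimates of orders instead of rearrangements of convergent series.\<close>

definition has_jet :: "nat \<Rightarrow> (complex ^ 'n::finite \<Rightarrow> complex) \<Rightarrow> 'n mfps \<Rightarrow> bool" where
  "has_jet N f T \<longleftrightarrow> vanishes (Suc N) (\<lambda>z. f z - jet N T z)"

lemma vanishes_jet: "vanishes 0 (jet N T)"
  unfolding jet_def by (intro vanishes_sum vanishes_cmult vanishes_mono[OF vanishes_mi_power]) simp

lemma has_jet_vanishes_0: "has_jet N f T \<Longrightarrow> vanishes 0 f"
  using vanishes_add[OF vanishes_mono vanishes_jet, of _ _ N T] unfolding has_jet_def by fastforce

lemma has_jet_mult: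
  assumes "has_jet N f S" "has_jet N g T" shows "has_jet N (\<lambda>z. f z * g z) (S * T)"
proof -
  have 1: "vanishes (Suc N + 0) (\<lambda>z. (f z - jet N S z) * g z)"
    using assms has_jet_vanishes_0 unfolding has_jet_def by (intro vanishes_mult) blast+
  have 2: "vanishes (0 + Suc N) (\<lambda>z. jet N S z * (g z - jet N T z))"
    using assms vanishes_jet unfolding has_jet_def by (intro vanishes_mult) blast+
  have "vanishes (Suc N) (\<lambda>z. (f z - jet N S z) * g z + jet N S z * (g z - jet N T z)
      + (jet N S z * jet N T z - jet N (S * T) z))"
    using 1 2 jet_mult by (intro vanishes_add) auto
  then show ?thesis unfolding has_jet_def by (simp add: algebra_simps)
qed

lemma jet_1:
  fixes z :: "complex ^ 'n::finite"
  shows "jet N 1 z = 1"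
proof -
  have "jet N 1 z = (\<Sum>l | mi_deg (l :: 'n \<Rightarrow> nat) \<le> N. if l = (\<lambda>_. 0) then 1 else 0)"
    unfolding jet_def one_mfps.rep_eq by (intro sum.cong) (auto simp: mi_power_def)
  then show ?thesis by (simp add: finite_mi_deg_le) (simp add: mi_deg_def)
qed

lemma has_jet_1: "has_jet N (\<lambda>_. 1) 1"
  by (simp add: has_jet_def jet_1)

lemma has_jet_power: "has_jet N f T \<Longrightarrow> has_jet N (\<lambda>z. f z ^ n) (T ^ n)"
  by (induction n) (auto intro: has_jet_1 has_jet_mult)

lemma has_jet_prod: "(\<And>i. i \<in> A \<Longrightarrow> has_jet N (f i) (T i)) \<Longrightarrow> has_jet N (\<lambda>z. \<Prod>i\<in>A. f i z) (\<Prod>i\<in>A. T i)"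
  by (induction A rule: infinite_finite_induct) (auto intro: has_jet_1 has_jet_mult)

text \<open>Absolute convergence at the single point \<open>w\<close> with all coordinates \<rho>
  suffices: for \<open>norm z < \<rho>\<close> a monomial of degree above \<open>N\<close> at
  \<open>z\<close> is at most \<open>(norm z / \<rho>) ^ Suc N\<close> times its modulus at
  \<open>w\<close>.\<close>

lemma has_mfps_expansion_has_jet:
  fixes f :: "complex ^ 'n::finite \<Rightarrow> complex"
  assumes "has_mfps_expansion f T" shows "has_jet N f T"
proof -
  obtain r where r: "r > 0" and hs: "\<And>z. z \<in> ball 0 r \<Longrightarrow> ((\<lambda>l. mfps_nth T l * mi_power z l) has_sum f z) UNIV"
    using assms unfolding has_mfps_expansion_def by blast
  define \<rho> where "\<rho> = r / (2 * real CARD('n))"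
  have \<rho>: "\<rho> > 0" using r by (simp add: \<rho>_def)
  define w :: "complex ^ 'n" where "w = (\<chi> j. of_real \<rho>)"
  have "norm w \<le> (\<Sum>j\<in>UNIV. norm (w $ j))" by (rule norm_vec_le_sum)
  also have "\<dots> = r / 2" using \<rho> by (simp add: w_def) (simp add: \<rho>_def)
  also have "\<dots> < r" using r by simp
  finally have "(\<lambda>l. mfps_nth T l * mi_power w l) summable_on UNIV"
    using hs[of w] has_sum_imp_summable by simp
  then have summ: "(\<lambda>l. norm (mfps_nth T l * mi_power w l)) summable_on UNIV"
    by (simp add: summable_on_iff_abs_summable_on_complex)
  have nw: "norm (mfps_nth T l * mi_power w l) = norm (mfps_nth T l) * \<rho> ^ mi_deg l" for l
    using \<rho> by (simp add: norm_mult mi_power_def w_def mi_deg_def power_sum prod_norm[symmetric] norm_power)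
  define B where "B = (\<Sum>\<^sub>\<infinity>l. norm (mfps_nth T l) * \<rho> ^ mi_deg l)"
  have summ: "(\<lambda>l. norm (mfps_nth T l) * \<rho> ^ mi_deg l) summable_on UNIV" using summ nw by simp
  have "\<forall>\<^sub>F z in nhds 0. norm (f z - jet N T z) \<le> (B / \<rho> ^ Suc N) * norm z ^ Suc N"
    unfolding eventually_nhds_metric
  proof (intro exI[of _ "min \<rho> r"] conjI allI impI)
    fix z :: "complex ^ 'n" assume z: "dist z 0 < min \<rho> r"
    let ?D = "{l :: 'n \<Rightarrow> nat. mi_deg l \<le> N}"
    have hsz: "((\<lambda>l. mfps_nth T l * mi_power z l) has_sum (f z - jet N T z)) (UNIV - ?D)"
      unfolding jet_def using z
      by (intro has_sum_Diff hs has_sum_finite finite_mi_deg_le) auto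
    have le: "norm (mfps_nth T l * mi_power z l) \<le>
        (norm z / \<rho>) ^ Suc N * (norm (mfps_nth T l) * \<rho> ^ mi_deg l)" if "l \<in> UNIV - ?D" for l
    proof -
      have "norm (mi_power z l) = (\<Prod>j\<in>UNIV. norm (z $ j) ^ l j)"
        by (simp add: mi_power_def prod_norm[symmetric] norm_power)
      also have "\<dots> \<le> (\<Prod>j\<in>UNIV. norm z ^ l j)"
        by (intro prod_mono) (auto intro!: power_mono Finite_Cartesian_Product.norm_nth_le)
      also have "\<dots> = norm z ^ mi_deg l" by (simp add: mi_deg_def power_sum)
      also have "\<dots> = (norm z / \<rho>) ^ mi_deg l * \<rho> ^ mi_deg l"
        using \<rho> by (simp add: power_divide)
      also have "\<dots> \<le> (norm z / \<rho>) ^ Suc N * \<rho> ^ mi_deg l"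
        using that z \<rho> by (intro mult_right_mono power_decreasing) auto
      finally have "norm (mi_power z l) \<le> (norm z / \<rho>) ^ Suc N * \<rho> ^ mi_deg l" .
      then have "norm (mfps_nth T l) * norm (mi_power z l) \<le> norm (mfps_nth T l) * ((norm z / \<rho>) ^ Suc N * \<rho> ^ mi_deg l)"
        by (intro mult_left_mono) auto
      then show ?thesis unfolding norm_mult by (simp only: mult_ac)
    qed
    have summ': "(\<lambda>l. (norm z / \<rho>) ^ Suc N * (norm (mfps_nth T l) * \<rho> ^ mi_deg l)) summable_on UNIV - ?D"
      by (intro summable_on_cmult_right summable_on_subset_banach[OF summ]) auto
    have "norm (f z - jet N T z) \<le> (\<Sum>\<^sub>\<infinity>l\<in>UNIV - ?D. (norm z / \<rho>) ^ Suc N * (norm (mfps_nth T l) * \<rho> ^ mi_deg l))"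
      by (rule norm_infsum_le[OF hsz has_sum_infsum[OF summ'] le])
    also have "\<dots> = (norm z / \<rho>) ^ Suc N * (\<Sum>\<^sub>\<infinity>l\<in>UNIV - ?D. (norm (mfps_nth T l) * \<rho> ^ mi_deg l))"
      by (rule infsum_cmult_right') 
    also have "\<dots> \<le> (norm z / \<rho>) ^ Suc N * B" unfolding B_def
      using \<rho> by (intro mult_left_mono infsum_mono_neutral summ summable_on_subset_banach[OF summ]) auto
    finally show "norm (f z - jet N T z) \<le> (B / \<rho> ^ Suc N) * norm z ^ Suc N"
      by (simp add: power_divide mult_ac)
  qed (use \<rho> r in auto)
  then show ?thesis unfolding has_jet_def by (rule vanishesI)
qed

text \<open>The other indices of the same degree are excluded as well. For
  \<open>e = mi_unit j\<close> this means zero constant term and linear part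
  \<open>c * z $ j\<close>, the shape of a component of a map with diagonal differential.\<close>

definition leading_monomial :: "'n::finite mfps \<Rightarrow> complex \<Rightarrow> ('n \<Rightarrow> nat) \<Rightarrow> bool" where
  "leading_monomial f c e \<longleftrightarrow> (\<forall>m. mi_deg m \<le> mi_deg e \<longrightarrow> mfps_nth f m = (if m = e then c else 0))"

text \<open>If the degrees of two indices add up to at most those of \<open>a\<close> and
  \<open>b\<close>, then either one of them lies strictly below its leading degree, where the
  coefficient is zero, or neither exceeds it and only the pair \<open>a\<close>, \<open>b\<close>
  contributes.\<close>

lemma leading_monomial_mult:
  fixes f g :: "'n::finite mfps"
  assumes "leading_monomial f c a" "leading_monomial g d b"
  shows "leading_monomial (f * g) (c * d) (\<lambda>j. a j + b j)"
  unfolding leading_monomial_def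
proof (intro allI impI)
  fix m :: "'n \<Rightarrow> nat" assume m: "mi_deg m \<le> mi_deg (\<lambda>j. a j + b j)"
  let ?m = "\<lambda>x j. m j - x j"
  have "mfps_nth f x * mfps_nth g (?m x) = (if x = a \<and> ?m x = b then c * d else 0)" if "x \<le> m" for x
  proof -
    have "mi_deg m = mi_deg x + mi_deg (?m x)"
      using that by (simp flip: mi_deg_add add: le_fun_def)
    then have "mi_deg x + mi_deg (?m x) \<le> mi_deg a + mi_deg b" using m by (simp add: mi_deg_add)
    then consider "mi_deg x < mi_deg a" | "mi_deg (?m x) < mi_deg b" | "mi_deg x \<le> mi_deg a" "mi_deg (?m x) \<le> mi_deg b"
      by linarith
    then show ?thesis
      using assms unfolding leading_monomial_def by cases (auto simp: order.strict_implies_order)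
  qed
  then have "mfps_nth (f * g) m = (\<Sum>x | x \<le> m. if x = a \<and> ?m x = b then c * d else 0)"
    unfolding times_mfps.rep_eq by (intro sum.cong) auto
  also have "\<dots> = (\<Sum>x | x \<le> m. if x = a then (if ?m a = b then c * d else 0) else 0)"
    by (intro sum.cong) auto
  also have "\<dots> = (if a \<le> m \<and> ?m a = b then c * d else 0)"
    by (simp add: finite_mi_le)
  also have "(a \<le> m \<and> ?m a = b) \<longleftrightarrow> m = (\<lambda>j. a j + b j)"
    by (auto simp: le_fun_def fun_eq_iff) (metis le_add_diff_inverse)
  finally show "mfps_nth (f * g) m = (if m = (\<lambda>j. a j + b j) then c * d else 0)" .
qed

lemma mi_deg_eq_0_iff [simp]: "mi_deg l = 0 \<longleftrightarrow> l = (\<lambda>_. 0)"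
  by (auto simp: mi_deg_def fun_eq_iff)

lemma leading_monomial_1: "leading_monomial 1 1 (\<lambda>_. 0)"
  by (auto simp: leading_monomial_def one_mfps.rep_eq)

lemma leading_monomial_power:
  "leading_monomial f c a \<Longrightarrow> leading_monomial (f ^ n) (c ^ n) (\<lambda>j. n * a j)"
  by (induction n) (auto simp: leading_monomial_1 dest: leading_monomial_mult)

lemma leading_monomial_prod:
  assumes "\<And>i. i \<in> A \<Longrightarrow> leading_monomial (f i) (c i) (e i)"
  shows "leading_monomial (\<Prod>i\<in>A. f i) (\<Prod>i\<in>A. c i) (\<lambda>j. \<Sum>i\<in>A. e i j)"
  using assms by (induction A rule: infinite_finite_induct) (auto simp: leading_monomial_1 leading_monomial_mult)

lemma leading_monomial_mi_power:
  fixes \<Phi> :: "'n::finite mfps ^ 'n"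
  assumes "\<And>j. leading_monomial (\<Phi> $ j) (d $ j) (mi_unit j)"
  shows "leading_monomial (\<Prod>j\<in>UNIV. (\<Phi> $ j) ^ l j) (mi_power d l) l"
proof -
  have "leading_monomial (\<Prod>j\<in>UNIV. (\<Phi> $ j) ^ l j) (\<Prod>j\<in>UNIV. (d $ j) ^ l j) (\<lambda>k. \<Sum>j\<in>UNIV. l j * mi_unit j k)"
    by (intro leading_monomial_prod leading_monomial_power assms)
  then show ?thesis by (simp add: mi_power_def mi_unit_def if_distrib[of "(*) _"] cong: if_cong)
qed

lemma mfps_compose_nth:
  "mfps_nth (mfps_compose f \<Phi>) m =
     (\<Sum>l | mi_deg l \<le> mi_deg m. mfps_nth f l * mfps_nth (\<Prod>j\<in>UNIV. (\<Phi> $ j) ^ l j) m)"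
  by (simp add: mfps_compose_def Abs_mfps_inverse)

text \<open>The power with exponent \<open>l\<close> starts with a multiple of the monomial
  \<open>l\<close>, so among the indices of the degree of \<open>m\<close> only \<open>m\<close>
  itself contributes. Composition is therefore triangular in the degree with diagonal entries
  \<open>mi_power d m\<close>, and coefficient equations can be solved degree by degree.\<close>

lemma mfps_compose_triangular:
  fixes \<Phi> :: "'n::finite mfps ^ 'n"
  assumes "\<And>j. leading_monomial (\<Phi> $ j) (d $ j) (mi_unit j)"
  shows "mfps_nth (mfps_compose f \<Phi>) m = mi_power d m * mfps_nth f m +
     (\<Sum>l | mi_deg l < mi_deg m. mfps_nth f l * mfps_nth (\<Prod>j\<in>UNIV. (\<Phi> $ j) ^ l j) m)"
proof -
  let ?g = "\<lambda>l. mfps_nth f l * mfps_nth (\<Prod>j\<in>UNIV. (\<Phi> $ j) ^ l j) m"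
  have eq: "{l :: 'n \<Rightarrow> nat. mi_deg l \<le> mi_deg m} = {l. mi_deg l < mi_deg m} \<union> {l. mi_deg l = mi_deg m}" by auto
  have fin: "finite {l :: 'n \<Rightarrow> nat. mi_deg l < mi_deg m}" "finite {l :: 'n \<Rightarrow> nat. mi_deg l = mi_deg m}"
    using finite_mi_deg_le[of "mi_deg m"] by (auto elim!: finite_subset[rotated])
  have "mfps_nth (mfps_compose f \<Phi>) m = sum ?g {l. mi_deg l < mi_deg m} + sum ?g {l. mi_deg l = mi_deg m}"
    unfolding mfps_compose_nth eq by (rule sum.union_disjoint) (use fin in auto)
  also have "sum ?g {l. mi_deg l = mi_deg m} = (\<Sum>l | mi_deg l = mi_deg m. if l = m then mi_power d m * mfps_nth f m else 0)"
    using leading_monomial_mi_power[OF assms] unfolding leading_monomial_def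
    by (intro sum.cong) auto
  also have "\<dots> = mi_power d m * mfps_nth f m" using fin by simp
  finally show ?thesis by simp
qed

text \<open>Truncation turns the formal identity into an asymptotic one for the germ itself.\<close>

lemma jet_compose:
  fixes F :: "complex ^ 'n::finite \<Rightarrow> complex ^ 'n"
  assumes T: "\<And>j. has_jet N (\<lambda>z. F z $ j) (T $ j)"
    and lead: "\<And>j. leading_monomial (T $ j) (d $ j) (mi_unit j)"
  shows "vanishes (Suc N) (\<lambda>z. jet N u (F z) - jet N (mfps_compose u T) z)"
proof -
  let ?D = "{l :: 'n \<Rightarrow> nat. mi_deg l \<le> N}"
  let ?P = "\<lambda>l. \<Prod>j\<in>UNIV. (T $ j) ^ l j"
  \<comment> \<open>Making the range of \<open>l\<close> independent of \<open>m\<close> allows the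
    two sums to be exchanged. The added terms are zero because the power with exponent
    \<open>l\<close> has no terms of degree below \<open>mi_deg l\<close>.\<close>
  have nth: "mfps_nth (mfps_compose u T) m = (\<Sum>l\<in>?D. mfps_nth u l * mfps_nth (?P l) m)"
    if "mi_deg m \<le> N" for m
    unfolding mfps_compose_nth
    by (rule sum.mono_neutral_left[OF finite_mi_deg_le])
       (use that leading_monomial_mi_power[OF lead] in \<open>auto simp: leading_monomial_def not_le\<close>)
  have eq: "jet N u (F z) - jet N (mfps_compose u T) z =
      (\<Sum>l\<in>?D. mfps_nth u l * (mi_power (F z) l - jet N (?P l) z))" for z
  proof -
    have "jet N (mfps_compose u T) z = (\<Sum>m\<in>?D. \<Sum>l\<in>?D. mfps_nth u l * mfps_nth (?P l) m * mi_power z m)"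
      unfolding jet_def by (intro sum.cong) (auto simp: nth sum_distrib_right)
    also have "(\<Sum>m\<in>?D. \<Sum>l\<in>?D. mfps_nth u l * mfps_nth (?P l) m * mi_power z m) = (\<Sum>l\<in>?D. mfps_nth u l * jet N (?P l) z)"
      by (subst sum.swap) (simp add: jet_def sum_distrib_left mult_ac)
    finally show ?thesis
      by (simp add: jet_def[of N u] right_diff_distrib sum_subtractf)
  qed
  have "has_jet N (\<lambda>z. mi_power (F z) l) (?P l)" for l
    unfolding mi_power_def by (intro has_jet_prod has_jet_power T)
  then have "vanishes (Suc N) (\<lambda>z. \<Sum>l\<in>?D. mfps_nth u l * (mi_power (F z) l - jet N (?P l) z))"
    unfolding has_jet_def by (intro vanishes_sum vanishes_cmult) blast
  then show ?thesis by (simp add: eq)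
qed

lemma vanishes_at_0: "vanishes (Suc n) f \<Longrightarrow> f 0 = 0"
  unfolding vanishes_def by (auto dest!: eventually_nhds_x_imp_x)

lemma vanishes_2_has_derivative:
  assumes "vanishes 2 f" shows "(f has_derivative (\<lambda>_. 0)) (at 0)"
proof -
  obtain C where C: "C > 0" "\<forall>\<^sub>F z in nhds 0. norm (f z) \<le> C * norm z ^ 2" using vanishesE[OF assms] .
  obtain d where d: "d > 0" "\<And>z. norm z < d \<Longrightarrow> norm (f z) \<le> C * norm z ^ 2"
    using C(2) unfolding eventually_nhds_metric by auto
  have f0: "f 0 = 0" using vanishes_at_0[of 1 f] assms by (simp add: numeral_2_eq_2)
  show ?thesis unfolding has_derivative_at_alt
  proof (intro conjI allI impI)
    fix e :: real assume e: "e > 0"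
    show "\<exists>da>0. \<forall>y. norm (y - 0) < da \<longrightarrow> norm (f y - f 0 - 0) \<le> e * norm (y - 0)"
    proof (intro exI[of _ "min d (e / C)"] conjI allI impI)
      fix y :: 'a assume y: "norm (y - 0) < min d (e / C)"
      have "norm (f y) \<le> (C * norm y) * norm y" using d y by (simp add: power2_eq_square mult_ac)
      also have "\<dots> \<le> e * norm y" using y C by (intro mult_right_mono) (auto simp: field_simps)
      finally show "norm (f y - f 0 - 0) \<le> e * norm (y - 0)" by (simp add: f0)
    qed (use d e C in auto)
  qed auto
qed

text \<open>In the telescoping identity one factor of each term is a difference of order 2 instead
  of 1, which gains one order. Thus a coordinate inside a term of degree \<open>m\<close> may be
  replaced by any function with the same linear part.\<close>

lemma vanishes_power_diff:
  fixes f g :: "'a::real_normed_vector \<Rightarrow> 'b::real_normed_field"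
  assumes "vanishes 2 (\<lambda>z. f z - g z)" "vanishes 1 f" "vanishes 1 g"
  shows "vanishes (Suc m) (\<lambda>z. f z ^ m - g z ^ m)"
proof (induction m)
  case (Suc m)
  have "vanishes (1 + Suc m) (\<lambda>z. f z * (f z ^ m - g z ^ m))" by (intro vanishes_mult assms Suc)
  moreover have "vanishes (2 + 1 * m) (\<lambda>z. (f z - g z) * g z ^ m)"
    by (intro vanishes_mult assms vanishes_power)
  ultimately have "vanishes (Suc (Suc m)) (\<lambda>z. f z * (f z ^ m - g z ^ m) + (f z - g z) * g z ^ m)"
    by (intro vanishes_add) auto
  then show ?case by (simp add: algebra_simps)
qed simp

lemma mi_deg_unit [simp]: "mi_deg (mi_unit k) = 1"
  by (simp add: mi_deg_def mi_unit_def)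

lemma mi_deg_eq_1_iff: "mi_deg l = 1 \<longleftrightarrow> (\<exists>k. l = mi_unit k)"
proof
  assume "mi_deg l = 1"
  then obtain k where "l k = 1" "\<forall>j. k \<noteq> j \<longrightarrow> l j = 0"
    unfolding mi_deg_def by (auto simp: sum_eq_Suc0_iff)
  then have "l = mi_unit k" by (auto simp: mi_unit_def fun_eq_iff)
  then show "\<exists>k. l = mi_unit k" ..
qed auto

lemma mi_unit_inject [simp]: "mi_unit j = mi_unit k \<longleftrightarrow> j = k"
  by (auto simp: mi_unit_def fun_eq_iff split: if_splits) 

lemma mi_unit_neq_0 [simp]: "mi_unit k \<noteq> (\<lambda>_. 0)" "(\<lambda>_. 0) \<noteq> mi_unit k"
proof -
  show "mi_unit k \<noteq> (\<lambda>_. 0)"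
  proof
    assume "mi_unit k = (\<lambda>_. 0)"
    then have "mi_unit k k = 0" by simp
    then show False by (simp add: mi_unit_def)
  qed
  then show "(\<lambda>_. 0) \<noteq> mi_unit k" by metis
qed

lemma mi_power_unit [simp]: "mi_power z (mi_unit k) = z $ k"
proof -
  have "mi_power z (mi_unit k) = (\<Prod>j\<in>UNIV. if j = k then z $ j else 1)"
    unfolding mi_power_def mi_unit_def by (intro prod.cong) auto
  then show ?thesis by simp
qed

lemma mi_power_0 [simp]: "mi_power z (\<lambda>_. 0) = 1"
  by (simp add: mi_power_def)

lemma mi_deg_single: "mi_deg (\<lambda>j. if j = i then m else 0) = m"
  by (simp add: mi_deg_def)

lemma mi_power_single: "mi_power z (\<lambda>j. if j = i then m else 0) = (z $ i) ^ m"
proof -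
  have "mi_power z (\<lambda>j. if j = i then m else 0) = (\<Prod>j\<in>UNIV. if j = i then (z $ i) ^ m else 1)"
    unfolding mi_power_def by (intro prod.cong) auto
  then show ?thesis by simp
qed

lemma jet_degree_1: "jet 1 T z = mfps_nth T (\<lambda>_. 0) + (\<Sum>k\<in>UNIV. mfps_nth T (mi_unit k) * z $ k)"
proof -
  have "{l :: 'a \<Rightarrow> nat. mi_deg l \<le> 1} = insert (\<lambda>_. 0) (range mi_unit)"
  proof (intro set_eqI iffI)
    fix l :: "'a \<Rightarrow> nat" assume "l \<in> {l. mi_deg l \<le> 1}"
    then consider "mi_deg l = 0" | "mi_deg l = 1" by fastforce
    then show "l \<in> insert (\<lambda>_. 0) (range mi_unit)"
      by cases (simp, simp only: mi_deg_eq_1_iff, blast)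
  qed (auto simp del: One_nat_def; simp add: mi_deg_def)
  moreover have "(\<lambda>_. 0) \<notin> range (mi_unit :: 'a \<Rightarrow> _)" by auto
  moreover have "inj (mi_unit :: 'a \<Rightarrow> _)" by (simp add: inj_def)
  ultimately show ?thesis by (simp add: jet_def sum.reindex)
qed

lemma has_derivative_jet_degree_1:
  "(jet 1 T has_derivative (\<lambda>v. \<Sum>k\<in>UNIV. mfps_nth T (mi_unit k) * v $ k)) F"
proof -
  have "((\<lambda>z. mfps_nth T (\<lambda>_. 0) + (\<Sum>k\<in>UNIV. mfps_nth T (mi_unit k) * z $ k)) has_derivative
      (\<lambda>v. 0 + (\<Sum>k\<in>UNIV. mfps_nth T (mi_unit k) * v $ k))) F"
    by (intro has_derivative_add has_derivative_const has_derivative_sum has_derivative_mult_right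
        bounded_linear_imp_has_derivative bounded_linear_vec_nth)
  moreover have "jet 1 T = (\<lambda>z. mfps_nth T (\<lambda>_. 0) + (\<Sum>k\<in>UNIV. mfps_nth T (mi_unit k) * z $ k))"
    by (rule ext) (rule jet_degree_1)
  ultimately show ?thesis by simp
qed

lemma has_jet_mono:
  assumes "has_jet N f T" "M \<le> N" shows "has_jet M f T"
proof -
  have "jet N T z = jet M T z + (\<Sum>l\<in>{l. mi_deg l \<le> N} - {l. mi_deg l \<le> M}. mfps_nth T l * mi_power z l)" for z
    unfolding jet_def using assms(2)
    by (subst sum.subset_diff[OF _ finite_mi_deg_le, of "{l. mi_deg l \<le> M}"]) (auto simp: add.commute)
  then have eq: "f z - jet M T z = (f z - jet N T z) + (\<Sum>l\<in>{l. mi_deg l \<le> N} - {l. mi_deg l \<le> M}. mfps_nth T l * mi_power z l)" for z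
    by simp
  have "vanishes (Suc M) (\<lambda>z. (f z - jet N T z) + (\<Sum>l\<in>{l. mi_deg l \<le> N} - {l. mi_deg l \<le> M}. mfps_nth T l * mi_power z l))"
  proof (intro vanishes_add vanishes_sum vanishes_cmult)
    show "vanishes (Suc M) (\<lambda>z. f z - jet N T z)"
      using assms unfolding has_jet_def by (auto intro: vanishes_mono)
    show "vanishes (Suc M) (\<lambda>z. mi_power z l)" if "l \<in> {l. mi_deg l \<le> N} - {l. mi_deg l \<le> M}" for l
      using that by (intro vanishes_mono[OF vanishes_mi_power]) auto
  qed
  then show ?thesis unfolding has_jet_def eq .
qed

lemma has_jet_linear_coeff:
  fixes f :: "complex ^ 'n::finite \<Rightarrow> complex"
  assumes jet: "has_jet N f T" "N \<ge> 1" and D: "(f has_derivative D) (at 0)"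
  shows "mfps_nth T (\<lambda>_. 0) = f 0" "mfps_nth T (mi_unit k) = D (axis k 1)"
proof -
  have van: "vanishes 2 (\<lambda>z. f z - jet 1 T z)"
    using has_jet_mono[OF jet] unfolding has_jet_def by (simp add: numeral_2_eq_2)
  then have "f 0 - jet 1 T 0 = 0" using vanishes_at_0[of 1 "\<lambda>z. f z - jet 1 T z"] by (simp add: numeral_2_eq_2)
  then show "mfps_nth T (\<lambda>_. 0) = f 0" unfolding jet_degree_1 by simp
  have "((\<lambda>z. (f z - jet 1 T z) + jet 1 T z) has_derivative
      (\<lambda>v. 0 + (\<Sum>k\<in>UNIV. mfps_nth T (mi_unit k) * v $ k))) (at 0)"
    by (intro has_derivative_add vanishes_2_has_derivative van has_derivative_jet_degree_1)
  then have "(f has_derivative (\<lambda>v. (\<Sum>k\<in>UNIV. mfps_nth T (mi_unit k) * v $ k))) (at 0)" by simp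
  then have "D = (\<lambda>v. (\<Sum>k\<in>UNIV. mfps_nth T (mi_unit k) * v $ k))"
    using has_derivative_unique D by blast
  then show "mfps_nth T (mi_unit k) = D (axis k 1)"
    by (simp add: axis_def if_distrib[of "(*) _"] cong: if_cong)
qed

lemma vanishes_2_taylor:
  fixes f :: "complex ^ 'n::finite \<Rightarrow> complex"
  assumes "open S" "0 \<in> S" "\<And>z. z \<in> S \<Longrightarrow> cdiff_at f z" "f 0 = 0"
  shows "vanishes 2 (\<lambda>z. f z - (\<Sum>k\<in>UNIV. partial_deriv f k 0 * z $ k))"
proof -
  obtain T where "has_mfps_expansion f T" using cdiff_has_mfps_expansion[OF assms(1-3)] by blast
  then have T: "has_jet 1 f T" by (rule has_mfps_expansion_has_jet)
  have D: "(f has_derivative (\<lambda>v. \<Sum>j\<in>UNIV. partial_deriv f j 0 * v $ j)) (at 0)"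
    by (rule cdiff_at_has_derivative_partial) (use assms in auto)
  have "mfps_nth T (mi_unit k) = partial_deriv f k 0" for k
    using has_jet_linear_coeff(2)[OF T _ D, of k] by (simp add: axis_def if_distrib[of "(*) _"] cong: if_cong)
  moreover have "mfps_nth T (\<lambda>_. 0) = 0" using has_jet_linear_coeff(1)[OF T _ D] assms by simp
  ultimately show ?thesis using T unfolding has_jet_def jet_degree_1 by (simp add: numeral_2_eq_2)
qed

lemma cdiff_at_jet [intro]: "cdiff_at (jet N T) z"
  unfolding jet_def[abs_def] by (intro cdiff_at_sum cdiff_at_mult cdiff_at_const cdiff_at_mi_power)

lemma partial_deriv_jet:
  assumes "N \<ge> 1" shows "partial_deriv (jet N T) k 0 = mfps_nth T (mi_unit k)"
proof -
  have j: "has_jet N (jet N T) T" by (simp add: has_jet_def)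
  have "partial_deriv (jet N T) k 0 = (\<Sum>j\<in>UNIV. partial_deriv (jet N T) j 0 * axis k 1 $ j)"
    by (simp add: axis_def if_distrib[of "(*) _"] cong: if_cong)
  also have "\<dots> = mfps_nth T (mi_unit k)"
    using has_jet_linear_coeff(2)[OF j assms cdiff_at_has_derivative_partial[OF cdiff_at_jet], of k] by simp
  finally show ?thesis .
qed

text \<open>The mean value inequality for \<open>u\<close> minus its linear part along the axis;
  continuity of the partial derivative keeps the derivative below half of \<open>norm c\<close>.
  Hence the increment of \<open>u\<close> and \<open>s\<close> bound each other up to
  constants.\<close>

lemma complex_increment_along_axis:
  fixes u :: "complex ^ 'n::finite \<Rightarrow> complex"
  assumes S: "open S" "0 \<in> S" and u: "\<And>z. z \<in> S \<Longrightarrow> cdiff_at u z" and c: "partial_deriv u i 0 = c" "c \<noteq> 0"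
  obtains \<rho> where "\<rho> > 0" "\<And>z s. norm z < \<rho> \<Longrightarrow> norm s < \<rho> \<Longrightarrow>
    norm (u (z + s *s axis i 1) - u z - c * s) \<le> norm c / 2 * norm s"
proof -
  have cont: "isCont (partial_deriv u i) 0"
    using partial_deriv_continuous_on[OF S(1) u] S continuous_on_eq_continuous_at by blast
  have "\<exists>d>0. \<forall>z. dist z 0 < d \<longrightarrow> dist (partial_deriv u i z) (partial_deriv u i 0) < norm c / 2"
    by (rule cont[unfolded continuous_at_eps_delta, rule_format]) (use c in simp)
  then obtain d where d: "d > 0" and "\<forall>z. dist z 0 < d \<longrightarrow> dist (partial_deriv u i z) (partial_deriv u i 0) < norm c / 2"
    by (elim exE conjE)
  then have d2: "norm (partial_deriv u i z - c) < norm c / 2" if "norm z < d" for z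
    using that c(1) by (simp add: dist_norm)
  obtain e where e: "e > 0" "ball 0 e \<subseteq> S" using S open_contains_ball by blast
  define \<rho> where "\<rho> = min d e / 2"
  have \<rho>: "\<rho> > 0" using d e by (simp add: \<rho>_def)
  show thesis
  proof (rule that[OF \<rho>])
    fix z :: "complex ^ 'n" and s :: complex assume z: "norm z < \<rho>" and s: "norm s < \<rho>"
    have mem: "norm (z + t *s axis i 1) < min d e" if "norm t < \<rho>" for t
      using norm_triangle_ineq[of z "t *s axis i 1"] norm_smult_axis_le[of t i] that z by (simp add: \<rho>_def)
    have der: "((\<lambda>t. u (z + t *s axis i 1) - c * t) has_field_derivative
        (partial_deriv u i (z + t *s axis i 1) - c)) (at t within ball 0 \<rho>)" if "t \<in> ball 0 \<rho>" for t
    proof -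
      have "z + t *s axis i 1 \<in> S" using mem[of t] that e by auto
      then obtain D where D: "(u has_derivative D) (at (z + t *s axis i 1))" "\<And>c v. D (c *s v) = c * D v"
        using u unfolding cdiff_at_def by blast
      have 1: "((\<lambda>t. u (z + t *s axis i 1)) has_field_derivative partial_deriv u i (z + t *s axis i 1)) (at t)"
        unfolding partial_deriv_eq[OF D] by (rule field_derivative_along_axis[OF D])
      have 2: "((\<lambda>t. c * t) has_field_derivative c) (at t)" by (auto intro!: derivative_eq_intros)
      show ?thesis by (rule has_field_derivative_at_within[OF DERIV_diff[OF 1 2]])
    qed
    have "norm ((u (z + s *s axis i 1) - c * s) - (u (z + 0 *s axis i 1) - c * 0)) \<le> norm c / 2 * norm (s - 0)"
    proof (rule field_differentiable_bound[OF convex_ball der])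
      show "norm (partial_deriv u i (z + t *s axis i 1) - c) \<le> norm c / 2" if "t \<in> ball 0 \<rho>" for t
        using d2[of "z + t *s axis i 1"] mem[of t] that by simp
    qed (use s \<rho> in auto)
    then show "norm (u (z + s *s axis i 1) - u z - c * s) \<le> norm c / 2 * norm s"
      by (simp add: algebra_simps)
  qed
qed

lemma mfps_const_mult_X_nth:
  fixes c :: complex
  shows "mfps_nth (mfps_const c * mfps_X i :: 'n::finite mfps) l = (if l = mi_unit i then c else 0)"
proof -
  have "mfps_nth (mfps_const c * mfps_X i) l =
      (\<Sum>a | a \<le> l. if a = (\<lambda>_. 0) then (if l = mi_unit i then c else 0) else 0)"
    unfolding times_mfps.rep_eq mfps_const.rep_eq mfps_X.rep_eq by (intro sum.cong) auto
  also have "\<dots> = (if l = mi_unit i then c else 0)"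
    by (simp add: finite_mi_le) (simp add: le_fun_def)
  finally show ?thesis .
qed

lemma mfps_prod_unit:
  fixes \<Phi> :: "'n::finite mfps ^ 'n"
  shows "(\<Prod>j\<in>UNIV. (\<Phi> $ j) ^ mi_unit i j) = \<Phi> $ i"
proof -
  have "(\<Prod>j\<in>UNIV. (\<Phi> $ j) ^ mi_unit i j) = (\<Prod>j\<in>UNIV. if j = i then \<Phi> $ j else 1)"
    unfolding mi_unit_def by (intro prod.cong) auto
  then show ?thesis by simp
qed

lemma mfps_compose_linear:
  fixes \<Phi> :: "'n::finite mfps ^ 'n"
  assumes "mfps_nth (\<Phi> $ i) (\<lambda>_. 0) = 0" "\<And>l. mfps_nth f l = (if l = mi_unit i then c else 0)"
  shows "mfps_nth (mfps_compose f \<Phi>) m = c * mfps_nth (\<Phi> $ i) m"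
proof -
  have "mfps_nth (mfps_compose f \<Phi>) m = (\<Sum>l | mi_deg l \<le> mi_deg m.
      if l = mi_unit i then c * mfps_nth (\<Phi> $ i) m else 0)"
    unfolding mfps_compose_nth assms(2) by (intro sum.cong) (auto simp: mfps_prod_unit)
  also have "\<dots> = (if 1 \<le> mi_deg m then c * mfps_nth (\<Phi> $ i) m else 0)"
    by (simp add: finite_mi_deg_le)
  also have "\<dots> = c * mfps_nth (\<Phi> $ i) m"
    using assms(1) by (cases "m = (\<lambda>_. 0)") (auto simp: Suc_le_eq)
  finally show ?thesis .
qed

text \<open>Well-founded choice along the degree: the first hypothesis says that the condition at
  \<open>m\<close> sees only coefficients of lower degree. A relation is used instead of a recursion
  equation because at a resonant index the coefficient is not determined.\<close>

lemma mfps_recursion: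
  fixes P :: "('n::finite \<Rightarrow> nat) \<Rightarrow> (('n \<Rightarrow> nat) \<Rightarrow> complex) \<Rightarrow> complex \<Rightarrow> bool"
  assumes local: "\<And>f g m r. (\<And>l. mi_deg l < mi_deg m \<Longrightarrow> f l = g l) \<Longrightarrow> P m f r = P m g r"
    and ex: "\<And>f m. \<exists>r. P m f r"
  shows "\<exists>u. \<forall>m. P m (mfps_nth u) (mfps_nth u m)"
proof -
  have "\<exists>f. \<forall>m. P m f (f m)"
  proof (rule dependent_wf_choice[of "Wellfounded.measure mi_deg" "\<lambda>f m r. P m f r"])
    show "P m f r = P m g r" if "\<And>l. (l, m) \<in> Wellfounded.measure mi_deg \<Longrightarrow> f l = g l" for f g m r
      by (rule local) (use that in auto)
  qed (use ex in auto)
  then obtain f where "\<forall>m. P m f (f m)" ..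
  then show ?thesis by (intro exI[of _ "Abs_mfps f"]) (simp add: Abs_mfps_inverse)
qed

lemma leading_monomial_unitI:
  assumes "mfps_nth T (\<lambda>_. 0) = 0" "\<And>j. mfps_nth T (mi_unit j) = (if j = i then c else 0)"
  shows "leading_monomial T c (mi_unit i)"
  unfolding leading_monomial_def
proof (intro allI impI)
  fix m :: "'a \<Rightarrow> nat" assume "mi_deg m \<le> mi_deg (mi_unit i)"
  then have "mi_deg m = 0 \<or> mi_deg m = 1" by (auto simp del: mi_deg_eq_0_iff)
  then show "mfps_nth T m = (if m = mi_unit i then c else 0)"
    using assms unfolding mi_deg_eq_1_iff by auto
qed

section \<open>The displacement along the curve of partially fixed points\<close>

lemma vanishes_eventually_cong:
  "vanishes n f \<Longrightarrow> \<forall>\<^sub>F z in nhds 0. g z = f z \<Longrightarrow> vanishes n g"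
  by (erule vanishes_cong) (auto elim: eventually_mono)

lemma not_vanishes_power:
  fixes A :: complex
  assumes "A \<noteq> 0" shows "\<not> vanishes (Suc m) (\<lambda>t. A * t ^ m)"
proof
  assume "vanishes (Suc m) (\<lambda>t. A * t ^ m)"
  then obtain C where C: "C > 0" "\<forall>\<^sub>F t in nhds 0. norm (A * t ^ m) \<le> C * norm t ^ Suc m" by (rule vanishesE)
  then obtain d where d: "d > 0" "\<And>t. norm t < d \<Longrightarrow> norm (A * t ^ m) \<le> C * norm t ^ Suc m"
    unfolding eventually_nhds_metric by auto
  define s where "s = min (d / 2) (norm A / (2 * C))"
  have s: "0 < s" "s < d" using d C assms by (auto simp: s_def min_def)
  have "C * s \<le> C * (norm A / (2 * C))" using C by (intro mult_left_mono) (auto simp: s_def)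
  also have "\<dots> < norm A" using C assms by simp
  finally have Cs: "C * s < norm A" .
  have "norm A * s ^ m \<le> (C * s) * s ^ m"
    using d(2)[of "of_real s"] s by (simp add: norm_mult norm_power mult_ac)
  then show False using s Cs by simp
qed

lemma holomorphic_vanishes_1:
  assumes "f holomorphic_on ball 0 r" "r > 0" "f 0 = 0" shows "vanishes 1 f"
proof -
  have "(f has_field_derivative deriv f 0) (at 0)"
    using assms by (intro holomorphic_derivI[of _ "ball 0 r"]) auto
  then show ?thesis unfolding has_field_derivative_def by (rule vanishes_has_derivative) fact
qed

lemma norm_vec_upd_0: "norm (vec_upd 0 i t) \<le> norm t"
  using norm_vec_le_sum[of "vec_upd 0 i t"] by (simp add: if_distrib[of norm] cong: if_cong)

lemma diffeo_germ_repD: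
  assumes "diffeo_germ_rep \<psi> V"
  shows "open V" "0 \<in> V" "\<psi> 0 = 0" "inj_on \<psi> V" "open (\<psi> ` V)" "0 \<in> \<psi> ` V"
    "inv_into V \<psi> 0 = 0"
    "z \<in> V \<Longrightarrow> cdiff_at (\<lambda>z. \<psi> z $ j) z" "w \<in> \<psi> ` V \<Longrightarrow> cdiff_at (\<lambda>w. inv_into V \<psi> w $ j) w"
proof -
  show *: "open V" "0 \<in> V" "\<psi> 0 = 0" "inj_on \<psi> V" "open (\<psi> ` V)"
    using assms by (auto simp: diffeo_germ_rep_def biholomorphic_map_on_def)
  then show "0 \<in> \<psi> ` V" by (metis imageI)
  show "inv_into V \<psi> 0 = 0" using * inv_into_f_f by metis
  show "z \<in> V \<Longrightarrow> cdiff_at (\<lambda>z. \<psi> z $ j) z" "w \<in> \<psi> ` V \<Longrightarrow> cdiff_at (\<lambda>w. inv_into V \<psi> w $ j) w"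
    using assms * by (auto simp: diffeo_germ_rep_def biholomorphic_map_on_def intro: holomorphic_map_on_imp_cdiff)
qed

lemma cdiff_vanishes_1:
  assumes "\<And>j. cdiff_at (\<lambda>z. f z $ j) 0" "f 0 = 0" shows "vanishes 1 f"
proof (rule vanishes_vec)
  show "vanishes 1 (\<lambda>z. f z $ j)" for j
    by (rule vanishes_has_derivative[OF cdiff_at_has_derivative_partial[OF assms(1)]]) (simp add: assms(2))
qed

lemma diffeo_germ_rep_vanishes_1:
  assumes "diffeo_germ_rep \<psi> V" shows "vanishes 1 \<psi>" "vanishes 1 (inv_into V \<psi>)"
  by (rule cdiff_vanishes_1; use diffeo_germ_repD[OF assms] in simp)+

lemma norm_root_of_unity:
  fixes z :: complex
  assumes "z ^ K = 1" "K \<ge> 1" shows "norm z = 1"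
proof -
  have "norm z ^ K = 1 ^ K" using arg_cong[OF assms(1), of norm] by (simp add: norm_power)
  then show ?thesis by (rule power_eq_imp_eq_base) (use assms(2) in simp_all)
qed

section \<open>The germ, its resonances and its iterates\<close>

locale one_resonant_germ =
  fixes F :: "complex ^ 'n::finite \<Rightarrow> complex ^ 'n" and W :: "(complex ^ 'n) set"
    and lam :: "complex ^ 'n" and i :: 'n and q :: nat
  assumes germ: "diffeo_germ_rep F W"
    and diag: "(F has_derivative (\<lambda>v. \<chi> j. lam $ j * v $ j)) (at 0)"
    and q: "q \<ge> 1" "(lam $ i) ^ q = 1" "\<And>l. 1 \<le> l \<Longrightarrow> l \<le> q - 1 \<Longrightarrow> (lam $ i) ^ l \<noteq> 1"
    and attracting: "\<And>j. j \<noteq> i \<Longrightarrow> norm (lam $ j) < 1"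
begin

abbreviation \<mu> :: complex where "\<mu> \<equiv> lam $ i"

lemma norm_mu: "norm \<mu> = 1"
  by (rule norm_root_of_unity[OF q(2,1)])

lemma mu_nonzero: "\<mu> \<noteq> 0"
  using norm_mu by auto

lemma mu_power_mod: "\<mu> ^ (m mod q) = \<mu> ^ m"
proof -
  have "\<mu> ^ m = (\<mu> ^ q) ^ (m div q) * \<mu> ^ (m mod q)"
    by (simp flip: power_mult power_add)
  then show ?thesis using q by simp
qed

lemma mu_power_eq_1_iff: "\<mu> ^ m = 1 \<longleftrightarrow> q dvd m"
proof -
  note eq = mu_power_mod[of m, symmetric]
  have lt: "m mod q < q" using q by simp
  show ?thesis
  proof
    assume "\<mu> ^ m = 1"
    then have "m mod q = 0" using q(3)[of "m mod q"] eq lt by (cases "m mod q = 0") auto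
    then show "q dvd m" by auto
  qed (use eq in auto)
qed

lemma mu_power_resonant [simp]: "\<mu> ^ (k * q + 1) = \<mu>" "\<mu> ^ Suc (k * q) = \<mu>"
  using mu_power_eq_1_iff[of "k * q"] by auto

lemma lam_power_ne_1: "j \<noteq> i \<Longrightarrow> lam $ j ^ q \<noteq> 1"
proof
  assume "j \<noteq> i" "lam $ j ^ q = 1"
  then have "norm (lam $ j) ^ q = 1" by (simp flip: norm_power)
  moreover have "norm (lam $ j) ^ q < 1"
    using attracting[OF \<open>j \<noteq> i\<close>] q(1) by (simp add: power_less_one_iff)
  ultimately show False by simp
qed

text \<open>Comparing moduli kills every exponent at an attracting coordinate, since \<mu> has
  modulus 1. What remains is \<open>\<mu> ^ (l i - 1) = 1\<close>, which means that \<open>q\<close>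
  divides \<open>l i - 1\<close>.\<close>

lemma resonance_iff: "resonance lam i l \<longleftrightarrow> (\<exists>s\<ge>1. l = (\<lambda>j. s * (q * mi_unit i j) + mi_unit i j))"
proof
  assume res: "resonance lam i l"
  have l0: "l j = 0" if j: "j \<noteq> i" for j
  proof (rule ccontr)
    assume lj: "l j \<noteq> 0"
    have le1: "norm (lam $ k) \<le> 1" for k using attracting[of k] norm_mu by (cases "k = i") auto
    have "norm (mi_power lam l) = (\<Prod>k\<in>UNIV. norm (lam $ k) ^ l k)"
      by (simp add: mi_power_def prod_norm[symmetric] norm_power)
    also have "\<dots> = norm (lam $ j) ^ l j * (\<Prod>k\<in>UNIV - {j}. norm (lam $ k) ^ l k)"
      by (rule prod.remove) auto
    also have "\<dots> \<le> norm (lam $ j) ^ l j * 1"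
      using le1 by (intro mult_left_mono prod_le_1) (auto simp: power_le_one)
    also have "\<dots> < 1" using attracting[OF j] lj by (simp add: power_less_one_iff)
    finally show False using res norm_mu by (simp add: resonance_def)
  qed
  have deg: "mi_deg l = l i"
    using sum.remove[of UNIV i l] l0 by (simp add: mi_deg_def)
  have "mi_power lam l = \<mu> ^ l i"
    using prod.remove[of UNIV i "\<lambda>k. lam $ k ^ l k"] l0 by (simp add: mi_power_def)
  then have "\<mu> * \<mu> ^ (l i - 1) = \<mu>" and li: "l i \<ge> 2" using res deg
    using power_Suc[of \<mu> "l i - 1"] by (simp_all add: resonance_def)
  then have "q dvd l i - 1" using mu_nonzero mu_power_eq_1_iff by simp
  then obtain s where s: "l i - 1 = q * s" by (auto elim: dvdE)
  show "\<exists>s\<ge>1. l = (\<lambda>j. s * (q * mi_unit i j) + mi_unit i j)"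
  proof (intro exI[of _ s] conjI)
    show "s \<ge> 1" using s li by (cases s) auto
    show "l = (\<lambda>j. s * (q * mi_unit i j) + mi_unit i j)"
      using s li l0 by (auto simp: fun_eq_iff mi_unit_def mult.commute)
  qed
next
  assume "\<exists>s\<ge>1. l = (\<lambda>j. s * (q * mi_unit i j) + mi_unit i j)"
  then obtain s where s: "s \<ge> 1" and "l = (\<lambda>j. s * (q * mi_unit i j) + mi_unit i j)" by blast
  then have l: "l = (\<lambda>j. if j = i then s * q + 1 else 0)" by (auto simp: mi_unit_def fun_eq_iff)
  have "mi_deg l = s * q + 1" "mi_power lam l = \<mu>"
    unfolding l mi_deg_single mi_power_single by (rule refl) (rule mu_power_resonant)
  moreover have "s * q \<ge> 1" using s q(1) by (simp add: Suc_le_eq)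
  ultimately show "resonance lam i l" by (simp add: resonance_def)
qed

lemma one_resonant: "one_resonant_index lam i (\<lambda>j. q * mi_unit i j)"
proof -
  have "(\<lambda>j. q * mi_unit i j) \<noteq> (\<lambda>_. 0)"
    using q(1) by (auto simp: mi_unit_def fun_eq_iff)
  then show ?thesis by (simp add: one_resonant_index_def resonance_iff) (simp add: mi_unit_def)
qed

lemmas W = diffeo_germ_repD[OF germ]

lemma F_deriv: "((\<lambda>z. F z $ j) has_derivative (\<lambda>v. lam $ j * v $ j)) (at 0)"
  using bounded_linear.has_derivative[OF bounded_linear_vec_nth diag, of j] by simp

lemma vanishes_F: "vanishes 1 F"
  by (rule diffeo_germ_rep_vanishes_1[OF germ])

lemma F_linear_part: "vanishes 2 (\<lambda>z. F z $ j - lam $ j * z $ j)"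
proof -
  have "partial_deriv (\<lambda>z. F z $ j) k 0 = (if k = j then lam $ j else 0)" for k
    using partial_deriv_eq[OF F_deriv, of j k] by (simp add: axis_def)
  then show ?thesis
    using vanishes_2_taylor[OF W(1,2,8), of j] W(3)
    by (simp add: if_distrib[of "\<lambda>x. x * _"] cong: if_cong)
qed

lemma vanishes_iterate: "vanishes 1 (F ^^ p)"
proof (induction p)
  case 0
  show ?case by (rule vanishesI[of _ 1]) simp
next
  case (Suc p)
  from vanishes_compose[OF vanishes_F this] show ?case by (simp add: o_def)
qed

lemma iterate_linear_part: "vanishes 2 (\<lambda>z. (F ^^ p) z $ j - lam $ j ^ p * z $ j)"
proof (induction p)
  case (Suc p)
  have "vanishes 2 (\<lambda>z. (F ((F ^^ p) z) $ j - lam $ j * (F ^^ p) z $ j) +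
      lam $ j * ((F ^^ p) z $ j - lam $ j ^ p * z $ j))"
    by (intro vanishes_add vanishes_cmult Suc vanishes_compose[OF F_linear_part vanishes_iterate])
  then show ?case by (simp add: algebra_simps)
qed simp

lemma iterate_deriv: "((\<lambda>z. (F ^^ p) z $ j) has_derivative (\<lambda>v. lam $ j ^ p * v $ j)) (at 0)"
proof -
  have "((\<lambda>z. ((F ^^ p) z $ j - lam $ j ^ p * z $ j) + lam $ j ^ p * z $ j) has_derivative
      (\<lambda>v. 0 + lam $ j ^ p * v $ j)) (at 0)"
    by (intro has_derivative_add vanishes_2_has_derivative iterate_linear_part has_derivative_mult_right
        bounded_linear_imp_has_derivative bounded_linear_vec_nth)
  then show ?thesis by simp
qed

lemma iterate_0 [simp]: "(F ^^ p) 0 = 0"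
  by (induction p) (auto simp: W(3))

text \<open>An iterate is controlled only as a germ: the neighbourhood shrinks with
  \<open>p\<close>, so that the previous iterate still maps into \<open>W\<close>.\<close>

lemma iterate_holomorphic:
  "\<exists>N. open N \<and> 0 \<in> N \<and> (\<forall>z\<in>N. \<forall>j. cdiff_at (\<lambda>z. (F ^^ p) z $ j) z)"
proof (induction p)
  case 0
  show ?case by (rule exI[of _ UNIV]) auto
next
  case (Suc p)
  then obtain N where N: "open N" "0 \<in> N" "\<And>z j. z \<in> N \<Longrightarrow> cdiff_at (\<lambda>z. (F ^^ p) z $ j) z" by blast
  have "continuous_on N (F ^^ p)" by (rule cdiff_imp_continuous_on) (rule N(3))
  then have "open (N \<inter> (F ^^ p) -` W)" using N(1) W(1) by (rule continuous_open_preimage)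
  moreover have "cdiff_at (\<lambda>z. (F ^^ Suc p) z $ j) z" if "z \<in> N \<inter> (F ^^ p) -` W" for z j
    using cdiff_at_compose[of "\<lambda>z. F z $ j" "F ^^ p" z] W(8) N(3) that by simp
  ultimately show ?case using N W(2) by (intro exI[of _ "N \<inter> (F ^^ p) -` W"]) auto
qed

text \<open>By the condition on \<mu> the map multiplies \<open>(z $ i) ^ m\<close> by \<mu> up to
  higher order, exactly as it multiplies \<open>u\<close>, so each application adds the same term
  and the contributions accumulate to \<open>p * b\<close>. Writing the coefficient as
  \<open>\<mu> * b\<close> lets \<open>\<mu> ^ p\<close> split off; for \<open>p = q\<close> that
  factor is 1.\<close>

lemma iterate_asymptotic:
  assumes van: "vanishes (Suc m) (\<lambda>z. u (F z) - \<mu> * u z - \<mu> * b * (z $ i) ^ m)" and m: "\<mu> ^ m = \<mu>"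
  shows "vanishes (Suc m) (\<lambda>z. u ((F ^^ p) z) - \<mu> ^ p * (u z + of_nat p * b * (z $ i) ^ m))"
proof (induction p)
  case (Suc p)
  let ?b = "of_nat p * b"
  have 1: "vanishes (Suc m) (\<lambda>z. u ((F ^^ p) (F z)) - \<mu> ^ p * (u (F z) + ?b * (F z $ i) ^ m))"
    by (rule vanishes_compose[OF Suc vanishes_F])
  have 2: "vanishes (Suc m) (\<lambda>z. \<mu> ^ p * (u (F z) - \<mu> * u z - \<mu> * b * (z $ i) ^ m))"
    by (intro vanishes_cmult van)
  have "vanishes 1 (\<lambda>z. F z $ i)" by (rule vanishes_compose[OF vanishes_nth vanishes_F])
  then have 3: "vanishes (Suc m) (\<lambda>z. \<mu> ^ p * ?b * ((F z $ i) ^ m - (\<mu> * z $ i) ^ m))"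
    by (intro vanishes_cmult vanishes_power_diff F_linear_part vanishes_nth)
  have "vanishes (Suc m) (\<lambda>z. (u ((F ^^ p) (F z)) - \<mu> ^ p * (u (F z) + ?b * (F z $ i) ^ m)) +
      \<mu> ^ p * (u (F z) - \<mu> * u z - \<mu> * b * (z $ i) ^ m) + \<mu> ^ p * ?b * ((F z $ i) ^ m - (\<mu> * z $ i) ^ m))"
    by (intro vanishes_add 1 2 3)
  also have "(\<lambda>z. (u ((F ^^ p) (F z)) - \<mu> ^ p * (u (F z) + ?b * (F z $ i) ^ m)) +
      \<mu> ^ p * (u (F z) - \<mu> * u z - \<mu> * b * (z $ i) ^ m) + \<mu> ^ p * ?b * ((F z $ i) ^ m - (\<mu> * z $ i) ^ m)) =
      (\<lambda>z. u ((F ^^ Suc p) z) - \<mu> ^ Suc p * (u z + of_nat (Suc p) * b * (z $ i) ^ m))"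
    by (rule ext) (simp add: funpow_swap1 power_mult_distrib m algebra_simps)
  finally show ?case .
qed simp

lemma fixed_point_curve:
  obtains \<gamma> r where "r > 0" "\<And>j. (\<lambda>t. \<gamma> t $ j) holomorphic_on ball 0 r" "\<gamma> 0 = 0"
    "\<And>t. t \<in> ball 0 r \<Longrightarrow> \<gamma> t $ i = t"
    "\<And>t j. t \<in> ball 0 r \<Longrightarrow> j \<noteq> i \<Longrightarrow> (F ^^ q) (\<gamma> t) $ j = \<gamma> t $ j"
    "(\<lambda>t. (F ^^ q) (\<gamma> t) $ i - t) holomorphic_on ball 0 r" "vanishes 1 \<gamma>"
proof -
  obtain N where N: "open N" "0 \<in> N" "\<And>z j. z \<in> N \<Longrightarrow> cdiff_at (\<lambda>z. (F ^^ q) z $ j) z"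
    using iterate_holomorphic[of q] by (elim exE conjE) (rule that, auto)
  \<comment> \<open>The distinguished coordinate is kept and the others are replaced by their
    displacement under \<open>F ^^ q\<close>. The differential at the origin is diagonal with
    entries 1 and \<open>lam $ j ^ q - 1\<close>, all nonzero, and the curve is the preimage of the
    distinguished axis.\<close>
  define H where "H z = (\<chi> j. if j = i then z $ i else (F ^^ q) z $ j - z $ j)" for z
  define d where "d j = (if j = i then 1 else lam $ j ^ q - 1)" for j
  define A :: "complex ^ 'n ^ 'n" where "A = (\<chi> j k. if j = k then d j else 0)"
  have "holomorphic_map_on H N" unfolding holomorphic_map_on_cdiff_at[OF N(1)]
  proof (intro ballI allI)
    fix z j assume "z \<in> N"
    then show "cdiff_at (\<lambda>z. H z $ j) z"
      by (cases "j = i") (auto simp: H_def intro!: cdiff_at_diff N(3))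
  qed
  moreover have "(H has_derivative (*v) A) (at 0)"
  proof -
    have "((\<lambda>z. if j = i then z $ i else (F ^^ q) z $ j - z $ j) has_derivative (\<lambda>v. d j * v $ j)) (at 0)" for j
    proof (cases "j = i")
      case True
      then show ?thesis by (simp add: d_def bounded_linear_imp_has_derivative bounded_linear_vec_nth)
    next
      case False
      have "((\<lambda>z. (F ^^ q) z $ j - z $ j) has_derivative (\<lambda>v. lam $ j ^ q * v $ j - v $ j)) (at 0)"
        by (intro has_derivative_diff iterate_deriv bounded_linear_imp_has_derivative bounded_linear_vec_nth)
      with False show ?thesis by (simp add: d_def algebra_simps)
    qed
    then have "(H has_derivative (\<lambda>v. \<chi> j. d j * v $ j)) (at 0)"
      unfolding H_def by (rule has_derivative_vec_lambda)
    moreover have "(*v) A = (\<lambda>v. \<chi> j. d j * v $ j)"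
      by (rule ext) (simp add: vec_eq_iff A_def matrix_vector_mult_def if_distrib[of "\<lambda>x. x * _"] cong: if_cong)
    ultimately show ?thesis by simp
  qed
  moreover have "invertible A"
  proof -
    have d: "d j \<noteq> 0" for j using lam_power_ne_1[of j] by (simp add: d_def)
    let ?B = "(\<chi> j k. if j = k then 1 / d j else 0) :: complex ^ 'n ^ 'n"
    have "A ** ?B = mat 1" "?B ** A = mat 1"
      using d by (auto simp: A_def matrix_matrix_mult_def mat_def vec_eq_iff
          if_distrib[of "\<lambda>x. x * _"] cong: if_cong)
    then show ?thesis unfolding invertible_def by blast
  qed
  ultimately obtain V where V: "0 \<in> V" "V \<subseteq> N" "biholomorphic_map_on H V"
    using holomorphic_inverse_function[OF N(1,2)] by blast
  have H0: "H 0 = 0" by (simp add: H_def vec_eq_iff)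
  then have HV: "diffeo_germ_rep H V" using V by (simp add: diffeo_germ_rep_def)
  note D = diffeo_germ_repD[OF HV]
  obtain r where r: "r > 0" "ball 0 r \<subseteq> H ` V" using D(5,6) open_contains_ball by blast
  define \<gamma> where "\<gamma> t = inv_into V H (vec_upd 0 i t)" for t
  have mem: "vec_upd 0 i t \<in> H ` V" if "t \<in> ball 0 r" for t
    using norm_vec_upd_0[of i t] that r by (auto simp: subset_iff)
  have \<gamma>V: "\<gamma> t \<in> V" "H (\<gamma> t) = vec_upd 0 i t" if "t \<in> ball 0 r" for t
    using mem[OF that] by (auto simp: \<gamma>_def inv_into_into f_inv_into_f)
  have hol: "(\<lambda>t. \<gamma> t $ j) holomorphic_on ball 0 r" for j
    unfolding \<gamma>_def by (rule cdiff_at_vec_upd_holomorphic[where f = "\<lambda>w. inv_into V H w $ j"]) (use mem D(9) in blast)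
  have i: "\<gamma> t $ i = t" if "t \<in> ball 0 r" for t
    using arg_cong[OF \<gamma>V(2)[OF that], of "\<lambda>z. z $ i"] by (simp add: H_def)
  have ne: "(F ^^ q) (\<gamma> t) $ j = \<gamma> t $ j" if "t \<in> ball 0 r" "j \<noteq> i" for t j
    using arg_cong[OF \<gamma>V(2)[OF that(1)], of "\<lambda>z. z $ j"] that by (simp add: H_def)
  have "cdiff_at (\<lambda>w. (F ^^ q) (inv_into V H w) $ i) (vec_upd 0 i t)" if "t \<in> ball 0 r" for t
  proof (rule cdiff_at_compose[where f = "\<lambda>z. (F ^^ q) z $ i" and g = "inv_into V H"])
    show "cdiff_at (\<lambda>z. (F ^^ q) z $ i) (inv_into V H (vec_upd 0 i t))"
      using \<gamma>V(1)[OF that] V(2) unfolding \<gamma>_def by (intro N(3)) (rule subsetD)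
    show "cdiff_at (\<lambda>z. inv_into V H z $ j) (vec_upd 0 i t)" for j by (rule D(9)[OF mem[OF that]])
  qed
  then have "(\<lambda>t. (F ^^ q) (\<gamma> t) $ i) holomorphic_on ball 0 r"
    unfolding \<gamma>_def by (rule cdiff_at_vec_upd_holomorphic[where f = "\<lambda>w. (F ^^ q) (inv_into V H w) $ i"])
  then have h: "(\<lambda>t. (F ^^ q) (\<gamma> t) $ i - t) holomorphic_on ball 0 r" by (intro holomorphic_intros)
  have "vec_upd 0 i 0 = (0 :: complex ^ 'n)" by (simp add: vec_eq_iff)
  then have 0: "\<gamma> 0 = 0" by (simp add: \<gamma>_def D(7))
  have "vanishes 1 \<gamma>"
    by (rule vanishes_vec) (rule holomorphic_vanishes_1[OF hol r(1)], simp add: 0)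
  from that[OF r(1) hol 0 i ne h this] show thesis .
qed

text \<open>The increment of \<open>u\<close> on the curve and \<open>h\<close> are bounded by
  multiples of each other, so they have the same order of vanishing. The curve is a parameter of the
  lemma, so that different choices of \<open>u\<close> speak about the same
  \<open>h\<close>.\<close>

lemma curve_displacement:
  fixes u :: "complex ^ 'n \<Rightarrow> complex"
  assumes S: "open S" "0 \<in> S" and u: "\<And>z. z \<in> S \<Longrightarrow> cdiff_at u z" and c: "partial_deriv u i 0 \<noteq> 0"
    and van: "vanishes (Suc m) (\<lambda>z. u ((F ^^ q) z) - u z - A * (z $ i) ^ m)"
    and r: "r > 0" and \<gamma>0: "\<gamma> 0 = 0" and \<gamma>i: "\<And>t. t \<in> ball 0 r \<Longrightarrow> \<gamma> t $ i = t"
    and \<gamma>j: "\<And>t j. t \<in> ball 0 r \<Longrightarrow> j \<noteq> i \<Longrightarrow> (F ^^ q) (\<gamma> t) $ j = \<gamma> t $ j"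
    and h: "(\<lambda>t. (F ^^ q) (\<gamma> t) $ i - t) holomorphic_on ball 0 r" and \<gamma>v: "vanishes 1 \<gamma>"
  shows "A = 0 \<Longrightarrow> vanishes (Suc m) (\<lambda>t. (F ^^ q) (\<gamma> t) $ i - t)"
    and "A \<noteq> 0 \<Longrightarrow> vanishes m (\<lambda>t. (F ^^ q) (\<gamma> t) $ i - t)"
    and "A \<noteq> 0 \<Longrightarrow> \<not> vanishes (Suc m) (\<lambda>t. (F ^^ q) (\<gamma> t) $ i - t)"
proof -
  define h where "h t = (F ^^ q) (\<gamma> t) $ i - t" for t
  define \<Delta> where "\<Delta> t = u ((F ^^ q) (\<gamma> t)) - u (\<gamma> t)" for t
  define c where "c = partial_deriv u i 0"
  have c0: "c \<noteq> 0" using c by (simp add: c_def)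
  have ball: "\<forall>\<^sub>F t in nhds 0. t \<in> ball 0 r" using r by (intro eventually_nhds_in_open) auto
  have hv: "vanishes 1 h"
    using h unfolding h_def by (rule holomorphic_vanishes_1) (use r in \<open>auto simp: \<gamma>0\<close>)
  obtain \<rho> where \<rho>: "\<rho> > 0" "\<And>z s. norm z < \<rho> \<Longrightarrow> norm s < \<rho> \<Longrightarrow>
      norm (u (z + s *s axis i 1) - u z - c * s) \<le> norm c / 2 * norm s"
    using complex_increment_along_axis[OF S u c_def[symmetric] c0] by blast
  have "\<forall>\<^sub>F t in nhds 0. dist (\<gamma> t) 0 < \<rho>" using tendstoD[OF vanishes_1_tendsto[OF \<gamma>v] \<rho>(1)] .
  moreover have "\<forall>\<^sub>F t in nhds 0. dist (h t) 0 < \<rho>" using tendstoD[OF vanishes_1_tendsto[OF hv] \<rho>(1)] .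
  ultimately have inc: "\<forall>\<^sub>F t in nhds 0. norm (\<Delta> t - c * h t) \<le> norm c / 2 * norm (h t)"
    using ball
  proof eventually_elim
    case (elim t)
    have "(F ^^ q) (\<gamma> t) = \<gamma> t + h t *s axis i 1"
      using \<gamma>i[OF elim(3)] \<gamma>j[OF elim(3)] by (simp add: vec_eq_iff h_def axis_def)
    then show ?case using \<rho>(2)[of "\<gamma> t" "h t"] elim by (simp add: \<Delta>_def)
  qed
  have Dh: "vanishes n \<Delta> \<Longrightarrow> vanishes n h" for n
  proof -
    assume "vanishes n \<Delta>"
    then have "vanishes n (\<lambda>t. 2 / c * \<Delta> t)" by (rule vanishes_cmult)
    then show "vanishes n h"
    proof (rule vanishes_cong)
      show "\<forall>\<^sub>F t in nhds 0. norm (h t) \<le> norm (2 / c * \<Delta> t)" using inc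
      proof eventually_elim
        case (elim t)
        have "norm (c * h t) \<le> norm (\<Delta> t - c * h t) + norm (\<Delta> t)"
          by (metis norm_triangle_sub norm_minus_commute add.commute)
        then have "norm c * norm (h t) \<le> norm c / 2 * norm (h t) + norm (\<Delta> t)" using elim by (simp add: norm_mult)
        then show ?case using c0 by (simp add: norm_mult norm_divide field_simps)
      qed
    qed
  qed
  have hD: "vanishes n h \<Longrightarrow> vanishes n \<Delta>" for n
  proof -
    assume "vanishes n h"
    then have "vanishes n (\<lambda>t. 2 * c * h t)" by (rule vanishes_cmult)
    then show "vanishes n \<Delta>"
    proof (rule vanishes_cong)
      show "\<forall>\<^sub>F t in nhds 0. norm (\<Delta> t) \<le> norm (2 * c * h t)" using inc
      proof eventually_elim
        case (elim t)
        have "norm (\<Delta> t) \<le> norm (\<Delta> t - c * h t) + norm (c * h t)" by (metis diff_add_cancel norm_triangle_ineq)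
        moreover have "0 \<le> norm c * norm (h t)" by simp
        ultimately show ?case using elim unfolding norm_mult norm_numeral by linarith
      qed
    qed
  qed
  have "vanishes (Suc m) (\<lambda>t. \<Delta> t - A * (\<gamma> t $ i) ^ m)"
    unfolding \<Delta>_def by (rule vanishes_compose[OF van \<gamma>v])
  then have DA: "vanishes (Suc m) (\<lambda>t. \<Delta> t - A * t ^ m)"
    by (rule vanishes_eventually_cong) (use ball in eventually_elim, simp add: \<gamma>i)
  have hfold: "(\<lambda>t. (F ^^ q) (\<gamma> t) $ i - t) = h" by (simp add: h_def[abs_def])
  show "vanishes (Suc m) (\<lambda>t. (F ^^ q) (\<gamma> t) $ i - t)" if "A = 0"
    unfolding hfold using DA that by (intro Dh) simp
  have "vanishes (1 * m) (\<lambda>t :: complex. t ^ m)"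
    by (rule vanishes_power) (rule vanishesI[of _ 1], simp)
  then have "vanishes m (\<lambda>t. A * t ^ m)" by (intro vanishes_cmult) simp
  from vanishes_add[OF vanishes_mono[OF DA] this] have "vanishes m \<Delta>" by simp
  then show "vanishes m (\<lambda>t. (F ^^ q) (\<gamma> t) $ i - t)" if "A \<noteq> 0"
    unfolding hfold by (rule Dh)
  show "\<not> vanishes (Suc m) (\<lambda>t. (F ^^ q) (\<gamma> t) $ i - t)" if "A \<noteq> 0"
  proof
    assume "vanishes (Suc m) (\<lambda>t. (F ^^ q) (\<gamma> t) $ i - t)"
    then have "vanishes (Suc m) \<Delta>" unfolding hfold by (rule hD)
    from vanishes_diff[OF this DA] have "vanishes (Suc m) (\<lambda>t. A * t ^ m)" by simp
    then show False using not_vanishes_power[OF that] by blast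
  qed
qed

end

section \<open>Formal normal form of the first component\<close>

lemma mi_deg_0 [simp]: "mi_deg (\<lambda>_. 0) = 0"
  by simp

lemma vanishes_bigo:
  fixes f :: "complex ^ 'n::finite \<Rightarrow> complex"
  shows "(\<lambda>z. norm (f z)) \<in> O[nhds 0](\<lambda>z. norm z ^ n) \<longleftrightarrow> vanishes n f"
proof
  assume "(\<lambda>z. norm (f z)) \<in> O[nhds 0](\<lambda>z. norm z ^ n)"
  then obtain c where "\<forall>\<^sub>F z in nhds 0. norm (norm (f z)) \<le> c * norm (norm z ^ n)"
    by (rule landau_o.bigE)
  then show "vanishes n f" by (intro vanishesI[of _ c]) simp
next
  assume "vanishes n f"
  then obtain C where "\<forall>\<^sub>F z in nhds 0. norm (f z) \<le> C * norm z ^ n" using vanishesE by blast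
  then show "(\<lambda>z. norm (f z)) \<in> O[nhds 0](\<lambda>z. norm z ^ n)" by (intro bigoI[of _ C]) simp
qed

text \<open>A holomorphic function that is zero at the origin but not identically zero is bounded
  below near it by a multiple of some power of the modulus, and this contradicts the next order.
  Arbitrarily large orders are enough, and only those of the form \<open>Suc (k * q + 1)\<close>
  become available.\<close>

lemma holomorphic_vanishes_all_imp_0:
  assumes f: "f holomorphic_on ball 0 r" and r: "r > 0" and van: "\<And>n. \<exists>m\<ge>n. vanishes m f"
    and t: "t \<in> ball 0 r"
  shows "f t = 0"
proof (rule ccontr)
  assume ft: "f t \<noteq> 0"
  have van': "vanishes n f" for n using van vanishes_mono by blast
  have f0: "f 0 = 0" using vanishes_at_0[OF van'] .
  obtain k n s where k: "0 < k" and s: "0 < s"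
    and le: "\<And>w. w \<in> ball 0 s \<Longrightarrow> k * norm (w - 0) ^ n \<le> norm (f w - f 0)"
  proof (rule holomorphic_lower_bound_difference[OF f open_ball connected_ball _ t])
    show "0 \<in> ball (0 :: complex) r" using r by simp
    show "f t \<noteq> f 0" using ft f0 by simp
  next
    fix k n s assume "0 < k" "0 < s" "\<And>w. w \<in> ball 0 s \<Longrightarrow> k * norm (w - 0) ^ n \<le> norm (f w - f 0)"
    then show thesis by (rule that)
  qed
  have "vanishes (Suc n) (\<lambda>t. complex_of_real k * t ^ n)"
  proof (rule vanishes_cong[OF van'])
    have "\<forall>\<^sub>F t :: complex in nhds 0. t \<in> ball 0 s" using s by (intro eventually_nhds_in_open) auto
    then show "\<forall>\<^sub>F t in nhds 0. norm (complex_of_real k * t ^ n) \<le> norm (f t)"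
    proof eventually_elim
      case (elim t)
      then show ?case using le[OF elim] k f0 by (simp add: norm_mult norm_power)
    qed
  qed
  then show False using not_vanishes_power[of "complex_of_real k" n] k by simp
qed

context one_resonant_germ
begin

lemma expansion_leading:
  assumes "\<And>j. has_mfps_expansion (\<lambda>z. F z $ j) (T $ j)"
  shows "leading_monomial (T $ j) (lam $ j) (mi_unit j)"
proof -
  have jet: "has_jet 1 (\<lambda>z. F z $ j) (T $ j)" by (rule has_mfps_expansion_has_jet[OF assms])
  show ?thesis
    using has_jet_linear_coeff[OF jet order.refl F_deriv] W(3)
    by (intro leading_monomial_unitI) (auto simp: axis_def)
qed

lemma expansion_exists:
  obtains T where "\<And>j. has_mfps_expansion (\<lambda>z. F z $ j) (T $ j)"
proof -
  have "\<exists>T. has_mfps_expansion (\<lambda>z. F z $ j) T" for j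
    using cdiff_has_mfps_expansion[OF W(1,2,8)] by blast
  then have "\<forall>j. \<exists>T. has_mfps_expansion (\<lambda>z. F z $ j) T" by blast
  then obtain T where T: "\<forall>j. has_mfps_expansion (\<lambda>z. F z $ j) (T j)" by (rule choice[THEN exE])
  show thesis by (rule that[of "\<chi> j. T j"]) (use T in simp)
qed

text \<open>In degree one, row \<open>i\<close> of the linear part is a left eigenvector of the
  diagonal differential for \<mu>. The other diagonal entries differ from \<mu> in modulus, so only
  the entry at \<open>i\<close> survives, and invertibility makes it nonzero.\<close>

lemma formal_coord_change_row:
  assumes "formal_coord_change \<Phi>" "formal_map_compose \<Phi> T = formal_map_compose G \<Phi>"
    "G $ i = mfps_const \<mu> * mfps_X i" and lead: "\<And>j. leading_monomial (T $ j) (lam $ j) (mi_unit j)"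
  shows "mfps_nth (mfps_compose (\<Phi> $ i) T) m = \<mu> * mfps_nth (\<Phi> $ i) m"
    and "mfps_nth (\<Phi> $ i) (mi_unit i) \<noteq> 0"
proof -
  have \<Phi>0: "mfps_nth (\<Phi> $ i) (\<lambda>_. 0) = 0" using assms by (simp add: formal_coord_change_def)
  have "mfps_compose (\<Phi> $ i) T = mfps_compose (G $ i) \<Phi>"
    using arg_cong[OF assms(2), of "\<lambda>z. z $ i"] by (simp add: formal_map_compose_def)
  then show eq: "mfps_nth (mfps_compose (\<Phi> $ i) T) m = \<mu> * mfps_nth (\<Phi> $ i) m" for m
    using mfps_compose_linear[where \<Phi> = \<Phi> and i = i and f = "G $ i" and c = \<mu>] \<Phi>0 assms(3)
    by (simp add: mfps_const_mult_X_nth)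
  have off: "mfps_nth (\<Phi> $ i) (mi_unit j) = 0" if "j \<noteq> i" for j
  proof -
    have "{l :: 'n \<Rightarrow> nat. mi_deg l < mi_deg (mi_unit j)} = {\<lambda>_. 0}" by auto
    then have "lam $ j * mfps_nth (\<Phi> $ i) (mi_unit j) = \<mu> * mfps_nth (\<Phi> $ i) (mi_unit j)"
      using eq[of "mi_unit j"] mfps_compose_triangular[where \<Phi> = T, OF lead, of "\<Phi> $ i" "mi_unit j"] \<Phi>0 by simp
    moreover have "lam $ j \<noteq> \<mu>" using attracting[OF that] norm_mu by auto
    ultimately show ?thesis by simp
  qed
  let ?M = "(\<chi> i j. mfps_nth (\<Phi> $ i) (mi_unit j)) :: complex ^ 'n ^ 'n"
  obtain B where B: "?M ** B = mat 1" using assms(1) unfolding formal_coord_change_def invertible_def by blast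
  show "mfps_nth (\<Phi> $ i) (mi_unit i) \<noteq> 0"
  proof
    assume "mfps_nth (\<Phi> $ i) (mi_unit i) = 0"
    then have "?M $ i $ j = 0" for j using off[of j] by (cases "j = i") auto
    then have "(?M ** B) $ i $ i = 0" by (simp add: matrix_matrix_mult_def)
    then show False using B by (simp add: mat_def)
  qed
qed

text \<open>Row \<open>i\<close> of the formal conjugacy is an identity between coefficients. Its
  truncation at degree \<open>N\<close> gives a polynomial \<open>u\<close>, which turns a possibly
  divergent series into an estimate for the germ.\<close>

lemma formally_linearizable_asymptotic:
  assumes "formally_linearizable_comp i \<mu> F" "N \<ge> 1"
  obtains u where "\<And>z. cdiff_at u z" "partial_deriv u i 0 \<noteq> 0" "vanishes (Suc N) (\<lambda>z. u (F z) - \<mu> * u z)"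
proof -
  obtain T \<Phi> G where T: "\<And>j. has_mfps_expansion (\<lambda>z. F z $ j) (T $ j)"
    and \<Phi>: "formal_coord_change \<Phi>" "formal_map_compose \<Phi> T = formal_map_compose G \<Phi>" "G $ i = mfps_const \<mu> * mfps_X i"
    using assms(1) unfolding formally_linearizable_comp_def by blast
  note lead = expansion_leading[OF T]
  note row = formal_coord_change_row[OF \<Phi> lead]
  have "jet N (mfps_compose (\<Phi> $ i) T) z = \<mu> * jet N (\<Phi> $ i) z" for z
    by (simp add: jet_def row(1) sum_distrib_left mult_ac)
  then have "vanishes (Suc N) (\<lambda>z. jet N (\<Phi> $ i) (F z) - \<mu> * jet N (\<Phi> $ i) z)"
    using jet_compose[OF has_mfps_expansion_has_jet[OF T] lead, of N "\<Phi> $ i"] by simp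
  then show thesis
    by (intro that[of "jet N (\<Phi> $ i)"]) (use row(2) assms(2) in \<open>auto simp: partial_deriv_jet\<close>)
qed

text \<open>Solving the homological equation monomial by monomial leaves only the resonant monomials.\<close>

lemma formal_resonant_form:
  assumes lead: "\<And>j. leading_monomial (T $ j) (lam $ j) (mi_unit j)"
  shows "\<exists>u. leading_monomial u 1 (mi_unit i) \<and>
    (\<forall>m. mfps_nth (mfps_compose u T) m \<noteq> \<mu> * mfps_nth u m \<longrightarrow> resonance lam i m)"
proof -
  let ?R = "\<lambda>m f. \<Sum>l | mi_deg l < mi_deg m. f l * mfps_nth (\<Prod>j\<in>UNIV. (T $ j) ^ l j) m"
  \<comment> \<open>In degree at most 1 the series is prescribed to be the distinguished coordinate.
    Above that, the equation is imposed only where the divisor \<open>\<mu> - mi_power lam m\<close>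
    is nonzero; elsewhere the coefficient is left free.\<close>
  let ?P = "\<lambda>m f r. if mi_deg m \<le> 1 then r = (if m = mi_unit i then 1 else 0)
      else mi_power lam m \<noteq> \<mu> \<longrightarrow> mi_power lam m * r + ?R m f = \<mu> * r"
  have "\<exists>u. \<forall>m. ?P m (mfps_nth u) (mfps_nth u m)"
  proof (rule mfps_recursion)
    fix f g :: "('n \<Rightarrow> nat) \<Rightarrow> complex" and m :: "'n \<Rightarrow> nat" and r
    assume "\<And>l. mi_deg l < mi_deg m \<Longrightarrow> f l = g l"
    then have "?R m f = ?R m g" by (intro sum.cong) auto
    then show "?P m f r = ?P m g r" by simp
  next
    fix f :: "('n \<Rightarrow> nat) \<Rightarrow> complex" and m :: "'n \<Rightarrow> nat"
    show "\<exists>r. ?P m f r"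
    proof (cases "mi_deg m \<le> 1")
      case False
      \<comment> \<open>If the divisor is zero, the quotient is 0 by convention and the implication
        to be shown is vacuous.\<close>
      show ?thesis
        by (rule exI[of _ "?R m f / (\<mu> - mi_power lam m)"]) (use False in \<open>auto simp: field_simps\<close>)
    qed auto
  qed
  then obtain u where u: "\<And>m. ?P m (mfps_nth u) (mfps_nth u m)" by blast
  have lead_u: "leading_monomial u 1 (mi_unit i)"
  proof (rule leading_monomial_unitI)
    show "mfps_nth u (\<lambda>_. 0) = 0" using u[of "\<lambda>_. 0"] by (simp add: mi_deg_def)
    show "mfps_nth u (mi_unit j) = (if j = i then 1 else 0)" for j using u[of "mi_unit j"] by simp
  qed
  moreover have "resonance lam i m" if ne: "mfps_nth (mfps_compose u T) m \<noteq> \<mu> * mfps_nth u m" for m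
  proof -
    have eq: "mfps_nth (mfps_compose u T) m = mi_power lam m * mfps_nth u m + ?R m (mfps_nth u)"
      by (rule mfps_compose_triangular[OF lead])
    have "\<not> mi_deg m \<le> 1"
    proof
      assume le: "mi_deg m \<le> 1"
      have "mfps_nth u l = 0" if "mi_deg l < mi_deg m" for l
      proof -
        have "mi_deg l = 0" using that le by linarith
        then show ?thesis using lead_u unfolding leading_monomial_def by auto
      qed
      then have "?R m (mfps_nth u) = 0" by (intro sum.neutral) auto
      moreover have "mfps_nth u m = (if m = mi_unit i then 1 else 0)" using u[of m] le by simp
      ultimately show False using ne eq by (auto split: if_splits)
    qed
    then show ?thesis using u[of m] ne eq by (auto simp: resonance_def split: if_splits)
  qed
  ultimately show ?thesis by blast
qed

text \<open>The eigenfunction \<open>u\<close> is completed to a coordinate change by the remaining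
  coordinate functions. Since \<open>\<Phi>\<close> is tangent to the identity, composition with it
  on the right can be inverted degree by degree, and this inversion produces the other components of
  \<open>G\<close>.\<close>

lemma formally_linearizableI:
  assumes T: "\<And>j. has_mfps_expansion (\<lambda>z. F z $ j) (T $ j)"
    and u: "leading_monomial u 1 (mi_unit i)" "\<And>m. mfps_nth (mfps_compose u T) m = \<mu> * mfps_nth u m"
  shows "formally_linearizable_comp i \<mu> F"
proof -
  define \<Phi> where "\<Phi> = (\<chi> j. if j = i then u else mfps_X j)"
  have \<Phi>lead: "leading_monomial (\<Phi> $ j) ((\<chi> j. 1) $ j) (mi_unit j)" for j
    using u(1) by (auto simp: \<Phi>_def leading_monomial_def mfps_X.rep_eq)
  have \<Phi>0: "mfps_nth (\<Phi> $ j) (\<lambda>_. 0) = 0" for j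
    using \<Phi>lead[of j] unfolding leading_monomial_def by (auto simp: mi_deg_def)
  have one: "mi_power (\<chi> j. 1) m = 1" for m :: "'n \<Rightarrow> nat" by (simp add: mi_power_def)
  have inv: "\<exists>g. mfps_compose g \<Phi> = f" for f
  proof -
    let ?P = "\<lambda>m g r. r + (\<Sum>l | mi_deg l < mi_deg m. g l * mfps_nth (\<Prod>j\<in>UNIV. (\<Phi> $ j) ^ l j) m) = mfps_nth f m"
    have "\<exists>g. \<forall>m. ?P m (mfps_nth g) (mfps_nth g m)"
    proof (rule mfps_recursion)
      fix f g :: "('n \<Rightarrow> nat) \<Rightarrow> complex" and m :: "'n \<Rightarrow> nat" and r
      assume "\<And>l. mi_deg l < mi_deg m \<Longrightarrow> f l = g l"
      then have "(\<Sum>l | mi_deg l < mi_deg m. f l * mfps_nth (\<Prod>j\<in>UNIV. (\<Phi> $ j) ^ l j) m) =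
          (\<Sum>l | mi_deg l < mi_deg m. g l * mfps_nth (\<Prod>j\<in>UNIV. (\<Phi> $ j) ^ l j) m)" by (intro sum.cong) auto
      then show "?P m f r = ?P m g r" by simp
    next
      fix g :: "('n \<Rightarrow> nat) \<Rightarrow> complex" and m :: "'n \<Rightarrow> nat"
      show "\<exists>r. ?P m g r"
        by (rule exI[of _ "mfps_nth f m - (\<Sum>l | mi_deg l < mi_deg m. g l * mfps_nth (\<Prod>j\<in>UNIV. (\<Phi> $ j) ^ l j) m)"]) simp
    qed
    then obtain g where "\<forall>m. ?P m (mfps_nth g) (mfps_nth g m)" by blast
    then have "mfps_compose g \<Phi> = f"
      by (intro mfps_eqI) (simp add: mfps_compose_triangular[OF \<Phi>lead] one)
    then show ?thesis by blast
  qed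
  then have "\<forall>j. \<exists>g. mfps_compose g \<Phi> = T $ j" by blast
  then obtain g where g: "\<forall>j. mfps_compose (g j) \<Phi> = T $ j" by (rule choice[THEN exE])
  define G where "G = (\<chi> j. if j = i then mfps_const \<mu> * mfps_X i else g j)"
  have "mfps_compose (\<Phi> $ j) T = mfps_compose (G $ j) \<Phi>" for j
  proof (cases "j = i")
    case True
    have "mfps_nth (mfps_compose u T) m = mfps_nth (mfps_compose (mfps_const \<mu> * mfps_X i) \<Phi>) m" for m
      unfolding mfps_compose_linear[where \<Phi> = \<Phi> and i = i and c = \<mu>, OF \<Phi>0 mfps_const_mult_X_nth]
      using u(2) by (simp add: \<Phi>_def)
    then show ?thesis using True by (auto intro!: mfps_eqI simp: G_def \<Phi>_def)
  next
    case False
    have "mfps_nth (T $ j) (\<lambda>_. 0) = 0"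
      using expansion_leading[OF T, of j] unfolding leading_monomial_def by (auto simp: mi_deg_def)
    then have "mfps_nth (mfps_compose (mfps_X j) T) m = 1 * mfps_nth (T $ j) m" for m
      by (rule mfps_compose_linear) (simp add: mfps_X.rep_eq)
    then have "mfps_compose (mfps_X j) T = T $ j" by (intro mfps_eqI) simp
    then show ?thesis using False g by (simp add: G_def \<Phi>_def)
  qed
  then have "formal_map_compose \<Phi> T = formal_map_compose G \<Phi>" by (simp add: formal_map_compose_def)
  moreover have "formal_coord_change \<Phi>"
  proof -
    have "mfps_nth (\<Phi> $ j) (mi_unit k) = (if j = k then 1 else 0)" for j k
      using \<Phi>lead[of j] unfolding leading_monomial_def by auto
    then have "(\<chi> j k. mfps_nth (\<Phi> $ j) (mi_unit k)) = (mat 1 :: complex ^ 'n ^ 'n)"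
      by (simp add: mat_def)
    moreover have "invertible (mat 1 :: complex ^ 'n ^ 'n)"
      unfolding invertible_def by (rule exI[of _ "mat 1"]) simp
    ultimately show ?thesis using \<Phi>0 by (simp add: formal_coord_change_def)
  qed
  moreover have "G $ i = mfps_const \<mu> * mfps_X i" by (simp add: G_def)
  ultimately show ?thesis using T unfolding formally_linearizable_comp_def by blast
qed

text \<open>\<open>P\<close> is the resonant form truncated at the first degree where the
  homological equation fails. Resonances have degree \<open>s * q + 1\<close>, one for each
  \<open>s\<close>, so up to this degree the defect \<open>E\<close> consists of a single monomial
  in the distinguished coordinate.\<close>

lemma formal_dichotomy:
  assumes "\<not> formally_linearizable_comp i \<mu> F"
  obtains k P a where "k \<ge> 1" "a \<noteq> 0" "\<And>z. cdiff_at P z" "vanishes 2 (\<lambda>z. P z - z $ i)"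
    "vanishes (Suc (k * q + 1)) (\<lambda>z. P (F z) - \<mu> * P z - a * (z $ i) ^ (k * q + 1))"
proof -
  obtain T where T: "\<And>j. has_mfps_expansion (\<lambda>z. F z $ j) (T $ j)" using expansion_exists by blast
  note lead = expansion_leading[OF T]
  obtain u where u: "leading_monomial u 1 (mi_unit i)"
    "\<And>m. mfps_nth (mfps_compose u T) m \<noteq> \<mu> * mfps_nth u m \<Longrightarrow> resonance lam i m"
    using formal_resonant_form[OF lead] by blast
  define E where "E m = mfps_nth (mfps_compose u T) m - \<mu> * mfps_nth u m" for m
  have "\<exists>m. E m \<noteq> 0" using formally_linearizableI[OF T u(1)] assms unfolding E_def by auto
  then have "\<exists>s. E (\<lambda>j. s * (q * mi_unit i j) + mi_unit i j) \<noteq> 0 \<and> s \<ge> 1"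
  proof
    fix m assume "E m \<noteq> 0"
    then have "resonance lam i m" using u(2) by (auto simp: E_def)
    then show ?thesis using \<open>E m \<noteq> 0\<close> unfolding resonance_iff by blast
  qed
  then obtain k where k: "E (\<lambda>j. k * (q * mi_unit i j) + mi_unit i j) \<noteq> 0" "k \<ge> 1"
    and least: "\<And>s. s < k \<Longrightarrow> s \<ge> 1 \<Longrightarrow> E (\<lambda>j. s * (q * mi_unit i j) + mi_unit i j) = 0"
    using exists_least_iff[of "\<lambda>s. E (\<lambda>j. s * (q * mi_unit i j) + mi_unit i j) \<noteq> 0 \<and> s \<ge> 1"] by blast
  define M where "M s = (\<lambda>j. s * (q * mi_unit i j) + mi_unit i j)" for s
  have M: "M s = (\<lambda>j. if j = i then s * q + 1 else 0)" for s by (auto simp: M_def mi_unit_def fun_eq_iff)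
  have degM: "mi_deg (M s) = s * q + 1" and powM: "mi_power z (M s) = (z $ i) ^ (s * q + 1)" for s z
    unfolding M mi_deg_single mi_power_single by (rule refl)+
  define N where "N = k * q + 1"
  have E0: "E m = (if m = M k then E (M k) else 0)" if "mi_deg m \<le> N" for m
  proof (cases "E m = 0")
    case False
    then have "resonance lam i m" using u(2) by (auto simp: E_def)
    then obtain s where s: "s \<ge> 1" "m = M s" using resonance_iff by (auto simp: M_def)
    then have "s \<le> k" using that q(1) by (simp add: degM N_def)
    moreover have "\<not> s < k" using least[of s] s False by (auto simp: M_def)
    ultimately show ?thesis using s by simp
  qed (use k in auto)
  have "jet N (mfps_compose u T) z = \<mu> * jet N u z + E (M k) * (z $ i) ^ N" for z
  proof -
    have "jet N (mfps_compose u T) z = \<mu> * jet N u z + (\<Sum>m | mi_deg m \<le> N. E m * mi_power z m)"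
      by (simp add: jet_def E_def sum_distrib_left algebra_simps flip: sum.distrib)
    also have "(\<Sum>m | mi_deg m \<le> N. E m * mi_power z m) =
        (\<Sum>m | mi_deg m \<le> N. if m = M k then E (M k) * mi_power z (M k) else 0)"
      by (intro sum.cong) (auto simp: E0)
    also have "\<dots> = E (M k) * (z $ i) ^ N"
      by (simp add: finite_mi_deg_le degM powM N_def)
    finally show ?thesis .
  qed
  then have "vanishes (Suc N) (\<lambda>z. jet N u (F z) - \<mu> * jet N u z - E (M k) * (z $ i) ^ N)"
    using jet_compose[OF has_mfps_expansion_has_jet[OF T] lead, of N u] by (simp add: diff_diff_eq)
  moreover have "vanishes 2 (\<lambda>z. jet N u z - z $ i)"
  proof -
    have "has_jet N (jet N u) u" by (simp add: has_jet_def)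
    then have "has_jet 1 (jet N u) u" by (rule has_jet_mono) (simp add: N_def)
    moreover have "mfps_nth u (mi_unit j) = (if j = i then 1 else 0)" "mfps_nth u (\<lambda>_. 0) = 0" for j
      using u(1) unfolding leading_monomial_def by auto
    ultimately show ?thesis
      unfolding has_jet_def jet_degree_1
      by (simp add: numeral_2_eq_2 if_distrib[of "\<lambda>x. x * _"] cong: if_cong)
  qed
  ultimately show thesis
    using that[OF k(2) k(1) cdiff_at_jet[of N u]] unfolding N_def M_def by blast
qed

end

section \<open>Order and formal linearizability\<close>

context one_resonant_germ
begin

text \<open>Only the distinguished coordinate changes, and the differential at the origin is the
  identity. The set \<open>S\<close> is prescribed so that the coordinates can be taken inside the
  domain of the germ.\<close>

lemma linearizing_coordinates:
  assumes P: "\<And>z. cdiff_at P z" "vanishes 2 (\<lambda>z. P z - z $ i)" and S: "open S" "0 \<in> S"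
  obtains V where "V \<subseteq> S" "diffeo_germ_rep (\<lambda>z. \<chi> j. if j = i then P z else z $ j) V"
proof -
  let ?\<psi> = "\<lambda>z. \<chi> j. if j = i then P z else z $ j"
  have P0: "P 0 = 0" using vanishes_at_0[of 1 "\<lambda>z. P z - z $ i"] P(2) by (simp add: numeral_2_eq_2)
  have "holomorphic_map_on ?\<psi> S" unfolding holomorphic_map_on_cdiff_at[OF S(1)]
  proof (intro ballI allI)
    show "cdiff_at (\<lambda>z. ?\<psi> z $ j) z" for z j using P(1) by (cases "j = i") auto
  qed
  moreover have "(?\<psi> has_derivative (*v) (mat 1)) (at 0)"
  proof -
    have "((\<lambda>z. if j = i then P z else z $ j) has_derivative (\<lambda>v. v $ j)) (at 0)" for j
    proof (cases "j = i")
      case True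
      have "((\<lambda>z. (P z - z $ i) + z $ i) has_derivative (\<lambda>v. 0 + v $ i)) (at 0)"
        by (intro has_derivative_add vanishes_2_has_derivative P bounded_linear_imp_has_derivative bounded_linear_vec_nth)
      with True show ?thesis by simp
    qed (simp add: bounded_linear_imp_has_derivative bounded_linear_vec_nth)
    then have "(?\<psi> has_derivative (\<lambda>v. \<chi> j. v $ j)) (at 0)" by (rule has_derivative_vec_lambda)
    moreover have "(*v) (mat 1) = (\<lambda>v :: complex ^ 'n. \<chi> j. v $ j)" by (rule ext) (simp add: vec_eq_iff)
    ultimately show ?thesis by simp
  qed
  moreover have "invertible (mat 1 :: complex ^ 'n ^ 'n)"
    unfolding invertible_def by (rule exI[of _ "mat 1"]) simp
  ultimately obtain V where V: "0 \<in> V" "V \<subseteq> S" "biholomorphic_map_on ?\<psi> V"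
    using holomorphic_inverse_function[OF S] by blast
  have "?\<psi> 0 = 0" using P0 by (simp add: vec_eq_iff)
  then have "diffeo_germ_rep ?\<psi> V" using V unfolding diffeo_germ_rep_def by blast
  from that[OF V(2) this] show thesis .
qed

lemma replace_coordinate_power:
  fixes u :: "complex ^ 'n \<Rightarrow> complex"
  assumes u: "vanishes 2 (\<lambda>z. u z - c * z $ i)"
  shows "vanishes (Suc m) (\<lambda>z. u z ^ m - (c * z $ i) ^ m)"
proof (rule vanishes_power_diff[OF u])
  show c: "vanishes 1 (\<lambda>z. c * z $ i)" by (intro vanishes_cmult vanishes_nth)
  have "vanishes 1 (\<lambda>z. (u z - c * z $ i) + c * z $ i)" by (intro vanishes_add c vanishes_mono[OF u]) simp
  then show "vanishes 1 u" by simp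
qed

text \<open>Since \<open>P\<close> has linear part \<open>z $ i\<close>, the monomial may be
  replaced by \<open>P z ^ m\<close> within the error, and \<open>P\<close> is the distinguished
  coordinate in the new chart.\<close>

lemma leading_term_in_coordinates:
  assumes \<psi>: "diffeo_germ_rep \<psi> V" "\<And>z. \<psi> z $ i = P z"
    and P: "vanishes 2 (\<lambda>z. P z - z $ i)"
    and van: "vanishes (Suc m) (\<lambda>z. P (F z) - \<mu> * P z - a * (z $ i) ^ m)"
  shows "vanishes (Suc m) (\<lambda>w. \<psi> (F (inv_into V \<psi> w)) $ i - (\<mu> * w $ i + a * (w $ i) ^ m))"
proof -
  note D = diffeo_germ_repD[OF \<psi>(1)]
  have "vanishes (Suc m) (\<lambda>z. a * (P z ^ m - (1 * z $ i) ^ m))"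
    using P by (intro vanishes_cmult replace_coordinate_power) simp
  from vanishes_diff[OF van this]
  have "vanishes (Suc m) (\<lambda>z. P (F z) - (\<mu> * P z + a * P z ^ m))" by (simp add: algebra_simps)
  from vanishes_compose[OF this diffeo_germ_rep_vanishes_1(2)[OF \<psi>(1)]]
  show ?thesis
  proof (rule vanishes_eventually_cong)
    have "\<forall>\<^sub>F w in nhds 0. w \<in> \<psi> ` V" using D by (intro eventually_nhds_in_open)
    then show "\<forall>\<^sub>F w in nhds 0. \<psi> (F (inv_into V \<psi> w)) $ i - (\<mu> * w $ i + a * (w $ i) ^ m) =
        P (F (inv_into V \<psi> w)) - (\<mu> * P (inv_into V \<psi> w) + a * P (inv_into V \<psi> w) ^ m)"
    proof eventually_elim
      case (elim w)
      have "P (inv_into V \<psi> w) = w $ i" using elim by (simp flip: \<psi>(2) add: f_inv_into_f)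
      then show ?case by (simp add: \<psi>(2))
    qed
  qed
qed

lemma has_leading_termI:
  assumes \<psi>: "diffeo_germ_rep \<psi> V" "\<And>z. \<psi> z $ i = P z" and a: "a \<noteq> 0"
    and P: "vanishes 2 (\<lambda>z. P z - z $ i)"
    and van: "vanishes (Suc (k * q + 1)) (\<lambda>z. P (F z) - \<mu> * P z - a * (z $ i) ^ (k * q + 1))"
  shows "has_leading_term i \<mu> q F k"
proof -
  let ?m = "k * q + 1"
  have "vanishes (Suc ?m) (\<lambda>w. \<psi> (F (inv_into V \<psi> w)) $ i - (\<mu> * w $ i + a * (w $ i) ^ ?m))"
    by (rule leading_term_in_coordinates[OF \<psi> P van])
  then have "(\<lambda>w. norm (\<psi> (F (inv_into V \<psi> w)) $ i - (\<mu> * w $ i + a * (w $ i) ^ ?m))) \<in> O[nhds 0](\<lambda>w. norm w ^ Suc ?m)"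
    by (simp only: vanishes_bigo)
  then show ?thesis unfolding has_leading_term_def using \<psi>(1) a
    by (intro exI[of _ \<psi>] exI[of _ V] exI[of _ a]) simp
qed

text \<open>
  The first component of the normalizing coordinates is an eigenvector of the differential to
  first order, so its differential at the origin is a multiple of the distinguished coordinate.
\<close>

lemma has_leading_termE:
  assumes "has_leading_term i \<mu> q F k" "k \<ge> 1"
  obtains u S A where "open S" "0 \<in> S" "\<And>z. z \<in> S \<Longrightarrow> cdiff_at u z" "partial_deriv u i 0 \<noteq> 0" "A \<noteq> 0"
    "vanishes (Suc (k * q + 1)) (\<lambda>z. u ((F ^^ q) z) - u z - A * (z $ i) ^ (k * q + 1))"
proof -
  let ?m = "k * q + 1"
  obtain \<psi> V a where \<psi>: "diffeo_germ_rep \<psi> V" and a: "a \<noteq> 0"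
    and O: "(\<lambda>w. norm (\<psi> (F (inv_into V \<psi> w)) $ i - (\<mu> * w $ i + a * (w $ i) ^ ?m))) \<in> O[nhds 0](\<lambda>w. norm w ^ (k * q + 2))"
    using assms(1) unfolding has_leading_term_def by blast
  note D = diffeo_germ_repD[OF \<psi>]
  define u where "u z = \<psi> z $ i" for z
  have cd: "cdiff_at u z" if "z \<in> V" for z unfolding u_def by (rule D(8)[OF that])
  have u0: "u 0 = 0" by (simp add: u_def D(3))
  have m2: "?m \<ge> 2" using assms(2) q(1) by (cases k; cases q) auto
  have "vanishes (Suc ?m) (\<lambda>w. \<psi> (F (inv_into V \<psi> w)) $ i - (\<mu> * w $ i + a * (w $ i) ^ ?m))"
    using O unfolding vanishes_bigo by simp
  from vanishes_compose[OF this diffeo_germ_rep_vanishes_1(1)[OF \<psi>]]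
  have van: "vanishes (Suc ?m) (\<lambda>z. u (F z) - \<mu> * u z - a * u z ^ ?m)"
  proof (rule vanishes_eventually_cong)
    have "\<forall>\<^sub>F z in nhds 0. z \<in> V" using D by (intro eventually_nhds_in_open)
    then show "\<forall>\<^sub>F z in nhds 0. u (F z) - \<mu> * u z - a * u z ^ ?m =
        \<psi> (F (inv_into V \<psi> (\<psi> z))) $ i - (\<mu> * \<psi> z $ i + a * (\<psi> z $ i) ^ ?m)"
    proof eventually_elim
      case (elim z)
      have "inv_into V \<psi> (\<psi> z) = z" using inv_into_f_f[OF D(4) elim] .
      then show ?case by (simp add: u_def)
    qed
  qed
  have u_deriv: "(u has_derivative (\<lambda>v. \<Sum>j\<in>UNIV. partial_deriv u j 0 * v $ j)) (at 0)"
    by (rule cdiff_at_has_derivative_partial[OF cd[OF D(2)]])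
  have u1: "vanishes 1 u" by (rule vanishes_has_derivative[OF u_deriv u0])
  have um: "vanishes 2 (\<lambda>z. a * u z ^ ?m)"
    using vanishes_mono[OF vanishes_power[OF u1, of ?m], of 2] m2 by (intro vanishes_cmult) simp
  have off: "partial_deriv u j 0 = 0" if "j \<noteq> i" for j
  proof -
    have "vanishes 2 (\<lambda>z. (u (F z) - \<mu> * u z - a * u z ^ ?m) + a * u z ^ ?m)"
      using m2 by (intro vanishes_add um vanishes_mono[OF van]) simp
    then have "((\<lambda>z. (u (F z) - \<mu> * u z - a * u z ^ ?m) + a * u z ^ ?m) has_derivative (\<lambda>_. 0)) (at 0)"
      by (rule vanishes_2_has_derivative)
    then have d0: "((\<lambda>z. u (F z) - \<mu> * u z) has_derivative (\<lambda>_. 0)) (at 0)" by simp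
    have "((\<lambda>z. u (F z)) has_derivative (\<lambda>v. \<Sum>j\<in>UNIV. partial_deriv u j 0 * (\<chi> j. lam $ j * v $ j) $ j)) (at 0)"
      by (rule has_derivative_compose[OF diag]) (simp add: W(3) u_deriv)
    then have "((\<lambda>z. u (F z) - \<mu> * u z) has_derivative (\<lambda>v. (\<Sum>j\<in>UNIV. partial_deriv u j 0 * (\<chi> j. lam $ j * v $ j) $ j) -
        \<mu> * (\<Sum>j\<in>UNIV. partial_deriv u j 0 * v $ j))) (at 0)"
      by (intro has_derivative_diff has_derivative_mult_right u_deriv)
    from has_derivative_unique[OF d0 this]
    have "0 = (\<Sum>l\<in>UNIV. partial_deriv u l 0 * (lam $ l * axis j 1 $ l)) - \<mu> * (\<Sum>l\<in>UNIV. partial_deriv u l 0 * axis j 1 $ l)"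
      by (auto simp: fun_eq_iff)
    then have "partial_deriv u j 0 * (lam $ j - \<mu>) = 0"
      by (auto simp: axis_def if_distrib[of "(*) _"] algebra_simps cong: if_cong)
    moreover have "lam $ j \<noteq> \<mu>" using attracting[OF that] norm_mu by auto
    ultimately show ?thesis by simp
  qed
  define c where "c = partial_deriv u i 0"
  \<comment> \<open>Otherwise the differential of \<open>u\<close> at the origin is zero, and so is
    that of \<open>u\<close> composed with the inverse of \<open>\<psi>\<close>, which is the
    coordinate function \<open>w $ i\<close>.\<close>
  have c0: "c \<noteq> 0"
  proof
    assume "c = 0"
    then have all0: "partial_deriv u j 0 = 0" for j using off[of j] by (cases "j = i") (auto simp: c_def)
    then have "(u has_derivative (\<lambda>v. 0)) (at (inv_into V \<psi> 0))" using u_deriv D(7) by simp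
    moreover obtain E where "(inv_into V \<psi> has_derivative E) (at 0)"
    proof -
      have "((\<lambda>w. \<chi> j. inv_into V \<psi> w $ j) has_derivative (\<lambda>v. \<chi> j. \<Sum>k\<in>UNIV. partial_deriv (\<lambda>w. inv_into V \<psi> w $ j) k 0 * v $ k)) (at 0)"
        by (intro has_derivative_vec_lambda cdiff_at_has_derivative_partial D(9)[OF D(6)])
      then show thesis using that by simp
    qed
    ultimately have "((\<lambda>w. u (inv_into V \<psi> w)) has_derivative (\<lambda>v. 0)) (at 0)"
      by (rule has_derivative_compose[rotated])
    then have "((\<lambda>w :: complex ^ 'n. w $ i) has_derivative (\<lambda>v. 0)) (at 0)"
      by (rule has_derivative_transform_within_open[OF _ D(5,6)]) (simp add: u_def f_inv_into_f)
    moreover have "((\<lambda>w :: complex ^ 'n. w $ i) has_derivative (\<lambda>v. v $ i)) (at 0)"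
      by (intro bounded_linear_imp_has_derivative bounded_linear_vec_nth)
    ultimately have "(\<lambda>v :: complex ^ 'n. 0) = (\<lambda>v. v $ i)" by (rule has_derivative_unique)
    from fun_cong[OF this, of "axis i 1"] show False by (simp add: axis_def)
  qed
  have "(\<Sum>k\<in>UNIV. partial_deriv u k 0 * z $ k) = c * z $ i" for z :: "complex ^ 'n"
  proof -
    have "(\<Sum>k\<in>UNIV. partial_deriv u k 0 * z $ k) = (\<Sum>k\<in>UNIV. if k = i then c * z $ i else 0)"
      by (intro sum.cong) (auto simp: off c_def)
    then show ?thesis by simp
  qed
  then have lin: "vanishes 2 (\<lambda>z. u z - c * z $ i)"
    using vanishes_2_taylor[OF D(1,2) cd u0] by simp
  \<comment> \<open>The power of \<open>c\<close> comes from replacing \<open>u z\<close> by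
    \<open>c * z $ i\<close>; division by \<mu> matches the form of the coefficient in
    \<open>iterate_asymptotic\<close>.\<close>
  define b where "b = a * c ^ ?m / \<mu>"
  have "vanishes (Suc ?m) (\<lambda>z. (u (F z) - \<mu> * u z - a * u z ^ ?m) + a * (u z ^ ?m - (c * z $ i) ^ ?m))"
    by (intro vanishes_add van vanishes_cmult replace_coordinate_power lin)
  then have "vanishes (Suc ?m) (\<lambda>z. u (F z) - \<mu> * u z - \<mu> * b * (z $ i) ^ ?m)"
    using mu_nonzero by (simp add: b_def algebra_simps)
  from iterate_asymptotic[OF this mu_power_resonant(1), of q]
  have "vanishes (Suc ?m) (\<lambda>z. u ((F ^^ q) z) - u z - of_nat q * b * (z $ i) ^ ?m)"
    by (simp add: q(2) algebra_simps)
  moreover have "of_nat q * b \<noteq> 0" using q(1) a c0 mu_nonzero by (simp add: b_def)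
  ultimately show thesis using that[OF D(1,2) cd c0[unfolded c_def]] by blast
qed

section \<open>Uniqueness of the order, and curves of fixed points\<close>

lemma has_leading_term_unique:
  assumes "has_leading_term i \<mu> q F k" "has_leading_term i \<mu> q F k'" "k \<ge> 1" "k' \<ge> 1"
  shows "k = k'"
proof -
  obtain \<gamma> r where r: "r > 0" and \<gamma>: "\<gamma> 0 = 0" "\<And>t. t \<in> ball 0 r \<Longrightarrow> \<gamma> t $ i = t"
    "\<And>t j. t \<in> ball 0 r \<Longrightarrow> j \<noteq> i \<Longrightarrow> (F ^^ q) (\<gamma> t) $ j = \<gamma> t $ j"
    and h: "(\<lambda>t. (F ^^ q) (\<gamma> t) $ i - t) holomorphic_on ball 0 r" "vanishes 1 \<gamma>"
    by (rule fixed_point_curve, rule that)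
  let ?h = "\<lambda>t. (F ^^ q) (\<gamma> t) $ i - t"
  have key: "vanishes (k * q + 1) ?h \<and> \<not> vanishes (Suc (k * q + 1)) ?h"
    if lt: "has_leading_term i \<mu> q F k" and k: "k \<ge> 1" for k
  proof -
    obtain u S A where S: "open S" "0 \<in> S" and u: "\<And>z. z \<in> S \<Longrightarrow> cdiff_at u z"
      "partial_deriv u i 0 \<noteq> 0" and A: "A \<noteq> 0"
      and van: "vanishes (Suc (k * q + 1)) (\<lambda>z. u ((F ^^ q) z) - u z - A * (z $ i) ^ (k * q + 1))"
      by (rule has_leading_termE[OF lt k], rule that)
    show ?thesis
      using curve_displacement(2,3)[OF S u van r \<gamma> h A] by blast
  qed
  have "\<not> k < k'" if lt: "has_leading_term i \<mu> q F k" "has_leading_term i \<mu> q F k'" "k \<ge> 1" "k' \<ge> 1" for k k'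
  proof
    assume "k < k'"
    then have "Suc k * q \<le> k' * q" by (intro mult_right_mono) auto
    then have "Suc (k * q + 1) \<le> k' * q + 1" using q(1) by simp
    then show False using key[OF lt(1,3)] key[OF lt(2,4)] vanishes_mono by blast
  qed
  from this[OF assms] this[OF assms(2,1,4,3)] show ?thesis by simp
qed

lemma formally_linearizable_imp_fixed_curve:
  assumes "formally_linearizable_comp i \<mu> F" shows "fixed_curve_germ (F ^^ q)"
proof -
  obtain \<gamma> r where r: "r > 0" and hol: "\<And>j. (\<lambda>t. \<gamma> t $ j) holomorphic_on ball 0 r"
    and \<gamma>: "\<gamma> 0 = 0" "\<And>t. t \<in> ball 0 r \<Longrightarrow> \<gamma> t $ i = t"
    "\<And>t j. t \<in> ball 0 r \<Longrightarrow> j \<noteq> i \<Longrightarrow> (F ^^ q) (\<gamma> t) $ j = \<gamma> t $ j"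
    and h: "(\<lambda>t. (F ^^ q) (\<gamma> t) $ i - t) holomorphic_on ball 0 r" "vanishes 1 \<gamma>"
    by (rule fixed_point_curve, rule that)
  let ?h = "\<lambda>t. (F ^^ q) (\<gamma> t) $ i - t"
  have van: "vanishes (Suc (k * q + 1)) ?h" for k
  proof -
    obtain u where u: "\<And>z. cdiff_at u z" "partial_deriv u i 0 \<noteq> 0"
      and uF: "vanishes (Suc (k * q + 1)) (\<lambda>z. u (F z) - \<mu> * u z)"
      using formally_linearizable_asymptotic[OF assms, of "k * q + 1"] by auto
    have "vanishes (Suc (k * q + 1)) (\<lambda>z. u (F z) - \<mu> * u z - \<mu> * 0 * (z $ i) ^ (k * q + 1))"
      using uF by simp
    from iterate_asymptotic[OF this mu_power_resonant(1), of q]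
    have "vanishes (Suc (k * q + 1)) (\<lambda>z. u ((F ^^ q) z) - u z - 0 * (z $ i) ^ (k * q + 1))"
      by (simp add: q(2))
    from curve_displacement(1)[OF open_UNIV UNIV_I u this r \<gamma> h refl] show ?thesis .
  qed
  have h0: "?h t = 0" if "t \<in> ball 0 r" for t
  proof (rule holomorphic_vanishes_all_imp_0[OF h(1) r _ that])
    fix n
    have le: "n \<le> Suc (n * q + 1)" using mult_le_mono2[OF q(1), of n] by linarith
    show "\<exists>m\<ge>n. vanishes m ?h" by (intro exI[of _ "Suc (n * q + 1)"] conjI van le)
  qed
  have "\<forall>\<^sub>F t in nhds 0. t \<in> ball (0 :: complex) r" using r by (intro eventually_nhds_in_open) auto
  then have "\<forall>\<^sub>F t in nhds 0. \<gamma> t $ i = t" by eventually_elim (rule \<gamma>(2))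
  then have "deriv (\<lambda>t. \<gamma> t $ i) 0 = deriv (\<lambda>t. t) 0" by (rule deriv_cong_ev) simp
  then have "deriv (\<lambda>t. \<gamma> t $ i) 0 \<noteq> 0" by simp
  moreover have "(F ^^ q) (\<gamma> t) = \<gamma> t" if "t \<in> ball 0 r" for t
    unfolding vec_eq_iff
  proof
    fix j
    show "(F ^^ q) (\<gamma> t) $ j = \<gamma> t $ j"
      using \<gamma>(2,3)[OF that] h0[OF that] by (cases "j = i") auto
  qed
  ultimately show ?thesis unfolding fixed_curve_germ_def using r hol \<gamma>(1) by blast
qed

text \<open>The given curve need not be parametrized by the distinguished coordinate.
  Differentiating \<open>(F ^^ q) (\<gamma> t) = \<gamma> t\<close> shows that its tangent is fixed
  by the differential of \<open>F ^^ q\<close>, hence points in direction \<open>i\<close>, and so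
  \<open>\<gamma> t $ i\<close> is bounded below by a multiple of \<open>t\<close>. Along the curve
  the increment of \<open>P\<close> is zero, which would make the obstruction term vanish to too
  high an order.\<close>

lemma fixed_curve_imp_formally_linearizable:
  assumes "fixed_curve_germ (F ^^ q)" shows "formally_linearizable_comp i \<mu> F"
proof (rule ccontr)
  assume nl: "\<not> formally_linearizable_comp i \<mu> F"
  obtain k P a where k: "k \<ge> 1" and a: "a \<noteq> 0" and P: "\<And>z. cdiff_at P z" "vanishes 2 (\<lambda>z. P z - z $ i)"
    and van: "vanishes (Suc (k * q + 1)) (\<lambda>z. P (F z) - \<mu> * P z - a * (z $ i) ^ (k * q + 1))"
    by (rule formal_dichotomy[OF nl], rule that)
  let ?m = "k * q + 1"
  obtain \<gamma> r where r: "r > 0" and hol: "\<And>j. (\<lambda>t. \<gamma> t $ j) holomorphic_on ball 0 r"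
    and \<gamma>0: "\<gamma> 0 = 0" and imm: "\<exists>j. deriv (\<lambda>t. \<gamma> t $ j) 0 \<noteq> 0" and fixed: "\<And>t. t \<in> ball 0 r \<Longrightarrow> (F ^^ q) (\<gamma> t) = \<gamma> t"
    using assms unfolding fixed_curve_germ_def by blast
  have ball: "\<forall>\<^sub>F t in nhds 0. t \<in> ball (0 :: complex) r" using r by (intro eventually_nhds_in_open) auto
  have \<gamma>v: "vanishes 1 \<gamma>" by (rule vanishes_vec) (rule holomorphic_vanishes_1[OF hol r], simp add: \<gamma>0)
  have der: "((\<lambda>t. \<gamma> t $ j) has_derivative (\<lambda>t. deriv (\<lambda>t. \<gamma> t $ j) 0 * t)) (at 0)" for j
    using holomorphic_derivI[OF hol open_ball, of 0] r unfolding has_field_derivative_def by simp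
  have off: "deriv (\<lambda>t. \<gamma> t $ j) 0 = 0" if "j \<noteq> i" for j
  proof -
    have "((\<lambda>t. \<chi> j. \<gamma> t $ j) has_derivative (\<lambda>t. \<chi> j. deriv (\<lambda>t. \<gamma> t $ j) 0 * t)) (at 0)"
      by (intro has_derivative_vec_lambda der)
    then have 1: "(\<gamma> has_derivative (\<lambda>t. \<chi> j. deriv (\<lambda>t. \<gamma> t $ j) 0 * t)) (at 0)" by simp
    have 2: "((\<lambda>z. (F ^^ q) z $ j) has_derivative (\<lambda>v. lam $ j ^ q * v $ j)) (at (\<gamma> 0))"
      using iterate_deriv by (simp add: \<gamma>0)
    from has_derivative_compose[OF 1 2]
    have "((\<lambda>t. (F ^^ q) (\<gamma> t) $ j) has_derivative (\<lambda>t. lam $ j ^ q * (deriv (\<lambda>t. \<gamma> t $ j) 0 * t))) (at 0)"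
      by simp
    then have "((\<lambda>t. \<gamma> t $ j) has_derivative (\<lambda>t. lam $ j ^ q * (deriv (\<lambda>t. \<gamma> t $ j) 0 * t))) (at 0)"
      by (rule has_derivative_transform_within_open[of _ _ _ _ "ball 0 r"]) (use r fixed in auto)
    from fun_cong[OF has_derivative_unique[OF der this], of 1] show ?thesis
      using lam_power_ne_1[OF that] by simp
  qed
  define c where "c = deriv (\<lambda>t. \<gamma> t $ i) 0"
  have c0: "c \<noteq> 0"
  proof -
    obtain j where "deriv (\<lambda>t. \<gamma> t $ j) 0 \<noteq> 0" using imm ..
    then show ?thesis using off[of j] by (cases "j = i") (auto simp: c_def)
  qed
  define b where "b = a / \<mu>"
  have b: "a = \<mu> * b" using mu_nonzero by (simp add: b_def)
  from iterate_asymptotic[OF van[unfolded b] mu_power_resonant(1), of q]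
  have "vanishes (Suc ?m) (\<lambda>z. P ((F ^^ q) z) - P z - of_nat q * b * (z $ i) ^ ?m)"
    by (simp add: q(2) algebra_simps)
  from vanishes_minus[OF vanishes_compose[OF this \<gamma>v]]
  have van\<gamma>: "vanishes (Suc ?m) (\<lambda>t. of_nat q * b * (\<gamma> t $ i) ^ ?m)"
    by (rule vanishes_eventually_cong) (use ball in eventually_elim, simp add: fixed)
  have "\<forall>\<^sub>F t in nhds 0. norm (c / 2 * t) \<le> norm (\<gamma> t $ i)"
  proof -
    have "\<exists>d>0. \<forall>t. norm (t - 0) < d \<longrightarrow> norm (\<gamma> t $ i - \<gamma> 0 $ i - c * (t - 0)) \<le> norm c / 2 * norm (t - 0)"
    proof -
      have "\<forall>e>0. \<exists>d>0. \<forall>t. norm (t - 0) < d \<longrightarrow> norm (\<gamma> t $ i - \<gamma> 0 $ i - c * (t - 0)) \<le> e * norm (t - 0)"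
        using der[of i] unfolding has_derivative_at_alt c_def[symmetric] by (rule conjunct2)
      then show ?thesis using c0 by (meson half_gt_zero zero_less_norm_iff)
    qed
    then obtain d where d: "d > 0" "\<And>t. norm t < d \<Longrightarrow> norm (\<gamma> t $ i - c * t) \<le> norm c / 2 * norm t"
      by (auto simp: \<gamma>0)
    have "\<forall>\<^sub>F t :: complex in nhds 0. t \<in> ball 0 d" using d by (intro eventually_nhds_in_open) auto
    then show ?thesis
    proof eventually_elim
      case (elim t)
      have "norm (c * t) \<le> norm (\<gamma> t $ i) + norm (\<gamma> t $ i - c * t)"
        by (metis norm_minus_commute norm_triangle_sub)
      then show ?case using d(2)[of t] elim by (simp add: norm_mult)
    qed
  qed
  then have "\<forall>\<^sub>F t in nhds 0. norm (of_nat q * b * (c / 2) ^ ?m * t ^ ?m) \<le> norm (of_nat q * b * (\<gamma> t $ i) ^ ?m)"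
  proof eventually_elim
    case (elim t)
    have "norm (c / 2 * t) ^ ?m \<le> norm (\<gamma> t $ i) ^ ?m" using elim by (intro power_mono) auto
    then have "norm (of_nat q * b) * norm (c / 2 * t) ^ ?m \<le> norm (of_nat q * b) * norm (\<gamma> t $ i) ^ ?m"
      by (intro mult_left_mono) auto
    then show ?case by (simp only: norm_mult norm_power power_mult_distrib mult.assoc)
  qed
  from vanishes_cong[OF van\<gamma> this] not_vanishes_power[of "of_nat q * b * (c / 2) ^ ?m" ?m]
  show False using q(1) a c0 mu_nonzero by (simp add: b_def)
qed

end

section \<open>Attracting petals\<close>

text \<open>Write \<open>y = \<nu> * x * (1 + \<delta>)\<close> with \<delta> equal to
  \<open>b * x ^ K\<close> up to higher order. Expanding \<open>(1 + \<delta>)\<close> to the power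
  \<open>-K\<close> to first order adds \<open>\<delta> / (b * x ^ K)\<close>, about 1, to the
  coordinate; the factor \<open>-1 / (K * b)\<close> normalizes the translation. The rotation \<nu>
  disappears in the \<open>K\<close>-th power.\<close>

lemma Fatou_coordinate_step:
  fixes b :: complex
  assumes K: "K \<ge> 1" and b: "b \<noteq> 0" and C: "C \<ge> 0" and \<epsilon>: "\<epsilon> > 0"
  obtains \<rho> where "\<rho> > 0" "\<And>x y \<nu>. 0 < norm x \<Longrightarrow> norm x < \<rho> \<Longrightarrow> \<nu> ^ K = 1 \<Longrightarrow>
    norm (y - \<nu> * x * (1 + b * x ^ K)) \<le> C * norm x ^ (K + 2) \<Longrightarrow>
    norm (y / (\<nu> * x) - 1) \<le> \<epsilon> \<and> y \<noteq> 0 \<and>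
    norm (- 1 / (of_nat K * b * y ^ K) - (- 1 / (of_nat K * b * x ^ K)) - 1) \<le> 1 / 4"
proof -
  define B where "B = norm b + C"
  have B: "B > 0" using b C by (simp add: B_def add_pos_nonneg)
  \<comment> \<open>Since \<open>norm \<delta>\<close> is at most \<open>B * norm x ^ K\<close>,
    this choice makes the error of the first-order expansion contribute 1/8.\<close>
  define \<eta> where "\<eta> = real K * norm b / (8 * B)"
  have \<eta>: "\<eta> > 0" using K b B by (simp add: \<eta>_def)
  have "((\<lambda>\<delta>. inverse ((1 + \<delta>) ^ K)) has_field_derivative - of_nat K) (at (0 :: complex))"
    by (auto intro!: derivative_eq_intros simp: field_simps)
  then have "\<exists>d>0. \<forall>\<delta>::complex. norm (\<delta> - 0) < d \<longrightarrow>
      norm (inverse ((1 + \<delta>) ^ K) - inverse ((1 + 0) ^ K) - (- of_nat K) * (\<delta> - 0)) \<le> \<eta> * norm (\<delta> - 0)"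
    using \<eta> unfolding has_field_derivative_def has_derivative_at_alt by blast
  then obtain d where d: "d > 0" "\<And>\<delta>::complex. norm \<delta> < d \<Longrightarrow>
      norm (inverse ((1 + \<delta>) ^ K) - 1 + of_nat K * \<delta>) \<le> \<eta> * norm \<delta>"
    by auto
  define m where "m = min d (min \<epsilon> (1 / 2))"
  have m: "m > 0" "m \<le> d" "m \<le> \<epsilon>" "m \<le> 1 / 2" using d \<epsilon> by (auto simp: m_def)
  \<comment> \<open>The entry \<open>m / B\<close> makes \<open>norm \<delta> < m\<close>; the last
    entry bounds \<open>C * norm x\<close> by \<open>norm b / 8\<close>, the second contribution of
    1/8.\<close>
  define \<rho> where "\<rho> = min (min 1 (m / B)) (norm b / (8 * (C + 1)))"
  have \<rho>: "\<rho> > 0" using m B b C by (simp add: \<rho>_def)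
  show thesis
  proof (rule that[OF \<rho>])
    fix x y \<nu> :: complex
    assume x0: "0 < norm x" and x: "norm x < \<rho>" and \<nu>: "\<nu> ^ K = 1"
      and y: "norm (y - \<nu> * x * (1 + b * x ^ K)) \<le> C * norm x ^ (K + 2)"
    note n\<nu> = norm_root_of_unity[OF \<nu> K]
    define \<delta> where "\<delta> = y / (\<nu> * x) - 1"
    have ne: "x \<noteq> 0" "\<nu> \<noteq> 0" using x0 n\<nu> by auto
    have y_eq: "y = \<nu> * x * (1 + \<delta>)" using ne by (simp add: \<delta>_def)
    have "norm (\<nu> * x * (\<delta> - b * x ^ K)) \<le> C * norm x ^ (K + 2)"
      using y by (simp add: y_eq algebra_simps)
    then have "norm x * norm (\<delta> - b * x ^ K) \<le> norm x * (C * norm x ^ (K + 1))"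
      by (simp add: norm_mult n\<nu> mult_ac)
    then have \<delta>1: "norm (\<delta> - b * x ^ K) \<le> C * norm x ^ (K + 1)"
      using x0 by simp
    have x1: "norm x \<le> 1" using x by (simp add: \<rho>_def)
    have "norm \<delta> \<le> norm (b * x ^ K) + norm (\<delta> - b * x ^ K)" by (metis norm_triangle_sub)
    also have "\<dots> \<le> norm b * norm x ^ K + C * norm x ^ K"
    proof -
      have "C * norm x ^ (K + 1) \<le> C * norm x ^ K"
        using C x1 by (intro mult_left_mono power_decreasing) auto
      then show ?thesis using \<delta>1 by (simp add: norm_mult norm_power)
    qed
    finally have \<delta>2: "norm \<delta> \<le> B * norm x ^ K" by (simp add: B_def distrib_right)
    have "norm x ^ K \<le> norm x ^ 1" using K x1 by (intro power_decreasing) auto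
    then have "B * norm x ^ K \<le> B * norm x" using B by simp
    also have "\<dots> < m" using x B by (simp add: \<rho>_def field_simps)
    finally have \<delta>m: "norm \<delta> < m" using \<delta>2 by simp
    have 1: "norm (y / (\<nu> * x) - 1) \<le> \<epsilon>" using \<delta>m m by (simp add: \<delta>_def)
    have "1 + \<delta> \<noteq> 0"
    proof
      assume "1 + \<delta> = 0"
      then have "\<delta> = - 1" by (simp add: add_eq_0_iff)
      then show False using \<delta>m m by simp
    qed
    then have 2: "y \<noteq> 0" using ne by (simp add: y_eq)
    define g where "g = inverse ((1 + \<delta>) ^ K)"
    have g: "norm (g - 1 + of_nat K * \<delta>) \<le> \<eta> * norm \<delta>" using d(2)[of \<delta>] \<delta>m m by (simp add: g_def)
    have yK: "y ^ K = x ^ K * (1 + \<delta>) ^ K" by (simp add: y_eq power_mult_distrib \<nu>)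
    have xK: "x ^ K \<noteq> 0" using ne by simp
    have Kn: "of_nat K \<noteq> (0 :: complex)" using K by simp
    have "- 1 / (of_nat K * b * y ^ K) - (- 1 / (of_nat K * b * x ^ K)) - 1 =
        - (g - 1 + of_nat K * \<delta>) / (of_nat K * b * x ^ K) + (\<delta> - b * x ^ K) / (b * x ^ K)"
      unfolding yK g_def using xK Kn b \<open>1 + \<delta> \<noteq> 0\<close> by (simp add: field_simps)
    also have "norm \<dots> \<le> norm (- (g - 1 + of_nat K * \<delta>) / (of_nat K * b * x ^ K)) + norm ((\<delta> - b * x ^ K) / (b * x ^ K))"
      by (rule norm_triangle_ineq)
    also have "\<dots> \<le> 1 / 8 + 1 / 8"
    proof (rule add_mono)
      have "norm (g - 1 + of_nat K * \<delta>) \<le> \<eta> * (B * norm x ^ K)"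
        using g \<delta>2 \<eta> by (meson less_imp_le mult_left_mono order_trans)
      also have "\<dots> = 1 / 8 * (real K * norm b * norm x ^ K)" using B by (simp add: \<eta>_def field_simps)
      finally have *: "norm (g - 1 + of_nat K * \<delta>) \<le> 1 / 8 * (real K * norm b * norm x ^ K)" .
      have pos: "0 < real K * norm b * norm x ^ K" using K b x0 by simp
      have "norm (- (g - 1 + of_nat K * \<delta>) / (of_nat K * b * x ^ K)) =
          norm (g - 1 + of_nat K * \<delta>) / (real K * norm b * norm x ^ K)"
        unfolding norm_divide norm_minus_cancel norm_mult norm_power by simp
      then show "norm (- (g - 1 + of_nat K * \<delta>) / (of_nat K * b * x ^ K)) \<le> 1 / 8"
        using * pos by (simp add: divide_le_eq)
      have pos': "0 < norm b * norm x ^ K" using b x0 by simp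
      have "C * norm x \<le> (C + 1) * norm x" by (simp add: algebra_simps)
      also have "\<dots> \<le> (C + 1) * (norm b / (8 * (C + 1)))"
        using x C by (intro mult_left_mono) (auto simp: \<rho>_def)
      also have "\<dots> = norm b / 8" using C by (simp add: field_simps)
      finally have "C * norm x * norm x ^ K \<le> norm b / 8 * norm x ^ K"
        by (rule mult_right_mono) simp
      then have "norm (\<delta> - b * x ^ K) \<le> 1 / 8 * (norm b * norm x ^ K)"
        using \<delta>1 by (simp add: mult_ac)
      then show "norm ((\<delta> - b * x ^ K) / (b * x ^ K)) \<le> 1 / 8"
        using pos' by (simp add: norm_divide norm_mult norm_power divide_le_eq)
    qed
    finally have 3: "norm (- 1 / (of_nat K * b * y ^ K) - (- 1 / (of_nat K * b * x ^ K)) - 1) \<le> 1 / 4" by simp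
    show "norm (y / (\<nu> * x) - 1) \<le> \<epsilon> \<and> y \<noteq> 0 \<and>
        norm (- 1 / (of_nat K * b * y ^ K) - (- 1 / (of_nat K * b * x ^ K)) - 1) \<le> 1 / 4"
      using 1 2 3 by blast
  qed
qed

lemma roots_of_unity_isolated:
  assumes "K \<ge> 1"
  obtains e where "e > 0" "\<And>\<zeta> :: complex. \<zeta> ^ K = 1 \<Longrightarrow> norm (\<zeta> - 1) < e \<Longrightarrow> \<zeta> = 1"
proof -
  have "finite {z :: complex. z ^ K = 1}" by (rule finite_roots_unity) (use assms in simp)
  then obtain e where e: "e > 0" "\<forall>x\<in>{z :: complex. z ^ K = 1}. x \<noteq> 1 \<longrightarrow> e \<le> dist 1 x"
    using finite_set_avoid by blast
  show thesis
    by (rule that[OF e(1)]) (use e(2) in \<open>force simp: dist_norm norm_minus_commute\<close>)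
qed

text \<open>The derivative of \<open>Ln\<close> is at most \<open>1 / R\<close> on the half-plane.
  For large \<open>R\<close>, a step of bounded length hardly changes the branch of the root that
  defines a petal.\<close>

lemma Ln_diff_le:
  assumes R: "R > 0" and Y: "Re Y > R" "Re Y' > R"
  shows "norm (Ln Y' - Ln Y) \<le> norm (Y' - Y) / R"
proof -
  have "norm (Ln Y' - Ln Y) \<le> 1 / R * norm (Y' - Y)"
  proof (rule field_differentiable_bound[where S = "{z. Re z > R}" and f' = inverse])
    show "convex {z. Re z > R}" by (rule convex_halfspace_Re_gt)
    fix z assume z: "z \<in> {z. Re z > R}"
    then have "z \<notin> \<real>\<^sub>\<le>\<^sub>0" using R by (auto simp: complex_nonpos_Reals_iff)
    then show "(Ln has_field_derivative inverse z) (at z within {z. Re z > R})"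
      by (rule has_field_derivative_at_within[OF has_field_derivative_Ln])
    have "R \<le> norm z" using z complex_Re_le_cmod[of z] by simp
    then show "norm (inverse z) \<le> 1 / R" using R by (simp add: inverse_eq_divide norm_divide frac_le)
  qed (use Y in auto)
  then show ?thesis by simp
qed

text \<open>
  In the coordinate \<open>Y = c / x ^ K\<close> the dynamics is close to the translation by 1. A petal is the
  image of a half-plane \<open>Re Y > R\<close> under a branch of \<open>x = (c / Y) ^ (1 / K)\<close>; the branches are
  indexed by the \<open>K\<close>-th roots of unity \<open>\<omega>\<close>. Along orbits the quantity
  \<open>Re Y + \<bar>Im Y\<bar>\<close> increases, which gives the stability estimate. The other coordinates contract,
  hence stay dominated by the distinguished one.
\<close>

lemma petals:
  fixes f :: "complex ^ 'n::finite \<Rightarrow> complex ^ 'n" and b \<nu> :: complex and lam :: "complex ^ 'n"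
  assumes K: "K \<ge> 1" and b: "b \<noteq> 0" and \<nu>: "\<nu> ^ K = 1"
    and attr: "\<And>j. j \<noteq> i \<Longrightarrow> norm (lam $ j) < 1"
    and fi: "vanishes (K + 2) (\<lambda>w. f w $ i - \<nu> * w $ i * (1 + b * (w $ i) ^ K))"
    and fj: "\<And>j. j \<noteq> i \<Longrightarrow> vanishes 2 (\<lambda>w. f w $ j - lam $ j * w $ j)"
    and r: "r > 0"
  obtains D :: "complex \<Rightarrow> (complex ^ 'n) set" and M :: real where
    "\<And>\<omega>. \<omega> ^ K = 1 \<Longrightarrow> open (D \<omega>) \<and> connected (D \<omega>) \<and> D \<omega> \<noteq> {} \<and> D \<omega> \<subseteq> ball 0 r \<and> f ` D \<omega> \<subseteq> D (\<nu> * \<omega>)"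
    "\<And>\<omega> \<omega>'. \<omega> ^ K = 1 \<Longrightarrow> \<omega>' ^ K = 1 \<Longrightarrow> \<omega> \<noteq> \<omega>' \<Longrightarrow> D \<omega> \<inter> D \<omega>' = {}"
    "\<And>\<omega> w n. \<omega> ^ K = 1 \<Longrightarrow> w \<in> D \<omega> \<Longrightarrow> norm ((f ^^ n) w) \<le> M * norm w"
    "\<And>\<omega> w. \<omega> ^ K = 1 \<Longrightarrow> w \<in> D \<omega> \<Longrightarrow> (\<lambda>n. (f ^^ n) w) \<longlonglongrightarrow> 0"
proof -
  define N where "N = real CARD('n)"
  have N: "N \<ge> 1" by (simp add: N_def Suc_le_eq)
  \<comment> \<open>A uniform contraction rate. The inserted 0 keeps the maximum defined when
    \<open>i\<close> is the only coordinate.\<close>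
  obtain L where L: "0 \<le> L" "L < 1" "\<And>j. j \<noteq> i \<Longrightarrow> norm (lam $ j) \<le> L"
  proof (rule that[of "Max (insert 0 ((\<lambda>j. norm (lam $ j)) ` (UNIV - {i})))"])
    show "Max (insert 0 ((\<lambda>j. norm (lam $ j)) ` (UNIV - {i}))) < 1"
      using attr by (subst Max_less_iff) auto
  qed auto
  have "\<exists>C r. C > 0 \<and> r > 0 \<and> (\<forall>w. norm w < r \<longrightarrow>
      norm (f w $ i - \<nu> * w $ i * (1 + b * (w $ i) ^ K)) \<le> C * norm w ^ (K + 2) \<and>
      (\<forall>j. j \<noteq> i \<longrightarrow> norm (f w $ j - lam $ j * w $ j) \<le> C * norm w ^ 2))"
  proof -
    have "vanishes 2 (\<lambda>w. \<chi> j. if j = i then 0 else f w $ j - lam $ j * w $ j)"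
    proof (rule vanishes_vec)
      show "vanishes 2 (\<lambda>w. (\<chi> j. if j = i then 0 else f w $ j - lam $ j * w $ j) $ j)" for j
        using fj[of j] by (cases "j = i") auto
    qed
    then obtain C2 where C2: "C2 > 0"
      "\<forall>\<^sub>F w in nhds 0. norm (\<chi> j. if j = i then 0 else f w $ j - lam $ j * w $ j) \<le> C2 * norm w ^ 2"
      by (rule vanishesE)
    obtain C1 where C1: "C1 > 0"
      "\<forall>\<^sub>F w in nhds 0. norm (f w $ i - \<nu> * w $ i * (1 + b * (w $ i) ^ K)) \<le> C1 * norm w ^ (K + 2)"
      using fi by (rule vanishesE)
    from C1(2) C2(2) have "\<forall>\<^sub>F w in nhds 0.
      norm (f w $ i - \<nu> * w $ i * (1 + b * (w $ i) ^ K)) \<le> (C1 + C2) * norm w ^ (K + 2) \<and>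
      (\<forall>j. j \<noteq> i \<longrightarrow> norm (f w $ j - lam $ j * w $ j) \<le> (C1 + C2) * norm w ^ 2)"
    proof eventually_elim
      case (elim w)
      have "norm (f w $ j - lam $ j * w $ j) \<le> C2 * norm w ^ 2" if "j \<noteq> i" for j
      proof -
        have "norm ((\<chi> j. if j = i then 0 else f w $ j - lam $ j * w $ j) $ j) \<le> C2 * norm w ^ 2"
          using elim(2) Finite_Cartesian_Product.norm_nth_le order_trans by blast
        then show ?thesis using that by simp
      qed
      moreover have "C2 * norm w ^ 2 \<le> (C1 + C2) * norm w ^ 2" "C1 * norm w ^ (K + 2) \<le> (C1 + C2) * norm w ^ (K + 2)"
        using C1 C2 by (auto intro!: mult_right_mono)
      ultimately show ?case using elim(1) by (meson order_trans)
    qed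
    then obtain r' where "r' > 0" "\<forall>w. dist w 0 < r' \<longrightarrow>
      norm (f w $ i - \<nu> * w $ i * (1 + b * (w $ i) ^ K)) \<le> (C1 + C2) * norm w ^ (K + 2) \<and>
      (\<forall>j. j \<noteq> i \<longrightarrow> norm (f w $ j - lam $ j * w $ j) \<le> (C1 + C2) * norm w ^ 2)"
      unfolding eventually_nhds_metric by blast
    then show ?thesis using C1 C2 by (intro exI[of _ "C1 + C2"] exI[of _ r']) auto
  qed
  then obtain C r1 where C: "C > 0" and r1: "r1 > 0"
    and est_i: "\<And>w. norm w < r1 \<Longrightarrow> norm (f w $ i - \<nu> * w $ i * (1 + b * (w $ i) ^ K)) \<le> C * norm w ^ (K + 2)"
    and est_j: "\<And>w j. norm w < r1 \<Longrightarrow> j \<noteq> i \<Longrightarrow> norm (f w $ j - lam $ j * w $ j) \<le> C * norm w ^ 2"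
    by blast
  obtain e where e: "e > 0" "\<And>\<zeta> :: complex. \<zeta> ^ K = 1 \<Longrightarrow> norm (\<zeta> - 1) < e \<Longrightarrow> \<zeta> = 1"
    by (rule roots_of_unity_isolated[OF K], rule that)
  \<comment> \<open>The bound 1 gives \<open>norm E \<le> 2\<close> below; with \<open>e / 4\<close>
    the total error \<open>3 * \<epsilon>\<close> in \<zeta> stays below \<open>e\<close>; the last
    entry leaves room for the contraction inside the cone.\<close>
  define \<epsilon> where "\<epsilon> = min (min 1 (e / 4)) ((1 - L) / 2)"
  have \<epsilon>: "\<epsilon> > 0" "\<epsilon> \<le> 1" "\<epsilon> \<le> e / 4" "\<epsilon> \<le> (1 - L) / 2" using e L by (simp_all add: \<epsilon>_def min_def)
  obtain \<rho> where \<rho>: "\<rho> > 0" and step: "\<And>x y \<nu>. 0 < norm x \<Longrightarrow> norm x < \<rho> \<Longrightarrow> \<nu> ^ K = 1 \<Longrightarrow>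
    norm (y - \<nu> * x * (1 + b * x ^ K)) \<le> (C * N ^ (K + 2)) * norm x ^ (K + 2) \<Longrightarrow>
    norm (y / (\<nu> * x) - 1) \<le> \<epsilon> \<and> y \<noteq> 0 \<and>
    norm (- 1 / (of_nat K * b * y ^ K) - (- 1 / (of_nat K * b * x ^ K)) - 1) \<le> 1 / 4"
    by (rule Fatou_coordinate_step[OF K b _ \<epsilon>(1), of "C * N ^ (K + 2)"]) (use C N in auto)
  have "isCont exp (0 :: complex)" by simp
  then obtain d where d: "d > 0" "\<And>z :: complex. norm z < d \<Longrightarrow> norm (exp z - 1) < \<epsilon>"
    using \<epsilon>(1) unfolding continuous_at_eps_delta by (auto simp: dist_norm)
  define c where "c = - 1 / (of_nat K * b)"
  have c0: "c \<noteq> 0" using K b by (simp add: c_def)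
  define s where "s = exp (Ln c / of_nat K)"
  have sK: "s ^ K = c" using K c0 by (simp add: s_def flip: exp_of_nat_mult)
  have s0: "s \<noteq> 0" by (simp add: s_def)
  \<comment> \<open>Division by \<open>N\<close> accounts for the cone estimate
    \<open>norm w \<le> N * norm (w $ i)\<close>. The last entry makes the quadratic remainder of
    the other coordinates at most \<open>(1 - L) / 4\<close> times the distinguished one.\<close>
  define \<rho>' where "\<rho>' = min (min \<rho> (min (r / N) (r1 / N))) ((1 - L) / (4 * C * N\<^sup>2))"
  have \<rho>': "\<rho>' > 0" using \<rho> r r1 N L C by (simp add: \<rho>'_def)
  \<comment> \<open>The first entry forces the distinguished coordinate below \<rho>'. The second
    makes \<open>Ln\<close> change by less than \<open>d\<close> in one step, whose length is less
    than 2.\<close>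
  define R where "R = max (norm c / \<rho>' ^ K) (2 / d)"
  have R: "R > 0" "norm c / \<rho>' ^ K \<le> R" "2 / d \<le> R" using d by (auto simp: R_def less_max_iff_disj)
  define Q where "Q Y = s * exp (- Ln Y / of_nat K)" for Y
  have QK: "Q Y ^ K = c / Y" if "Re Y > R" for Y
  proof -
    have "Y \<noteq> 0" using that R by auto
    then show ?thesis using K by (simp add: Q_def power_mult_distrib sK exp_minus field_simps flip: exp_of_nat_mult)
  qed
  have Q0: "Q Y \<noteq> 0" for Y by (simp add: Q_def s0)
  have Y_eq: "c / (\<omega> * Q Y) ^ K = Y" if "Re Y > R" "\<omega> ^ K = 1" for \<omega> Y
  proof -
    have "Y \<noteq> 0" using that R by auto
    then show ?thesis using QK[OF that(1)] that(2) c0 by (simp add: power_mult_distrib)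
  qed
  define H where "H = {Y. Re Y > R}"
  define D where "D \<omega> = {w. w $ i \<in> (\<lambda>Y. \<omega> * Q Y) ` H \<and> (\<forall>j. j \<noteq> i \<longrightarrow> norm (w $ j) < norm (w $ i))}" for \<omega>
  have hol: "(\<lambda>Y. \<omega> * Q Y) holomorphic_on H" for \<omega>
  proof -
    have "Y \<notin> \<real>\<^sub>\<le>\<^sub>0" if "Y \<in> H" for Y using that R by (auto simp: complex_nonpos_Reals_iff H_def)
    then show ?thesis unfolding Q_def using K by (auto intro!: holomorphic_intros)
  qed
  have opH: "open H" unfolding H_def by (rule open_halfspace_Re_gt)
  have cone: "norm w \<le> N * norm (w $ i)" if "w \<in> D \<omega>" for w \<omega>
  proof -
    have "norm w \<le> (\<Sum>j\<in>UNIV. norm (w $ j))" by (rule norm_vec_le_sum)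
    also have "\<dots> \<le> (\<Sum>j\<in>(UNIV :: 'n set). norm (w $ i))"
    proof (rule sum_mono)
      show "norm (w $ j) \<le> norm (w $ i)" for j using that by (cases "j = i") (auto simp: D_def less_imp_le)
    qed
    finally show ?thesis by (simp add: N_def)
  qed
  have small: "norm (w $ i) < \<rho>'" "w $ i \<noteq> 0" if \<omega>: "\<omega> ^ K = 1" and w: "w \<in> D \<omega>" for w \<omega>
  proof -
    obtain Y where Y: "Re Y > R" "w $ i = \<omega> * Q Y" using w by (auto simp: D_def H_def)
    have "norm (w $ i) ^ K = norm c / norm Y"
      using arg_cong[OF QK[OF Y(1)], of norm] Y(2) norm_root_of_unity[OF \<omega> K]
      by (simp add: norm_mult norm_power norm_divide)
    also have "\<dots> < norm c / R"
    proof (rule divide_strict_left_mono)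
      show "R < norm Y" using Y(1) complex_Re_le_cmod[of Y] by linarith
      then show "0 < norm Y * R" using R(1) by (intro mult_pos_pos) linarith+
    qed (use c0 in simp)
    also have "\<dots> \<le> \<rho>' ^ K" using R \<rho>' by (simp add: field_simps)
    finally show "norm (w $ i) < \<rho>'" using \<rho>' power_less_imp_less_base by (metis less_imp_le)
    have "\<omega> \<noteq> 0" using \<omega> K by (auto simp: power_0_left)
    then show "w $ i \<noteq> 0" using Y(2) Q0 by simp
  qed
  have inball: "norm w < r" "norm w < r1" if "\<omega> ^ K = 1" "w \<in> D \<omega>" for w \<omega>
  proof -
    have "N * norm (w $ i) < N * \<rho>'" using small[OF that] N by simp
    moreover have "\<rho>' \<le> r / N" "\<rho>' \<le> r1 / N" by (auto simp: \<rho>'_def)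
    then have "N * \<rho>' \<le> r" "N * \<rho>' \<le> r1" using N by (auto simp: field_simps)
    ultimately show "norm w < r" "norm w < r1" using cone[OF that(2)] by linarith+
  qed
  have main: "f w \<in> D (\<nu> * \<omega>) \<and> Re (c / (f w $ i) ^ K) \<ge> Re (c / (w $ i) ^ K) + 3 / 4 \<and>
      Re (c / (f w $ i) ^ K) + \<bar>Im (c / (f w $ i) ^ K)\<bar> \<ge> Re (c / (w $ i) ^ K) + \<bar>Im (c / (w $ i) ^ K)\<bar>"
    if \<omega>: "\<omega> ^ K = 1" and w: "w \<in> D \<omega>" for w \<omega>
  proof -
    define x where "x = w $ i"
    define y where "y = f w $ i"
    have x: "x \<noteq> 0" "norm x < \<rho>'" using small[OF \<omega> w] by (auto simp: x_def)
    obtain Y where Y: "Re Y > R" "x = \<omega> * Q Y" using w by (auto simp: D_def H_def x_def)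
    have cx: "c / x ^ K = Y" using Y_eq[OF Y(1) \<omega>] Y(2) by simp
    define Y' where "Y' = c / y ^ K"
    have "norm (y - \<nu> * x * (1 + b * x ^ K)) \<le> C * norm w ^ (K + 2)"
      unfolding x_def y_def by (rule est_i[OF inball(2)[OF \<omega> w]])
    also have "\<dots> \<le> C * (N * norm x) ^ (K + 2)"
      using C cone[OF w] by (intro mult_left_mono power_mono) (auto simp: x_def)
    also have "\<dots> = (C * N ^ (K + 2)) * norm x ^ (K + 2)" by (simp add: power_mult_distrib)
    finally have "norm (y - \<nu> * x * (1 + b * x ^ K)) \<le> (C * N ^ (K + 2)) * norm x ^ (K + 2)" .
    moreover have "norm x < \<rho>" using x by (simp add: \<rho>'_def)
    moreover have "- 1 / (of_nat K * b * z) = c / z" for z by (simp add: c_def)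
    ultimately have st: "norm (y / (\<nu> * x) - 1) \<le> \<epsilon>" "y \<noteq> 0" "norm (Y' - Y - 1) \<le> 1 / 4"
      using step[of x \<nu> y] x \<nu> cx by (auto simp: Y'_def)
    have re: "\<bar>Re Y' - Re Y - 1\<bar> \<le> 1 / 4" "\<bar>Im Y' - Im Y\<bar> \<le> 1 / 4"
      using abs_Re_le_cmod[of "Y' - Y - 1"] abs_Im_le_cmod[of "Y' - Y - 1"] st(3) by auto
    then have Y': "Re Y' > R" using Y(1) by linarith
    \<comment> \<open>Both \<open>y\<close> and the point of petal \<open>\<nu> * \<omega>\<close>
      over \<open>Y'\<close> are \<open>K\<close>-th roots of \<open>c / Y'\<close>, so \<zeta> is a
      \<open>K\<close>-th root of unity. It is close to 1, hence equal to 1, and this decides which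
      petal contains \<open>f w\<close>.\<close>
    define \<zeta> where "\<zeta> = y / (\<nu> * \<omega> * Q Y')"
    have \<omega>0: "\<omega> \<noteq> 0" "\<nu> \<noteq> 0" using \<omega> \<nu> K by (auto simp: power_0_left)
    have "\<zeta> = 1"
    proof (rule e(2))
      have "y ^ K = c / Y'" using c0 by (simp add: Y'_def)
      moreover have "Y' \<noteq> 0" using Y' R by auto
      ultimately show "\<zeta> ^ K = 1"
        using \<omega> \<nu> QK[OF Y'] c0 by (simp add: \<zeta>_def power_divide power_mult_distrib)
      define E where "E = exp ((Ln Y' - Ln Y) / of_nat K)"
      have "Q Y = Q Y' * E"
        by (simp add: Q_def E_def diff_divide_distrib flip: exp_add)
      then have \<zeta>: "\<zeta> = (y / (\<nu> * x)) * E"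
        using Q0[of Y] Q0[of Y'] \<omega>0 Y(2) by (simp add: \<zeta>_def E_def)
      have "norm (Y' - Y) \<le> norm (Y' - Y - 1) + norm (1 :: complex)" by (metis diff_add_cancel norm_triangle_ineq)
      then have "norm (Y' - Y) < 2" using st(3) by simp
      then have "norm (Y' - Y) / R < 2 / R" using R by (intro divide_strict_right_mono) auto
      also have "\<dots> \<le> d" using R d by (simp add: field_simps)
      finally have "norm (Ln Y' - Ln Y) < d" using Ln_diff_le[OF R(1) Y(1) Y'] by simp
      moreover have "norm ((Ln Y' - Ln Y) / of_nat K) \<le> norm (Ln Y' - Ln Y)"
        using K by (simp add: norm_divide divide_le_eq mult_le_cancel_left1)
      ultimately have E: "norm (E - 1) < \<epsilon>" unfolding E_def by (intro d(2)) simp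
      have "\<zeta> - 1 = (y / (\<nu> * x) - 1) * E + (E - 1)" by (simp add: \<zeta> algebra_simps)
      then have "norm (\<zeta> - 1) \<le> norm (y / (\<nu> * x) - 1) * norm E + norm (E - 1)"
        by (metis norm_mult norm_triangle_ineq)
      moreover have "norm E \<le> 2"
        using norm_triangle_ineq[of "E - 1" 1] E \<epsilon>(2) by simp
      then have "norm (y / (\<nu> * x) - 1) * norm E \<le> \<epsilon> * 2"
        using st(1) \<epsilon> by (intro mult_mono) auto
      ultimately show "norm (\<zeta> - 1) < e" using E \<epsilon> by linarith
    qed
    then have yQ: "y = (\<nu> * \<omega>) * Q Y'" using \<omega>0 Q0[of Y'] by (simp add: \<zeta>_def)
    have ylow: "(1 - \<epsilon>) * norm x \<le> norm y"
    proof -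
      have "1 - \<epsilon> \<le> norm (y / (\<nu> * x))"
        using st(1) norm_triangle_ineq2[of 1 "1 - y / (\<nu> * x)"] by (simp add: norm_minus_commute)
      then show ?thesis using x by (simp add: norm_divide norm_mult norm_root_of_unity[OF \<nu> K] field_simps)
    qed
    have "norm (f w $ j) < norm y" if j: "j \<noteq> i" for j
    proof -
      have "norm (f w $ j) \<le> norm (lam $ j * w $ j) + norm (f w $ j - lam $ j * w $ j)"
        by (metis norm_triangle_sub)
      also have "\<dots> \<le> L * norm x + C * norm w ^ 2"
      proof (rule add_mono)
        have "norm (w $ j) \<le> norm x" using w j by (auto simp: D_def x_def less_imp_le)
        then show "norm (lam $ j * w $ j) \<le> L * norm x"
          unfolding norm_mult using L(1) L(3)[OF j] by (intro mult_mono) auto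
      qed (rule est_j[OF inball(2)[OF \<omega> w] j])
      also have "C * norm w ^ 2 \<le> C * (N * norm x) ^ 2"
        using C cone[OF w] by (intro mult_left_mono power_mono) (auto simp: x_def)
      also have "C * (N * norm x) ^ 2 = (C * N\<^sup>2 * norm x) * norm x" by (simp add: power2_eq_square)
      also have "\<dots> \<le> ((1 - L) / 4) * norm x"
      proof (rule mult_right_mono)
        have "C * N\<^sup>2 * norm x \<le> C * N\<^sup>2 * ((1 - L) / (4 * C * N\<^sup>2))"
          using x(2) C by (intro mult_left_mono) (auto simp: \<rho>'_def)
        also have "\<dots> = (1 - L) / 4" using C N by (simp add: field_simps)
        finally show "C * N\<^sup>2 * norm x \<le> (1 - L) / 4" .
      qed simp
      also have "L * norm x + (1 - L) / 4 * norm x < (1 - \<epsilon>) * norm x"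
      proof -
        have "L + (1 - L) / 4 < 1 - \<epsilon>" using L \<epsilon>(4) by (simp add: field_simps)
        then have "(L + (1 - L) / 4) * norm x < (1 - \<epsilon>) * norm x" using x by (intro mult_strict_right_mono) auto
        then show ?thesis by (simp add: distrib_right)
      qed
      also note ylow
      finally show ?thesis by simp
    qed
    then have "f w \<in> D (\<nu> * \<omega>)" using yQ Y' by (auto simp: D_def H_def y_def)
    \<comment> \<open>The real part gains at least 3/4 while the imaginary part moves by at most
      1/4, so their combination cannot decrease even if the modulus of the imaginary part
      does.\<close>
    moreover have "Re Y' \<ge> Re Y + 3 / 4" "Re Y' + \<bar>Im Y'\<bar> \<ge> Re Y + \<bar>Im Y\<bar>" using re by linarith+
    ultimately show ?thesis using cx by (simp add: Y'_def x_def y_def)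
  qed
  have \<nu>\<omega>: "(\<nu> ^ n * \<omega>) ^ K = 1" if "\<omega> ^ K = 1" for n \<omega>
    using that \<nu> by (simp add: power_mult_distrib) (metis power_commutes power_mult power_one mult.commute)
  have orbit: "(f ^^ n) w \<in> D (\<nu> ^ n * \<omega>) \<and>
      Re (c / ((f ^^ n) w $ i) ^ K) \<ge> Re (c / (w $ i) ^ K) + 3 / 4 * real n \<and>
      Re (c / ((f ^^ n) w $ i) ^ K) + \<bar>Im (c / ((f ^^ n) w $ i) ^ K)\<bar> \<ge> Re (c / (w $ i) ^ K) + \<bar>Im (c / (w $ i) ^ K)\<bar>"
    if \<omega>: "\<omega> ^ K = 1" and w: "w \<in> D \<omega>" for w \<omega> n
  proof (induction n)
    case (Suc n)
    then have "(f ^^ n) w \<in> D (\<nu> ^ n * \<omega>)" by blast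
    note m = main[OF \<nu>\<omega>[OF \<omega>] this]
    have eq: "(f ^^ Suc n) w = f ((f ^^ n) w)" "\<nu> ^ Suc n * \<omega> = \<nu> * (\<nu> ^ n * \<omega>)"
      "3 / 4 * real (Suc n) = 3 / 4 * real n + 3 / 4"
      by (simp_all add: distrib_left)
    show ?case unfolding eq using m Suc by (intro conjI) (blast, linarith, linarith)
  qed (use w in auto)
  have ReY: "Re (c / (w $ i) ^ K) > R" if \<omega>: "\<omega> ^ K = 1" and w: "w \<in> D \<omega>" for w \<omega>
  proof -
    obtain Y where "Re Y > R" "w $ i = \<omega> * Q Y" using w by (auto simp: D_def H_def)
    then show ?thesis using Y_eq[of Y \<omega>] \<omega> by simp
  qed
  show thesis
  proof (rule that[of D "2 * N"])
    fix \<omega> :: complex assume \<omega>: "\<omega> ^ K = 1"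
    have inj: "inj_on (\<lambda>Y. \<omega> * Q Y) H"
      by (rule inj_onI) (metis Y_eq \<omega> H_def mem_Collect_eq)
    have "open ((\<lambda>Y. \<omega> * Q Y) ` H)" by (rule open_mapping_thm3[OF hol opH inj])
    then have "open ((\<lambda>w. w $ i) -` ((\<lambda>Y. \<omega> * Q Y) ` H) \<inter>
        (\<Inter>j\<in>UNIV - {i}. {w :: complex ^ 'n. norm (w $ j) < norm (w $ i)}))"
      by (intro open_Int open_vimage open_INT ballI open_Collect_less continuous_intros) auto
    also have "(\<lambda>w. w $ i) -` ((\<lambda>Y. \<omega> * Q Y) ` H) \<inter>
        (\<Inter>j\<in>UNIV - {i}. {w :: complex ^ 'n. norm (w $ j) < norm (w $ i)}) = D \<omega>"
      by (auto simp: D_def)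
    finally have op: "open (D \<omega>)" .
    \<comment> \<open>The petal is parametrized by a convex set, the half-plane together with the
      ratios \<open>w $ j / w $ i\<close>; this yields connectedness.\<close>
    define g where "g = (\<lambda>(Y, v :: complex ^ 'n). \<chi> j. if j = i then \<omega> * Q Y else \<omega> * Q Y * v $ j)"
    have \<omega>0: "\<omega> \<noteq> 0" using \<omega> K by (auto simp: power_0_left)
    have gim: "g ` (H \<times> polydisc 1) = D \<omega>"
    proof (intro set_eqI iffI)
      fix w assume "w \<in> g ` (H \<times> polydisc 1)"
      then show "w \<in> D \<omega>" using \<omega>0 Q0 by (auto simp: g_def D_def polydisc_def norm_mult)
    next
      fix w assume w: "w \<in> D \<omega>"
      then obtain Y where Y: "Y \<in> H" "w $ i = \<omega> * Q Y" by (auto simp: D_def)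
      have "w = g (Y, \<chi> j. if j = i then 0 else w $ j / w $ i)"
        using Y(2) \<omega>0 Q0[of Y] by (auto simp: g_def vec_eq_iff)
      moreover have "(\<chi> j. if j = i then 0 else w $ j / w $ i) \<in> polydisc 1"
        using w small(2)[OF \<omega> w] by (auto simp: polydisc_def D_def norm_divide divide_less_eq)
      ultimately show "w \<in> g ` (H \<times> polydisc 1)" using Y(1) by blast
    qed
    have "convex (polydisc 1 :: (complex ^ 'n) set)"
    proof -
      have "polydisc 1 = (\<Inter>j\<in>UNIV. (\<lambda>z :: complex ^ 'n. z $ j) -` ball 0 1)"
        by (auto simp: polydisc_def)
      moreover have "convex ((\<lambda>z :: complex ^ 'n. z $ j) -` ball 0 1)" for j
        by (intro convex_linear_vimage convex_ball linearI) auto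
      ultimately show ?thesis by (simp add: convex_INT)
    qed
    then have "connected (H \<times> (polydisc 1 :: (complex ^ 'n) set))"
      unfolding H_def by (intro convex_connected convex_Times convex_halfspace_Re_gt)
    moreover have "continuous_on (H \<times> polydisc 1) g"
    proof -
      have *: "continuous_on (H \<times> polydisc 1) (\<lambda>p :: complex \<times> (complex ^ 'n). \<omega> * Q (fst p))"
        using continuous_on_compose2[OF holomorphic_on_imp_continuous_on[OF hol[of \<omega>]]
            continuous_on_fst[OF continuous_on_id, of "H \<times> (polydisc 1 :: (complex ^ 'n) set)"]] by auto
      have "continuous_on (H \<times> polydisc 1) (\<lambda>p. \<chi> j. if j = i then \<omega> * Q (fst p) else \<omega> * Q (fst p) * snd p $ j)"
      proof (rule continuous_on_vec_lambda)
        show "continuous_on (H \<times> polydisc 1) (\<lambda>p. if j = i then \<omega> * Q (fst p) else \<omega> * Q (fst p) * snd p $ j)" for j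
          using * by (cases "j = i") (auto intro!: continuous_on_mult[OF *] continuous_intros)
      qed
      then show ?thesis by (simp add: g_def case_prod_unfold)
    qed
    ultimately have conn: "connected (D \<omega>)" using connected_continuous_image gim by metis
    have "(of_real (R + 1), 0) \<in> H \<times> (polydisc 1 :: (complex ^ 'n) set)" by (simp add: H_def polydisc_def)
    then have "D \<omega> \<noteq> {}" using gim by blast
    with op conn inball(1)[OF \<omega>] main[OF \<omega>]
    show "open (D \<omega>) \<and> connected (D \<omega>) \<and> D \<omega> \<noteq> {} \<and> D \<omega> \<subseteq> ball 0 r \<and> f ` D \<omega> \<subseteq> D (\<nu> * \<omega>)"
      by auto
    show "D \<omega> \<inter> D \<omega>' = {}" if \<omega>': "\<omega>' ^ K = 1" and ne: "\<omega> \<noteq> \<omega>'" for \<omega>'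
    proof (rule ccontr)
      assume "D \<omega> \<inter> D \<omega>' \<noteq> {}"
      then obtain w where w: "w \<in> D \<omega>" "w \<in> D \<omega>'" by blast
      obtain Y where Y1: "Re Y > R" "w $ i = \<omega> * Q Y" using w(1) by (auto simp: D_def H_def)
      obtain Y' where Y2: "Re Y' > R" "w $ i = \<omega>' * Q Y'" using w(2) by (auto simp: D_def H_def)
      have Y: "Re Y > R" "Re Y' > R" "\<omega> * Q Y = \<omega>' * Q Y'" using Y1 Y2 by simp_all
      \<comment> \<open>The value \<open>c / x ^ K\<close> recovers \<open>Y\<close> on every
        branch, so a common point has the same \<open>Y\<close> in both petals.\<close>
      then have "Y = Y'" using Y_eq[OF Y(1) \<omega>] Y_eq[OF Y(2) \<omega>'] by simp
      then show False using Y(3) Q0 ne by simp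
    qed
    fix w assume w: "w \<in> D \<omega>"
    have nK: "norm ((f ^^ n) w $ i) ^ K = norm c / norm (c / ((f ^^ n) w $ i) ^ K)" for n
      using c0 by (simp add: norm_divide norm_power)
    show "norm ((f ^^ n) w) \<le> (2 * N) * norm w" for n
    proof -
      let ?Y = "c / (w $ i) ^ K" and ?Z = "c / ((f ^^ n) w $ i) ^ K"
      note orb = orbit[OF \<omega> w, of n]
      have Rpos: "Re ?Y > R" "Re ?Z > R" using ReY[OF \<omega> w] ReY[OF \<nu>\<omega>[OF \<omega>]] orb by blast+
      \<comment> \<open>Comparing moduli through the monotone quantity costs a factor 2. As
        \<open>norm x ^ K = norm c / norm Y\<close>, the \<open>K\<close>-th power of the
        distinguished coordinate at most doubles along the orbit; the cone estimate contributes the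
        factor \<open>N\<close>.\<close>
      have "norm ?Y \<le> Re ?Y + \<bar>Im ?Y\<bar>" using cmod_le[of ?Y] Rpos R(1) by simp
      also have "\<dots> \<le> Re ?Z + \<bar>Im ?Z\<bar>" using orb by blast
      also have "\<dots> \<le> 2 * norm ?Z" using complex_Re_le_cmod[of ?Z] abs_Im_le_cmod[of ?Z] by simp
      finally have "norm ?Y \<le> 2 * norm ?Z" .
      moreover have "norm ?Y > 0" "norm ?Z > 0"
        using Rpos R(1) complex_Re_le_cmod[of ?Y] complex_Re_le_cmod[of ?Z] by linarith+
      moreover have "norm c / B \<le> 2 * (norm c / A)" if "A \<le> 2 * B" "A > 0" "B > 0" for A B :: real
        using mult_left_mono[OF that(1) norm_ge_zero[of c]] that(2,3) by (simp add: field_simps)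
      ultimately have "norm c / norm ?Z \<le> 2 * (norm c / norm ?Y)" by blast
      then have "norm ((f ^^ n) w $ i) ^ K \<le> 2 * norm (w $ i) ^ K"
        using nK[of n] nK[of 0] by simp
      also have "\<dots> \<le> 2 ^ K * norm (w $ i) ^ K"
        using power_increasing[OF K, of "2::real"] by (intro mult_right_mono) auto
      finally have "norm ((f ^^ n) w $ i) ^ K \<le> (2 * norm (w $ i)) ^ K" by (simp add: power_mult_distrib)
      then have "norm ((f ^^ n) w $ i) \<le> 2 * norm (w $ i)"
        using K power_le_imp_le_base[of _ "K - 1"] by (metis One_nat_def Suc_le_lessD Suc_pred norm_ge_zero zero_le_mult_iff zero_le_numeral)
      moreover have "norm ((f ^^ n) w) \<le> N * norm ((f ^^ n) w $ i)" using cone orb by blast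
      ultimately have "norm ((f ^^ n) w) \<le> N * (2 * norm (w $ i))"
        using N by (meson mult_left_mono order_trans zero_le_one)
      also have "\<dots> \<le> N * (2 * norm w)"
        using N by (intro mult_left_mono) (auto simp: Finite_Cartesian_Product.norm_nth_le)
      finally show ?thesis by simp
    qed
    show "(\<lambda>n. (f ^^ n) w) \<longlonglongrightarrow> 0"
    proof -
      have le: "norm ((f ^^ n) w $ i) ^ K \<le> norm c / (3 / 4 * real n)" if "n \<ge> 1" for n
      proof -
        let ?Z = "c / ((f ^^ n) w $ i) ^ K"
        have "Re ?Z \<ge> 3 / 4 * real n" using orbit[OF \<omega> w, of n] ReY[OF \<omega> w] R(1) by linarith
        then have "norm ?Z \<ge> 3 / 4 * real n" using complex_Re_le_cmod[of ?Z] by linarith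
        moreover have "3 / 4 * real n > 0" using that by simp
        moreover have "norm c / B \<le> norm c / A" if "A \<le> B" "A > 0" for A B :: real
          using that by (intro divide_left_mono mult_pos_pos) auto
        ultimately show ?thesis unfolding nK by blast
      qed
      have "(\<lambda>n. norm ((f ^^ n) w $ i) ^ K) \<longlonglongrightarrow> 0"
      proof (rule tendsto_sandwich[of "\<lambda>_. 0" _ _ "\<lambda>n. norm c / (3 / 4 * real n)"])
        show "\<forall>\<^sub>F n in sequentially. norm ((f ^^ n) w $ i) ^ K \<le> norm c / (3 / 4 * real n)"
          by (rule eventually_sequentiallyI[of 1]) (rule le)
        have "(\<lambda>n. (norm c / (3 / 4)) * (1 / real n)) \<longlonglongrightarrow> (norm c / (3 / 4)) * 0"
          by (intro tendsto_mult tendsto_const lim_1_over_n)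
        then show "(\<lambda>n. norm c / (3 / 4 * real n)) \<longlonglongrightarrow> 0" by simp
      qed auto
      then have "(\<lambda>n. norm ((f ^^ n) w $ i)) \<longlonglongrightarrow> 0" using K by simp
      then have "(\<lambda>n. N * norm ((f ^^ n) w $ i)) \<longlonglongrightarrow> N * 0" by (intro tendsto_mult tendsto_const)
      then have lim: "(\<lambda>n. N * norm ((f ^^ n) w $ i)) \<longlonglongrightarrow> 0" by simp
      show ?thesis
      proof (rule Lim_null_comparison[OF always_eventually lim], rule allI)
        show "norm ((f ^^ n) w) \<le> N * norm ((f ^^ n) w $ i)" for n
          by (rule cone[OF conjunct1[OF orbit[OF \<omega> w]]])
      qed
    qed
  qed
qed

section \<open>Basins of attraction\<close>

text \<open>
  Points of \<open>U\<close> whose whole orbit stays in a ball form, together with the part of the ball outside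
  \<open>U\<close>, a neighbourhood of the origin by stability; these neighbourhoods are the required basis.
\<close>

lemma basin_of_attractionI:
  fixes F :: "complex ^ 'n::finite \<Rightarrow> complex ^ 'n"
  assumes U: "open U" "U \<noteq> {}" "U \<subseteq> W" "F ` U \<subseteq> U"
    and stable: "\<And>z n. z \<in> U \<Longrightarrow> norm ((F ^^ n) z) \<le> M * norm z"
    and lim: "\<And>z. z \<in> U \<Longrightarrow> (\<lambda>n. (F ^^ n) z) \<longlonglongrightarrow> 0"
  shows "basin_of_attraction W F U"
proof -
  have inv: "(F ^^ n) z \<in> U" if "z \<in> U" for n z
    using that U(4) by (induction n) auto
  obtain z0 where z0: "z0 \<in> U" using U(2) by blast
  have cl: "0 \<in> closure U"
    unfolding closure_sequential by (rule exI[of _ "\<lambda>n. (F ^^ n) z0"]) (use inv[OF z0] lim[OF z0] in simp)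
  define \<Omega> where "\<Omega> e = (ball 0 e - U) \<union> {z \<in> U. \<forall>n. norm ((F ^^ n) z) < e}" for e :: real
  have "nhds_basis 0 (\<Omega> ` {0<..})" unfolding nhds_basis_def
  proof (intro conjI ballI allI impI)
    fix X assume "X \<in> \<Omega> ` {0<..}"
    then obtain e where e: "e > 0" "X = \<Omega> e" by auto
    \<comment> \<open>The constant serves both requirements,
      \<open>\<bar>M\<bar> * norm z < e\<close> for orbits in \<open>U\<close> and
      \<open>norm z < e\<close> for points outside.\<close>
    define d where "d = e / (\<bar>M\<bar> + 1)"
    have d: "d > 0" using e by (simp add: d_def)
    have "ball 0 d \<subseteq> \<Omega> e"
    proof
      fix z :: "complex ^ 'n" assume "z \<in> ball 0 d"
      then have "(\<bar>M\<bar> + 1) * norm z < e" by (simp add: d_def pos_less_divide_eq add_pos_pos mult.commute add_nonneg_pos)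
      then have *: "\<bar>M\<bar> * norm z < e" "norm z < e"
        using mult_nonneg_nonneg[of "\<bar>M\<bar>" "norm z"] norm_ge_zero[of z] unfolding distrib_right by linarith+
      show "z \<in> \<Omega> e"
      proof (cases "z \<in> U")
        case True
        have "norm ((F ^^ n) z) < e" for n
        proof -
          have "norm ((F ^^ n) z) \<le> \<bar>M\<bar> * norm z"
            using stable[OF True, of n] mult_right_mono[OF abs_ge_self[of M] norm_ge_zero[of z]] by linarith
          then show ?thesis using * by simp
        qed
        then show ?thesis using True by (simp add: \<Omega>_def)
      next
        case False
        then show ?thesis using * by (simp add: \<Omega>_def)
      qed
    qed
    then show "0 \<in> interior X" using d e(2) by (intro interiorI[of "ball 0 d"]) auto
  next
    fix V :: "(complex ^ 'n) set" assume "open V \<and> 0 \<in> V"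
    then obtain e where e: "e > 0" "ball 0 e \<subseteq> V" using open_contains_ball by blast
    have "\<Omega> e \<subseteq> ball 0 e"
    proof
      fix z assume z: "z \<in> \<Omega> e"
      show "z \<in> ball 0 e"
      proof (cases "z \<in> U")
        case True
        then have "norm ((F ^^ 0) z) < e" using z unfolding \<Omega>_def by blast
        then show ?thesis by simp
      qed (use z in \<open>auto simp: \<Omega>_def\<close>)
    qed
    then show "\<exists>\<Omega>'\<in>\<Omega> ` {0<..}. \<Omega>' \<subseteq> V" using e by blast
  qed
  moreover have "F ` (U \<inter> \<Omega> e) \<subseteq> U \<inter> \<Omega> e" for e
  proof
    fix y assume "y \<in> F ` (U \<inter> \<Omega> e)"
    then obtain z where z: "z \<in> U" "\<And>n. norm ((F ^^ n) z) < e" "y = F z" by (auto simp: \<Omega>_def)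
    have "norm ((F ^^ n) y) < e" for n using z(2)[of "Suc n"] by (simp add: z(3) funpow_swap1)
    then show "y \<in> U \<inter> \<Omega> e" using z U(4) by (auto simp: \<Omega>_def)
  qed
  ultimately show ?thesis
    unfolding basin_of_attraction_def using U cl lim by (intro conjI exI[of _ "\<Omega> ` {0<..}"]) auto
qed

context one_resonant_germ
begin

section \<open>Assembling petals into basins\<close>

lemma mu_power_inj:
  assumes "\<mu> ^ p = \<mu> ^ p'" "p < q" "p' < q" shows "p = p'"
proof -
  have "\<not> p < p'" if "\<mu> ^ p = \<mu> ^ p'" "p < q" "p' < q" for p p'
  proof
    assume "p < p'"
    then have "\<mu> ^ p' = \<mu> ^ p * \<mu> ^ (p' - p)" by (simp flip: power_add)
    then have "\<mu> ^ (p' - p) = 1" using that mu_nonzero by simp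
    then have "q dvd p' - p" by (simp add: mu_power_eq_1_iff)
    then show False using \<open>p < p'\<close> that by (auto dest: dvd_imp_le)
  qed
  from this[OF assms] this[OF assms(1)[symmetric] assms(3,2)] show ?thesis by simp
qed

text \<open>With \<zeta> a primitive root of order \<open>k * q\<close>, the \<open>q\<close>-th
  power removes \<mu> and leaves \<open>\<zeta> ^ (h * q)\<close>. These are distinct for
  \<open>h < k\<close>, so the powers of \<zeta> with exponent below \<open>k\<close> represent
  distinct cosets of the group generated by \<mu>.\<close>

lemma roots_of_unity_cosets:
  assumes k: "k \<ge> 1"
  obtains \<zeta> :: complex where "\<And>h p. (\<mu> ^ p * \<zeta> ^ h) ^ (k * q) = 1"
    "\<And>h h' p p'. h < k \<Longrightarrow> h' < k \<Longrightarrow> p < q \<Longrightarrow> p' < q \<Longrightarrow> \<mu> ^ p * \<zeta> ^ h = \<mu> ^ p' * \<zeta> ^ h' \<Longrightarrow> h = h' \<and> p = p'"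
proof -
  define K where "K = k * q"
  have K: "K > 0" using k q(1) by (simp add: K_def)
  define \<zeta> where "\<zeta> = cis (2 * pi / real K)"
  have \<zeta>_pow: "\<zeta> ^ j = cis (2 * pi * real j / real K)" for j
    unfolding \<zeta>_def Complex.DeMoivre by (simp add: mult_ac)
  have inj: "inj_on (\<lambda>j. \<zeta> ^ j) {..<K}"
    using Complex.bij_betw_roots_unity[OF K] unfolding \<zeta>_pow bij_betw_def by blast
  have \<zeta>K: "\<zeta> ^ K = 1" using K by (simp add: \<zeta>_pow)
  show thesis
  proof (rule that[of \<zeta>])
    fix h p
    have "(\<mu> ^ p * \<zeta> ^ h) ^ K = (\<mu> ^ q) ^ (k * p) * (\<zeta> ^ K) ^ h"
      unfolding power_mult_distrib power_mult[symmetric] by (simp add: K_def mult_ac)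
    then show "(\<mu> ^ p * \<zeta> ^ h) ^ (k * q) = 1" using q(2) \<zeta>K by (simp add: K_def)
  next
    fix h h' p p' assume lt: "h < k" "h' < k" "p < q" "p' < q" and eq: "\<mu> ^ p * \<zeta> ^ h = \<mu> ^ p' * \<zeta> ^ h'"
    have raise: "(\<mu> ^ p * \<zeta> ^ h) ^ q = \<zeta> ^ (h * q)" for p h
    proof -
      have "(\<mu> ^ p * \<zeta> ^ h) ^ q = (\<mu> ^ q) ^ p * \<zeta> ^ (h * q)"
        unfolding power_mult_distrib power_mult[symmetric] by (simp add: mult.commute)
      then show ?thesis using q(2) by simp
    qed
    have "\<zeta> ^ (h * q) = \<zeta> ^ (h' * q)" using eq raise by metis
    moreover have "h * q \<in> {..<K}" "h' * q \<in> {..<K}" using lt q(1) by (auto simp: K_def)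
    ultimately have "h * q = h' * q" using inj by (meson inj_onD)
    then have h: "h = h'" using q(1) by simp
    have "\<zeta> \<noteq> 0" by (simp add: \<zeta>_def)
    then have "\<mu> ^ p = \<mu> ^ p'" using eq h by simp
    then show "h = h' \<and> p = p'" using mu_power_inj lt h by blast
  qed
qed

text \<open>Petals are constructed in the normalized coordinates for the conjugated map
  \<open>f\<close> and carried back by \<open>\<phi>\<close>. The radius is so small that
  \<open>F (\<phi> w)\<close> stays in the chart; the conjugacy is then exact on the petals, and
  orbits of \<open>F\<close> correspond to orbits of \<open>f\<close>. A basin is the union of the
  \<open>q\<close> petals of one coset.\<close>

lemma basins_exist:
  assumes k: "k \<ge> 1" and a: "a \<noteq> 0" and P: "\<And>z. cdiff_at P z" "vanishes 2 (\<lambda>z. P z - z $ i)"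
    and van: "vanishes (Suc (k * q + 1)) (\<lambda>z. P (F z) - \<mu> * P z - a * (z $ i) ^ (k * q + 1))"
  shows "\<exists>U. disjoint_family_on U {..<k} \<and>
    (\<forall>h<k. basin_of_attraction W F (U h) \<and> components_cyclically_permuted F (U h) q)"
proof -
  define \<psi> where "\<psi> z = (\<chi> j. if j = i then P z else z $ j)" for z
  obtain V where V: "V \<subseteq> W" "diffeo_germ_rep \<psi> V"
    using linearizing_coordinates[OF P W(1,2)] unfolding \<psi>_def by blast
  note D = diffeo_germ_repD[OF V(2)]
  define \<phi> where "\<phi> = inv_into V \<psi>"
  have \<phi>v: "vanishes 1 \<phi>" and \<psi>v: "vanishes 1 \<psi>"
    unfolding \<phi>_def using diffeo_germ_rep_vanishes_1[OF V(2)] by auto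
  define f where "f w = \<psi> (F (\<phi> w))" for w
  define K where "K = k * q"
  have K: "K \<ge> 1" using k q(1) by (simp add: K_def Suc_le_eq)
  have \<psi>i: "\<psi> z $ i = P z" and \<psi>j: "j \<noteq> i \<Longrightarrow> \<psi> z $ j = z $ j" for z j by (auto simp: \<psi>_def)
  have inV: "\<forall>\<^sub>F w in nhds 0. w \<in> \<psi> ` V" using D by (intro eventually_nhds_in_open)
  \<comment> \<open>Factoring out \<open>\<mu> * w $ i\<close> turns the coefficient
    \<open>a\<close> into \<open>a / \<mu>\<close>, which plays the role of \<open>b\<close> for the
    petals.\<close>
  have fi: "vanishes (K + 2) (\<lambda>w. f w $ i - \<mu> * w $ i * (1 + (a / \<mu>) * (w $ i) ^ K))"
    using leading_term_in_coordinates[OF V(2) \<psi>i P(2) van] mu_nonzero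
    by (simp add: f_def \<phi>_def K_def algebra_simps)
  have fj: "vanishes 2 (\<lambda>w. f w $ j - lam $ j * w $ j)" if j: "j \<noteq> i" for j
  proof -
    have "vanishes 2 (\<lambda>w. F (\<phi> w) $ j - lam $ j * \<phi> w $ j)"
      by (rule vanishes_compose[OF F_linear_part \<phi>v])
    then show ?thesis
    proof (rule vanishes_eventually_cong)
      show "\<forall>\<^sub>F w in nhds 0. f w $ j - lam $ j * w $ j = F (\<phi> w) $ j - lam $ j * \<phi> w $ j"
        using inV
      proof eventually_elim
        case (elim w)
        have "\<psi> (\<phi> w) = w" unfolding \<phi>_def by (rule f_inv_into_f[OF elim])
        then have "\<phi> w $ j = w $ j" using \<psi>j[OF j, of "\<phi> w"] by simp
        then show ?case by (simp add: f_def \<psi>j[OF j])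
      qed
    qed
  qed
  obtain C1 where C1: "C1 > 0" "\<forall>\<^sub>F w in nhds 0. norm (\<phi> w) \<le> C1 * norm w ^ 1" using \<phi>v by (rule vanishesE)
  obtain C2 where C2: "C2 > 0" "\<forall>\<^sub>F z in nhds 0. norm (\<psi> z) \<le> C2 * norm z ^ 1" using \<psi>v by (rule vanishesE)
  have "\<forall>\<^sub>F w in nhds 0. F (\<phi> w) \<in> V"
  proof -
    have "((\<lambda>w. F (\<phi> w)) \<longlongrightarrow> 0) (nhds 0)"
      by (rule vanishes_1_tendsto[OF vanishes_compose[OF vanishes_F \<phi>v]])
    then show ?thesis using topological_tendstoD D(1,2) by blast
  qed
  moreover have "\<forall>\<^sub>F w in nhds 0. norm (\<psi> (\<phi> w)) \<le> C2 * norm (\<phi> w) ^ 1"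
    using filterlim_iff[THEN iffD1, OF vanishes_1_tendsto[OF \<phi>v]] C2(2) by blast
  ultimately have "\<forall>\<^sub>F w in nhds 0. w \<in> \<psi> ` V \<and> F (\<phi> w) \<in> V \<and> norm (\<phi> w) \<le> C1 * norm w \<and> norm (\<psi> (\<phi> w)) \<le> C2 * norm (\<phi> w)"
    using inV C1(2) by eventually_elim simp
  then obtain r where r: "r > 0" and "\<forall>w. dist w 0 < r \<longrightarrow>
      w \<in> \<psi> ` V \<and> F (\<phi> w) \<in> V \<and> norm (\<phi> w) \<le> C1 * norm w \<and> norm (\<psi> (\<phi> w)) \<le> C2 * norm (\<phi> w)"
    unfolding eventually_nhds_metric by blast
  then have rw: "w \<in> \<psi> ` V" "F (\<phi> w) \<in> V" "norm (\<phi> w) \<le> C1 * norm w" "norm (\<psi> (\<phi> w)) \<le> C2 * norm (\<phi> w)"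
    if "w \<in> ball 0 r" for w using that by auto
  have b0: "a / \<mu> \<noteq> 0" using a mu_nonzero by simp
  have \<mu>K: "\<mu> ^ K = 1" using mu_power_eq_1_iff by (simp add: K_def)
  obtain B M where B1: "\<And>\<omega>. \<omega> ^ K = 1 \<Longrightarrow> open (B \<omega>) \<and> connected (B \<omega>) \<and> B \<omega> \<noteq> {} \<and> B \<omega> \<subseteq> ball 0 r \<and> f ` B \<omega> \<subseteq> B (\<mu> * \<omega>)"
    and B2: "\<And>\<omega> \<omega>'. \<omega> ^ K = 1 \<Longrightarrow> \<omega>' ^ K = 1 \<Longrightarrow> \<omega> \<noteq> \<omega>' \<Longrightarrow> B \<omega> \<inter> B \<omega>' = {}"
    and B3: "\<And>\<omega> w n. \<omega> ^ K = 1 \<Longrightarrow> w \<in> B \<omega> \<Longrightarrow> norm ((f ^^ n) w) \<le> M * norm w"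
    and B4: "\<And>\<omega> w. \<omega> ^ K = 1 \<Longrightarrow> w \<in> B \<omega> \<Longrightarrow> (\<lambda>n. (f ^^ n) w) \<longlonglongrightarrow> 0"
    by (rule petals[OF K b0 \<mu>K attracting fi fj r], assumption, assumption, rule that)
  have Br: "w \<in> ball 0 r" if "\<omega> ^ K = 1" "w \<in> B \<omega>" for \<omega> w using B1 that by blast
  define E where "E \<omega> = \<phi> ` B \<omega>" for \<omega>
  have \<phi>V: "\<phi> w \<in> V" "\<psi> (\<phi> w) = w" if "w \<in> \<psi> ` V" for w
    using that by (auto simp: \<phi>_def inv_into_into f_inv_into_f)
  have \<phi>\<psi>: "\<phi> (\<psi> z) = z" if "z \<in> V" for z using that D(4) by (simp add: \<phi>_def inv_into_f_f)
  have F\<phi>: "F (\<phi> w) = \<phi> (f w)" if "w \<in> ball 0 r" for w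
    unfolding f_def using \<phi>\<psi>[OF rw(2)[OF that]] by simp
  have \<mu>\<omega>: "(\<mu> * \<omega>) ^ K = 1" "(\<mu> ^ n * \<omega>) ^ K = 1" if "\<omega> ^ K = 1" for \<omega> n
    using that \<mu>K by (auto simp: power_mult_distrib) (metis mult.commute power_mult power_one)
  have orbit: "(f ^^ n) w \<in> B (\<mu> ^ n * \<omega>) \<and> (F ^^ n) (\<phi> w) = \<phi> ((f ^^ n) w)" if \<omega>: "\<omega> ^ K = 1" and w: "w \<in> B \<omega>" for n w \<omega>
  proof (induction n)
    case (Suc n)
    have "(f ^^ Suc n) w \<in> B (\<mu> * (\<mu> ^ n * \<omega>))" using Suc B1[OF \<mu>\<omega>(2)[OF \<omega>, of n]] by auto
    moreover have "(F ^^ Suc n) (\<phi> w) = \<phi> ((f ^^ Suc n) w)"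
      using Suc F\<phi>[OF Br[OF \<mu>\<omega>(2)[OF \<omega>]]] by auto
    ultimately show ?case by (simp add: mult_ac)
  qed (use w in simp)
  have EV: "E \<omega> \<subseteq> V" if "\<omega> ^ K = 1" for \<omega> unfolding E_def using \<phi>V(1) rw(1) Br[OF that] by blast
  \<comment> \<open>The image form gives connectedness, the preimage form openness and
    disjointness.\<close>
  have E_eq: "E \<omega> = V \<inter> \<psi> -` B \<omega>" if "\<omega> ^ K = 1" for \<omega>
  proof
    show "E \<omega> \<subseteq> V \<inter> \<psi> -` B \<omega>" unfolding E_def using \<phi>V rw(1) Br[OF that] by auto
    show "V \<inter> \<psi> -` B \<omega> \<subseteq> E \<omega>" unfolding E_def using \<phi>\<psi> by force
  qed
  have E1: "open (E \<omega>)" "connected (E \<omega>)" "E \<omega> \<noteq> {}" "F ` E \<omega> \<subseteq> E (\<mu> * \<omega>)" if \<omega>: "\<omega> ^ K = 1" for \<omega>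
  proof -
    show "open (E \<omega>)" unfolding E_eq[OF \<omega>]
      using cdiff_imp_continuous_on[of V \<psi>] D(8) D(1) B1[OF \<omega>] by (intro continuous_open_preimage) auto
    have "continuous_on (B \<omega>) \<phi>"
    proof (rule cdiff_imp_continuous_on)
      fix w j assume "w \<in> B \<omega>"
      then show "cdiff_at (\<lambda>w. \<phi> w $ j) w" unfolding \<phi>_def using D(9) rw(1) Br[OF \<omega>] by blast
    qed
    then show "connected (E \<omega>)" unfolding E_def using B1[OF \<omega>] connected_continuous_image by blast
    show "E \<omega> \<noteq> {}" using B1[OF \<omega>] by (simp add: E_def)
    show "F ` E \<omega> \<subseteq> E (\<mu> * \<omega>)"
      unfolding E_def using F\<phi>[OF Br[OF \<omega>]] B1[OF \<omega>] by (auto simp: image_subset_iff)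
  qed
  have E2: "E \<omega> \<inter> E \<omega>' = {}" if "\<omega> ^ K = 1" "\<omega>' ^ K = 1" "\<omega> \<noteq> \<omega>'" for \<omega> \<omega>'
    using B2[OF that] unfolding E_eq[OF that(1)] E_eq[OF that(2)] by blast
  have E3: "norm ((F ^^ n) z) \<le> (C1 * \<bar>M\<bar> * C2) * norm z" if \<omega>: "\<omega> ^ K = 1" and z: "z \<in> E \<omega>" for \<omega> z n
  proof -
    obtain w where w: "w \<in> B \<omega>" "z = \<phi> w" using z by (auto simp: E_def)
    have wr: "w \<in> ball 0 r" "(f ^^ n) w \<in> ball 0 r"
      using Br[OF \<omega> w(1)] orbit[OF \<omega> w(1), of n] Br[OF \<mu>\<omega>(2)[OF \<omega>]] by blast+
    have "norm ((F ^^ n) z) \<le> C1 * norm ((f ^^ n) w)"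
      using orbit[OF \<omega> w(1), of n] rw(3)[OF wr(2)] w(2) by simp
    also have "\<dots> \<le> C1 * (\<bar>M\<bar> * norm w)"
    proof (rule mult_left_mono)
      show "norm ((f ^^ n) w) \<le> \<bar>M\<bar> * norm w"
        using B3[OF \<omega> w(1), of n] mult_right_mono[OF abs_ge_self[of M] norm_ge_zero[of w]] by linarith
    qed (use C1 in simp)
    also have "\<dots> \<le> C1 * (\<bar>M\<bar> * (C2 * norm z))"
      using rw(4)[OF wr(1)] \<phi>V(2)[OF rw(1)[OF wr(1)]] w(2) C1(1) by (intro mult_left_mono) auto
    finally show ?thesis by (simp add: mult_ac)
  qed
  have E4: "(\<lambda>n. (F ^^ n) z) \<longlonglongrightarrow> 0" if \<omega>: "\<omega> ^ K = 1" and z: "z \<in> E \<omega>" for \<omega> z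
  proof -
    obtain w where w: "w \<in> B \<omega>" "z = \<phi> w" using z by (auto simp: E_def)
    have "(\<lambda>n. \<phi> ((f ^^ n) w)) \<longlonglongrightarrow> 0"
      by (rule filterlim_compose[OF vanishes_1_tendsto[OF \<phi>v] B4[OF \<omega> w(1)]])
    then show ?thesis using orbit[OF \<omega> w(1)] w(2) by simp
  qed
  obtain \<zeta> :: complex where \<zeta>0: "\<And>h p. (\<mu> ^ p * \<zeta> ^ h) ^ (k * q) = 1"
    and \<zeta>2: "\<And>h h' p p'. h < k \<Longrightarrow> h' < k \<Longrightarrow> p < q \<Longrightarrow> p' < q \<Longrightarrow> \<mu> ^ p * \<zeta> ^ h = \<mu> ^ p' * \<zeta> ^ h' \<Longrightarrow> h = h' \<and> p = p'"
    by (rule roots_of_unity_cosets[OF k], rule that)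
  have \<zeta>1: "(\<mu> ^ p * \<zeta> ^ h) ^ K = 1" for h p unfolding K_def by (rule \<zeta>0)
  define U where "U h = (\<Union>p<q. E (\<mu> ^ p * \<zeta> ^ h))" for h
  have "disjoint_family_on U {..<k}"
    unfolding disjoint_family_on_def
  proof (intro ballI impI)
    fix h h' assume h: "h \<in> {..<k}" "h' \<in> {..<k}" "h \<noteq> h'"
    have "E (\<mu> ^ p * \<zeta> ^ h) \<inter> E (\<mu> ^ p' * \<zeta> ^ h') = {}" if "p < q" "p' < q" for p p'
      using \<zeta>2[of h h' p p'] h that by (intro E2 \<zeta>1) auto
    then show "U h \<inter> U h' = {}" unfolding U_def by blast
  qed
  moreover have "basin_of_attraction W F (U h)" "components_cyclically_permuted F (U h) q" if h: "h < k" for h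
  proof -
    define A where "A p = E (\<mu> ^ p * \<zeta> ^ h)" for p
    have FA: "F ` A p \<subseteq> A (Suc p mod q)" if "p < q" for p
    proof -
      \<comment> \<open>The cycle closes because \<open>\<mu> ^ q = 1\<close>, so exponents of \<mu>
        may be reduced modulo \<open>q\<close>.\<close>
      have "A (Suc p mod q) = E (\<mu> * (\<mu> ^ p * \<zeta> ^ h))" by (simp add: A_def mu_power_mod mult_ac)
      then show ?thesis using E1(4)[OF \<zeta>1] by (simp add: A_def)
    qed
    have UA: "U h = \<Union> (A ` {..<q})" by (simp add: U_def A_def)
    have FU: "F ` U h \<subseteq> U h"
    proof
      fix y assume "y \<in> F ` U h"
      then obtain p z where "p < q" "z \<in> A p" "y = F z" by (auto simp: UA)
      then have "y \<in> A (Suc p mod q)" using FA by blast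
      moreover have "Suc p mod q < q" using q(1) by simp
      ultimately show "y \<in> U h" unfolding UA by blast
    qed
    show "basin_of_attraction W F (U h)"
    proof (rule basin_of_attractionI[where M = "C1 * \<bar>M\<bar> * C2"])
      show "open (U h)" unfolding U_def using E1(1)[OF \<zeta>1] by blast
      have "0 < q" using q(1) by simp
      then show "U h \<noteq> {}" unfolding U_def using E1(3)[OF \<zeta>1] by blast
      show "U h \<subseteq> W" unfolding U_def using EV[OF \<zeta>1] V(1) by blast
      show "F ` U h \<subseteq> U h" by (rule FU)
      show "norm ((F ^^ n) z) \<le> C1 * \<bar>M\<bar> * C2 * norm z" if "z \<in> U h" for z n
        using that E3[OF \<zeta>1] unfolding U_def by blast
      show "(\<lambda>n. (F ^^ n) z) \<longlonglongrightarrow> 0" if "z \<in> U h" for z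
        using that E4[OF \<zeta>1] unfolding U_def by blast
    qed
    have disj: "A p \<inter> A p' = {}" if "p < q" "p' < q" "p \<noteq> p'" for p p'
    proof -
      have "\<mu> ^ p * \<zeta> ^ h \<noteq> \<mu> ^ p' * \<zeta> ^ h" using \<zeta>2[OF h h that(1,2)] that(3) by blast
      then show ?thesis unfolding A_def by (rule E2[OF \<zeta>1 \<zeta>1])
    qed
    have "components (U h) = A ` {..<q}"
    proof (rule components_open_unique)
      show "pairwise disjnt (A ` {..<q})" unfolding pairwise_def disjnt_def using disj by auto
      show "\<Union> (A ` {..<q}) = U h" by (simp add: UA)
      show "open X \<and> connected X \<and> X \<noteq> {}" if "X \<in> A ` {..<q}" for X
        using that E1[OF \<zeta>1] by (auto simp: A_def)
    qed
    moreover have "inj_on A {..<q}"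
    proof (rule inj_onI, rule ccontr)
      fix p p' assume p: "p \<in> {..<q}" "p' \<in> {..<q}" "A p = A p'" "p \<noteq> p'"
      then have "A p = {}" using disj[of p p'] by simp
      then show False using E1(3)[OF \<zeta>1] by (simp add: A_def)
    qed
    ultimately have "bij_betw A {..<q} (components (U h))" by (simp add: bij_betw_def)
    then show "components_cyclically_permuted F (U h) q"
      unfolding components_cyclically_permuted_def using FA by blast
  qed
  ultimately show ?thesis by blast
qed

text \<open>The same \<open>P\<close> is used twice: as a coordinate it certifies the leading term,
  so that uniqueness identifies the order with \<open>k\<close>, and it is the input to the
  construction of the \<open>k\<close> basins.\<close>

lemma resonance_order_finite:
  assumes "\<not> formally_linearizable_comp i \<mu> F"
  shows "\<exists>k. resonance_order i \<mu> q F = enat k \<and>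
    (\<exists>U. disjoint_family_on U {..<k} \<and>
      (\<forall>h<k. basin_of_attraction W F (U h) \<and> components_cyclically_permuted F (U h) q))"
proof -
  obtain k P a where k: "k \<ge> 1" and a: "a \<noteq> 0" and P: "\<And>z. cdiff_at P z" "vanishes 2 (\<lambda>z. P z - z $ i)"
    and van: "vanishes (Suc (k * q + 1)) (\<lambda>z. P (F z) - \<mu> * P z - a * (z $ i) ^ (k * q + 1))"
    by (rule formal_dichotomy[OF assms], rule that)
  obtain V where V: "V \<subseteq> W" "diffeo_germ_rep (\<lambda>z. \<chi> j. if j = i then P z else z $ j) V"
    using linearizing_coordinates[OF P W(1,2)] by blast
  have lt: "has_leading_term i \<mu> q F k"
    by (rule has_leading_termI[OF V(2) _ a P(2) van]) simp
  have "(THE k. k \<ge> 1 \<and> has_leading_term i \<mu> q F k) = k"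
    by (rule the_equality) (use k lt has_leading_term_unique in blast)+
  then have "resonance_order i \<mu> q F = enat k" using assms by (simp add: resonance_order_def)
  then show ?thesis using basins_exist[OF k a P van] by blast
qed

end

theorem corollary6p1:
  fixes F :: "complex ^ 'n::finite \<Rightarrow> complex ^ 'n" and W :: "(complex ^ 'n) set"
    and lam :: "complex ^ 'n" and i :: 'n and q :: nat
  assumes germ: "diffeo_germ_rep F W"
    and diag: "(F has_derivative (\<lambda>v. \<chi> j. lam $ j * v $ j)) (at 0)"
    and q: "q \<ge> 1" "(lam $ i) ^ q = 1" "\<And>l. 1 \<le> l \<Longrightarrow> l \<le> q - 1 \<Longrightarrow> (lam $ i) ^ l \<noteq> 1"
    and attracting: "\<And>j. j \<noteq> i \<Longrightarrow> norm (lam $ j) < 1"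
  shows "one_resonant_index lam i (\<lambda>j. q * mi_unit i j) \<and>
    ((\<exists>k. resonance_order i (lam $ i) q F = enat k \<and>
        (\<exists>U. disjoint_family_on U {..<k} \<and>
           (\<forall>h<k. basin_of_attraction W F (U h) \<and> components_cyclically_permuted F (U h) q)))
     \<or> (resonance_order i (lam $ i) q F = \<infinity> \<and> formally_linearizable_comp i (lam $ i) F)) \<and>
    (resonance_order i (lam $ i) q F = \<infinity> \<and> formally_linearizable_comp i (lam $ i) F
       \<longleftrightarrow> fixed_curve_germ (F ^^ q))"
proof -
  interpret one_resonant_germ F W lam i q
    by unfold_locales (use assms in auto)
  have inf: "resonance_order i (lam $ i) q F = \<infinity>" if "formally_linearizable_comp i (lam $ i) F"
    using that by (simp add: resonance_order_def)
  show ?thesis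
    using one_resonant inf resonance_order_finite formally_linearizable_imp_fixed_curve
      fixed_curve_imp_formally_linearizable by blast
qed

end
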